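(* Let $(M,\Omega,\omega)$ be a compact LCS manifold. Assume that the LCS flux homomorphism $\widetilde{\Psi}:\widetilde{(\ker\Phi)}_0\to H^1_\omega(M)$ is surjective onto some subgroup containing the period group $\Delta:=\widetilde{\Psi}(\pi_1((\ker\Phi)_0))$, and that $\Delta$ is a discrete subgroup of $H^1_\omega(M)$. Let $\mathrm{Ham}_\Omega(M):=\tilde{\pi}(\ker\widetilde{\Psi})\subset(\ker\Phi)_0$, where $\tilde{\pi}:\widetilde{(\ker\Phi)}_0\to(\ker\Phi)_0$ is the covering projection, let $i$ be the inclusion of $\mathrm{Ham}_\Omega(M)$ in $(\ker\Phi)_0$, and let $\mathcal{F}:(\ker\Phi)_0\to H^1_\omega(M)/\Delta$ be the induced flux homomorphism. Assume $\operatorname{Im}(\mathcal{F})=H^1_\omega(M)/\Delta$. Then there is a short exact sequence of groups $$1\longrightarrow \mathrm{Ham}_\Omega(M)\xrightarrow{\ i\ }(\ker\Phi)_0\xrightarrow{\ \mathcal{F}\ }H^1_\omega(M)/\Delta\longrightarrow 1 .$$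
   Context: An LCS (locally conformally symplectic) manifold $(M,\Omega,\omega)$ is a smooth $2n$-dimensional manifold $M$ with a non-degenerate 2-form $\Omega$ and a closed 1-form $\omega$ (the Lee form) such that $d\Omega=-\omega\wedge\Omega$. Put $d^\omega\alpha:=d\alpha+\omega\wedge\alpha$; then $d^\omega\circ d^\omega=0$, and $H^p_\omega(M)$ denotes the $p$-th cohomology of $(\Omega^*(M),d^\omega)$ (Lichnerowicz cohomology), with $[\alpha]_\omega$ the class of a $d^\omega$-closed form $\alpha$. An LCS diffeomorphism is a diffeomorphism $g$ of $M$ such that $g^*\Omega=a^{-1}\Omega$ and $g^*\omega=\omega+d(\ln a)$ for some smooth $a:M\to\mathbb{R}_{>0}$. $\mathrm{Diff}_\Omega(M)$ is the group of compactly supported LCS diffeomorphisms and $\mathrm{Diff}_{\Omega,0}(M)$ its identity component. Its Lie algebra $\mathcal{X}_{c,\omega}(M)$ consists of compactly supported vector fields $X$ with $L_X\Omega=-f\Omega$, $L_X\omega=df$ for some function $f$. The Lie subalgebra $\ker\Phi\subset\mathcal{X}_{c,\omega}(M)$ consists of those $X$ with $f=\omega(X)$, equivalently those $X$ for which $i_X\Omega$ is $d^\omega$-closed. $(\ker\Phi)_0$ is the identity component of the subgroup of $\mathrm{Diff}_{\Omega,0}(M)$ whose Lie algebra is $\ker\Phi$; smooth paths $\{g_t\}$ in it with $g_0=\mathrm{id}$ are generated by $X_t\in\ker\Phi$ via $\frac{d}{dt}g_t=X_t\circ g_t$. Its universal cover $\widetilde{(\ker\Phi)}_0$ is the group of homotopy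 classes relative to endpoints of such paths on $[0,1]$ starting at the identity. The LCS flux homomorphism is $\widetilde{\Psi}([\{g_t\}])=\left[\int_0^1 i_{X_t}\Omega\,dt\right]_\omega\in H^1_\omega(M)$. "Discrete" means there is an open neighborhood $U$ of $0$ in $H^1_\omega(M)$ with $U\cap\Delta=\{0\}$. The induced flux homomorphism is $\mathcal{F}(g):=\widetilde{\Psi}([\{g_t\}])+\Delta$ for any path $\{g_t\}$ in $(\ker\Phi)_0$ from $\mathrm{id}$ to $g$. *)

theory Defs
  imports "HOL-Analysis.Analysis" "HOL-Algebra.Elementary_Groups"
begin

section \<open>Smooth maps between Euclidean spaces\<close>

text \<open>Continuous differentiability of order \<open>k\<close>; meant for open \<open>S\<close>.\<close>

primrec Ck_on :: "nat \<Rightarrow> 'a::euclidean_space set \<Rightarrow> ('a \<Rightarrow> 'b::real_normed_vector) \<Rightarrow> bool" where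
  "Ck_on 0 S f \<longleftrightarrow> continuous_on S f"
| "Ck_on (Suc k) S f \<longleftrightarrow> (\<forall>x\<in>S. f differentiable (at x)) \<and>
     (\<forall>v. Ck_on k S (\<lambda>x. frechet_derivative f (at x) v))"

text \<open>On a set \<open>S\<close> that need not be open (for instance a product of \<open>{0..1}\<close> with an open set),
  smooth means that \<open>f\<close> extends, near every point of \<open>S\<close>, to a smooth map on an open set.\<close>

definition smooth_on :: "'a::euclidean_space set \<Rightarrow> ('a \<Rightarrow> 'b::real_normed_vector) \<Rightarrow> bool" where
  "smooth_on S f \<longleftrightarrow> (\<forall>x\<in>S. \<exists>U g. open U \<and> x \<in> U \<and> (\<forall>k. Ck_on k U g) \<and> (\<forall>y\<in>S \<inter> U. f y = g y))"


section \<open>Smooth manifolds\<close>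

text \<open>A manifold is a Hausdorff second countable type \<open>'m\<close> together with an atlas of charts with
  values in a Euclidean space \<open>'e\<close>. A chart is a pair of its domain and its coordinate map.\<close>

type_synonym ('m, 'e) chart = "'m set \<times> ('m \<Rightarrow> 'e)"

definition chart_inv :: "('m, 'e) chart \<Rightarrow> 'e \<Rightarrow> 'm" where
  "chart_inv c = inv_into (fst c) (snd c)"

definition smooth_atlas ::
  "('m::{t2_space,second_countable_topology}, 'e::euclidean_space) chart set \<Rightarrow> bool" where
  "smooth_atlas A \<longleftrightarrow>
     (\<forall>c\<in>A. open (fst c) \<and> open (snd c ` fst c) \<and>
        homeomorphism (fst c) (snd c ` fst c) (snd c) (chart_inv c)) \<and>
     (\<Union>c\<in>A. fst c) = UNIV \<and>
     (\<forall>c\<in>A. \<forall>d\<in>A. smooth_on (snd c ` (fst c \<inter> fst d)) (snd d \<circ> chart_inv c))"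

definition charts_at :: "('m, 'e) chart set \<Rightarrow> 'm \<Rightarrow> ('m, 'e) chart set" where
  "charts_at A x = {c \<in> A. x \<in> fst c}"

definition chart_at :: "('m, 'e) chart set \<Rightarrow> 'm \<Rightarrow> ('m, 'e) chart" where
  "chart_at A x = (SOME c. c \<in> charts_at A x)"

text \<open>The derivative at \<open>x\<close>, in direction \<open>v\<close>, of \<open>F\<close> read in the chart \<open>c\<close>.\<close>

definition chart_deriv ::
  "('m, 'e::euclidean_space) chart \<Rightarrow> ('m \<Rightarrow> 'b::real_normed_vector) \<Rightarrow> 'm \<Rightarrow> 'e \<Rightarrow> 'b" where
  "chart_deriv c F x = frechet_derivative (F \<circ> chart_inv c) (at (snd c x))"

definition smooth_functions :: "('m, 'e::euclidean_space) chart set \<Rightarrow> ('m \<Rightarrow> real) set" where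
  "smooth_functions A = {f. \<forall>c\<in>A. smooth_on (snd c ` fst c) (f \<circ> chart_inv c)}"


section \<open>Vector fields and differential forms\<close>

text \<open>Tensor fields are given by their coordinate representatives: \<open>X c x\<close> is the coordinate vector
  in the chart \<open>c\<close> of the value of the vector field \<open>X\<close> at \<open>x\<close>, and \<open>\<alpha> c x v w\<close> is the value of the
  form \<open>\<alpha>\<close> at \<open>x\<close> on the tangent vectors with coordinates \<open>v\<close>, \<open>w\<close> in the chart \<open>c\<close>. Representatives
  in different charts are related by the derivative of the change of coordinates. They are \<open>0\<close>
  at points outside the domain of the chart, so that equal tensor fields are equal functions.\<close>

type_synonym ('m, 'e) vfield = "('m, 'e) chart \<Rightarrow> 'm \<Rightarrow> 'e"
type_synonym ('m, 'e) form1 = "('m, 'e) chart \<Rightarrow> 'm \<Rightarrow> 'e \<Rightarrow> real"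
type_synonym ('m, 'e) form2 = "('m, 'e) chart \<Rightarrow> 'm \<Rightarrow> 'e \<Rightarrow> 'e \<Rightarrow> real"
type_synonym ('m, 'e) form3 = "('m, 'e) chart \<Rightarrow> 'm \<Rightarrow> 'e \<Rightarrow> 'e \<Rightarrow> 'e \<Rightarrow> real"

definition vector_fields :: "('m, 'e::euclidean_space) chart set \<Rightarrow> ('m, 'e) vfield set" where
  "vector_fields A = {X.
     (\<forall>c\<in>A. smooth_on (snd c ` fst c) (X c \<circ> chart_inv c)) \<and>
     (\<forall>x. \<forall>c\<in>charts_at A x. \<forall>d\<in>charts_at A x. X d x = chart_deriv c (snd d) x (X c x)) \<and>
     (\<forall>x c. c \<notin> charts_at A x \<longrightarrow> X c x = 0)}"

definition one_forms :: "('m, 'e::euclidean_space) chart set \<Rightarrow> ('m, 'e) form1 set" where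
  "one_forms A = {\<alpha>.
     (\<forall>c\<in>A. \<forall>v. smooth_on (snd c ` fst c) (\<lambda>y. \<alpha> c (chart_inv c y) v)) \<and>
     (\<forall>x. \<forall>c\<in>charts_at A x. linear (\<alpha> c x)) \<and>
     (\<forall>x. \<forall>c\<in>charts_at A x. \<forall>d\<in>charts_at A x. \<forall>v.
        \<alpha> c x v = \<alpha> d x (chart_deriv c (snd d) x v)) \<and>
     (\<forall>x c v. c \<notin> charts_at A x \<longrightarrow> \<alpha> c x v = 0)}"

definition two_forms :: "('m, 'e::euclidean_space) chart set \<Rightarrow> ('m, 'e) form2 set" where
  "two_forms A = {\<Omega>.
     (\<forall>c\<in>A. \<forall>v w. smooth_on (snd c ` fst c) (\<lambda>y. \<Omega> c (chart_inv c y) v w)) \<and>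
     (\<forall>x. \<forall>c\<in>charts_at A x. bilinear (\<Omega> c x) \<and> (\<forall>v. \<Omega> c x v v = 0)) \<and>
     (\<forall>x. \<forall>c\<in>charts_at A x. \<forall>d\<in>charts_at A x. \<forall>v w.
        \<Omega> c x v w = \<Omega> d x (chart_deriv c (snd d) x v) (chart_deriv c (snd d) x w)) \<and>
     (\<forall>x c v w. c \<notin> charts_at A x \<longrightarrow> \<Omega> c x v w = 0)}"

definition d0 :: "('m, 'e::euclidean_space) chart set \<Rightarrow> ('m \<Rightarrow> real) \<Rightarrow> ('m, 'e) form1" where
  "d0 A f = (\<lambda>c x v. if c \<in> charts_at A x then chart_deriv c f x v else 0)"

definition d1 :: "('m, 'e::euclidean_space) chart set \<Rightarrow> ('m, 'e) form1 \<Rightarrow> ('m, 'e) form2" where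
  "d1 A \<alpha> = (\<lambda>c x v w. if c \<in> charts_at A x
     then chart_deriv c (\<lambda>z. \<alpha> c z w) x v - chart_deriv c (\<lambda>z. \<alpha> c z v) x w
     else 0)"

definition d2 :: "('m, 'e::euclidean_space) chart set \<Rightarrow> ('m, 'e) form2 \<Rightarrow> ('m, 'e) form3" where
  "d2 A \<Omega> = (\<lambda>c x u v w. if c \<in> charts_at A x
     then chart_deriv c (\<lambda>z. \<Omega> c z v w) x u - chart_deriv c (\<lambda>z. \<Omega> c z u w) x v
        + chart_deriv c (\<lambda>z. \<Omega> c z u v) x w
     else 0)"

definition wedge11 :: "('m, 'e) form1 \<Rightarrow> ('m, 'e) form1 \<Rightarrow> ('m, 'e) form2" where
  "wedge11 \<alpha> \<beta> = (\<lambda>c x v w. \<alpha> c x v * \<beta> c x w - \<alpha> c x w * \<beta> c x v)"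

definition wedge12 :: "('m, 'e) form1 \<Rightarrow> ('m, 'e) form2 \<Rightarrow> ('m, 'e) form3" where
  "wedge12 \<alpha> \<Omega> = (\<lambda>c x u v w. \<alpha> c x u * \<Omega> c x v w - \<alpha> c x v * \<Omega> c x u w + \<alpha> c x w * \<Omega> c x u v)"

definition contract1 ::
  "('m, 'e) chart set \<Rightarrow> ('m, 'e) form1 \<Rightarrow> ('m, 'e) vfield \<Rightarrow> 'm \<Rightarrow> real" where
  "contract1 A \<alpha> X = (\<lambda>x. \<alpha> (chart_at A x) x (X (chart_at A x) x))"

definition contract2 :: "('m, 'e) form2 \<Rightarrow> ('m, 'e) vfield \<Rightarrow> ('m, 'e) form1" where
  "contract2 \<Omega> X = (\<lambda>c x v. \<Omega> c x (X c x) v)"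

text \<open>In coordinates \<open>(L\<^sub>X \<alpha>)(v) = D\<alpha>(X)(v) + \<alpha>(DX(v))\<close>, and similarly for 2-forms.\<close>

definition lie1 ::
  "('m, 'e::euclidean_space) chart set \<Rightarrow> ('m, 'e) vfield \<Rightarrow> ('m, 'e) form1 \<Rightarrow> ('m, 'e) form1" where
  "lie1 A X \<alpha> = (\<lambda>c x v. if c \<in> charts_at A x
     then chart_deriv c (\<lambda>z. \<alpha> c z v) x (X c x) + \<alpha> c x (chart_deriv c (X c) x v)
     else 0)"

definition lie2 ::
  "('m, 'e::euclidean_space) chart set \<Rightarrow> ('m, 'e) vfield \<Rightarrow> ('m, 'e) form2 \<Rightarrow> ('m, 'e) form2" where
  "lie2 A X \<Omega> = (\<lambda>c x v w. if c \<in> charts_at A x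
     then chart_deriv c (\<lambda>z. \<Omega> c z v w) x (X c x)
        + \<Omega> c x (chart_deriv c (X c) x v) w + \<Omega> c x v (chart_deriv c (X c) x w)
     else 0)"


section \<open>Diffeomorphisms and pullback\<close>

definition smooth_map ::
  "('m::topological_space, 'e::euclidean_space) chart set \<Rightarrow> ('m \<Rightarrow> 'm) \<Rightarrow> bool" where
  "smooth_map A g \<longleftrightarrow> continuous_on UNIV g \<and>
     (\<forall>c\<in>A. \<forall>d\<in>A. smooth_on (snd c ` (fst c \<inter> g -` fst d)) (snd d \<circ> g \<circ> chart_inv c))"

definition diffeo ::
  "('m::topological_space, 'e::euclidean_space) chart set \<Rightarrow> ('m \<Rightarrow> 'm) \<Rightarrow> bool" where
  "diffeo A g \<longleftrightarrow> bij g \<and> smooth_map A g \<and> smooth_map A (inv_into UNIV g)"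

text \<open>Below, \<open>chart_deriv c (snd d \<circ> g) x\<close> is the tangent map of \<open>g\<close> at \<open>x\<close> in the charts \<open>c\<close> (at \<open>x\<close>)
  and \<open>d\<close> (at \<open>g x\<close>); the value of the pullback does not depend on the choice of \<open>d\<close>.\<close>

definition pullback1 ::
  "('m, 'e::euclidean_space) chart set \<Rightarrow> ('m \<Rightarrow> 'm) \<Rightarrow> ('m, 'e) form1 \<Rightarrow> ('m, 'e) form1" where
  "pullback1 A g \<alpha> = (\<lambda>c x v. if c \<in> charts_at A x
     then let d = chart_at A (g x) in \<alpha> d (g x) (chart_deriv c (snd d \<circ> g) x v)
     else 0)"

definition pullback2 ::
  "('m, 'e::euclidean_space) chart set \<Rightarrow> ('m \<Rightarrow> 'm) \<Rightarrow> ('m, 'e) form2 \<Rightarrow> ('m, 'e) form2" where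
  "pullback2 A g \<Omega> = (\<lambda>c x v w. if c \<in> charts_at A x
     then let d = chart_at A (g x)
       in \<Omega> d (g x) (chart_deriv c (snd d \<circ> g) x v) (chart_deriv c (snd d \<circ> g) x w)
     else 0)"


section \<open>LCS manifolds and Lichnerowicz cohomology\<close>

definition lcs_manifold ::
  "('m::{t2_space,second_countable_topology}, 'e::euclidean_space) chart set \<Rightarrow>
   ('m, 'e) form2 \<Rightarrow> ('m, 'e) form1 \<Rightarrow> bool" where
  "lcs_manifold A \<Omega> \<omega> \<longleftrightarrow> smooth_atlas A \<and> even DIM('e) \<and>
     \<Omega> \<in> two_forms A \<and> (\<forall>x. \<forall>c\<in>charts_at A x. \<forall>v. v \<noteq> 0 \<longrightarrow> (\<exists>w. \<Omega> c x v w \<noteq> 0)) \<and>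
     \<omega> \<in> one_forms A \<and> d1 A \<omega> = (\<lambda>c x v w. 0) \<and>
     d2 A \<Omega> = (\<lambda>c x u v w. - wedge12 \<omega> \<Omega> c x u v w)"

definition dw0 ::
  "('m, 'e::euclidean_space) chart set \<Rightarrow> ('m, 'e) form1 \<Rightarrow> ('m \<Rightarrow> real) \<Rightarrow> ('m, 'e) form1" where
  "dw0 A \<omega> f = (\<lambda>c x v. d0 A f c x v + f x * \<omega> c x v)"

definition dw1 ::
  "('m, 'e::euclidean_space) chart set \<Rightarrow> ('m, 'e) form1 \<Rightarrow> ('m, 'e) form1 \<Rightarrow> ('m, 'e) form2" where
  "dw1 A \<omega> \<alpha> = (\<lambda>c x v w. d1 A \<alpha> c x v w + wedge11 \<omega> \<alpha> c x v w)"

definition closed1 ::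
  "('m, 'e::euclidean_space) chart set \<Rightarrow> ('m, 'e) form1 \<Rightarrow> ('m, 'e) form1 monoid" where
  "closed1 A \<omega> = \<lparr>carrier = {\<alpha> \<in> one_forms A. dw1 A \<omega> \<alpha> = (\<lambda>c x v w. 0)},
     mult = (\<lambda>\<alpha> \<beta> c x v. \<alpha> c x v + \<beta> c x v), one = (\<lambda>c x v. 0)\<rparr>"

definition exact1 ::
  "('m, 'e::euclidean_space) chart set \<Rightarrow> ('m, 'e) form1 \<Rightarrow> ('m, 'e) form1 set" where
  "exact1 A \<omega> = dw0 A \<omega> ` smooth_functions A"

definition H1 ::
  "('m, 'e::euclidean_space) chart set \<Rightarrow> ('m, 'e) form1 \<Rightarrow> ('m, 'e) form1 set monoid" where
  "H1 A \<omega> = closed1 A \<omega> Mod exact1 A \<omega>"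

definition class1 ::
  "('m, 'e::euclidean_space) chart set \<Rightarrow> ('m, 'e) form1 \<Rightarrow> ('m, 'e) form1 \<Rightarrow> ('m, 'e) form1 set" where
  "class1 A \<omega> \<alpha> = exact1 A \<omega> #>\<^bsub>closed1 A \<omega>\<^esub> \<alpha>"

text \<open>A set is open in the real vector space \<open>H1\<close> if its preimage under every linear map
  from some \<open>\<real>\<^sup>k\<close> is open. On a compact manifold \<open>H1\<close> has finite dimension, and these are
  the open sets of its usual (unique Hausdorff) vector space topology.\<close>

definition open_H1 ::
  "('m, 'e::euclidean_space) chart set \<Rightarrow> ('m, 'e) form1 \<Rightarrow> ('m, 'e) form1 set set \<Rightarrow> bool" where
  "open_H1 A \<omega> U \<longleftrightarrow> U \<subseteq> carrier (H1 A \<omega>) \<and>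
     (\<forall>k \<alpha>. (\<forall>i<k. \<alpha> i \<in> carrier (closed1 A \<omega>)) \<longrightarrow>
        openin (product_topology (\<lambda>_::nat. euclideanreal) {..<k})
          {t \<in> {..<k} \<rightarrow>\<^sub>E UNIV. class1 A \<omega> (\<lambda>c x v. \<Sum>i<k. t i * \<alpha> i c x v) \<in> U})"

definition discrete_subgroup_H1 ::
  "('m, 'e::euclidean_space) chart set \<Rightarrow> ('m, 'e) form1 \<Rightarrow> ('m, 'e) form1 set set \<Rightarrow> bool" where
  "discrete_subgroup_H1 A \<omega> D \<longleftrightarrow> subgroup D (H1 A \<omega>) \<and>
     (\<exists>U. open_H1 A \<omega> U \<and> \<one>\<^bsub>H1 A \<omega>\<^esub> \<in> U \<and> U \<inter> D = {\<one>\<^bsub>H1 A \<omega>\<^esub>})"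


section \<open>LCS diffeomorphisms and the Lie algebra of the kernel\<close>

definition Diff_Omega ::
  "('m::topological_space, 'e::euclidean_space) chart set \<Rightarrow> ('m, 'e) form2 \<Rightarrow> ('m, 'e) form1 \<Rightarrow>
   ('m \<Rightarrow> 'm) set" where
  "Diff_Omega A \<Omega> \<omega> = {g. diffeo A g \<and> compact (closure {x. g x \<noteq> x}) \<and>
     (\<exists>a\<in>smooth_functions A. (\<forall>x. a x > 0) \<and>
        pullback2 A g \<Omega> = (\<lambda>c x v w. inverse (a x) * \<Omega> c x v w) \<and>
        pullback1 A g \<omega> = (\<lambda>c x v. \<omega> c x v + d0 A (\<lambda>z. ln (a z)) c x v))}"

definition lcs_field_with ::
  "('m::topological_space, 'e::euclidean_space) chart set \<Rightarrow> ('m, 'e) form2 \<Rightarrow> ('m, 'e) form1 \<Rightarrow>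
   ('m, 'e) vfield \<Rightarrow> ('m \<Rightarrow> real) \<Rightarrow> bool" where
  "lcs_field_with A \<Omega> \<omega> X f \<longleftrightarrow> X \<in> vector_fields A \<and>
     compact (closure {x. \<exists>c\<in>charts_at A x. X c x \<noteq> 0}) \<and> f \<in> smooth_functions A \<and>
     lie2 A X \<Omega> = (\<lambda>c x v w. - f x * \<Omega> c x v w) \<and> lie1 A X \<omega> = d0 A f"

definition kerPhi ::
  "('m::topological_space, 'e::euclidean_space) chart set \<Rightarrow> ('m, 'e) form2 \<Rightarrow> ('m, 'e) form1 \<Rightarrow>
   ('m, 'e) vfield set" where
  "kerPhi A \<Omega> \<omega> = {X. \<exists>f. lcs_field_with A \<Omega> \<omega> X f \<and> f = contract1 A \<omega> X}"


section \<open>Smooth paths in the kernel group\<close>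

definition smooth_family ::
  "('m::topological_space, 'e::euclidean_space) chart set \<Rightarrow> 'p::euclidean_space set \<Rightarrow>
   ('p \<Rightarrow> 'm \<Rightarrow> 'm) \<Rightarrow> bool" where
  "smooth_family A S G \<longleftrightarrow> continuous_on (S \<times> UNIV) (\<lambda>(p, x). G p x) \<and>
     (\<forall>c\<in>A. \<forall>d\<in>A. smooth_on {(p, y). p \<in> S \<and> y \<in> snd c ` fst c \<and> G p (chart_inv c y) \<in> fst d}
        (\<lambda>(p, y). snd d (G p (chart_inv c y))))"

definition diffeo_family ::
  "('m::topological_space, 'e::euclidean_space) chart set \<Rightarrow> 'p::euclidean_space set \<Rightarrow>
   ('p \<Rightarrow> 'm \<Rightarrow> 'm) \<Rightarrow> bool" where
  "diffeo_family A S G \<longleftrightarrow> (\<forall>p\<in>S. bij (G p)) \<and>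
     smooth_family A S G \<and> smooth_family A S (\<lambda>p. inv_into UNIV (G p))"

text \<open>The vector field \<open>X\<^sub>t = (d/dt g\<^sub>t) \<circ> g\<^sub>t\<^sup>-\<^sup>1\<close> generating a path \<open>g\<close> parametrised by \<open>{0..1}\<close>.\<close>

definition velocity ::
  "('m::topological_space, 'e::euclidean_space) chart set \<Rightarrow> (real \<Rightarrow> 'm \<Rightarrow> 'm) \<Rightarrow> real \<Rightarrow>
   ('m, 'e) vfield" where
  "velocity A g t = (\<lambda>c x. if c \<in> charts_at A x
     then vector_derivative (\<lambda>s. snd c (g s (inv_into UNIV (g t) x))) (at t within {0..1})
     else 0)"

definition kerPhi_paths ::
  "('m::topological_space, 'e::euclidean_space) chart set \<Rightarrow> ('m, 'e) form2 \<Rightarrow> ('m, 'e) form1 \<Rightarrow>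
   (real \<Rightarrow> 'm \<Rightarrow> 'm) set" where
  "kerPhi_paths A \<Omega> \<omega> = {g. g 0 = id \<and> diffeo_family A {0..1} g \<and>
     (\<forall>t\<in>{0..1}. g t \<in> Diff_Omega A \<Omega> \<omega> \<and> velocity A g t \<in> kerPhi A \<Omega> \<omega>)}"

text \<open>The group \<open>(ker \<Phi>)\<^sub>0\<close>: its elements are those joined to the identity by a smooth path
  of LCS diffeomorphisms tangent to \<open>ker \<Phi>\<close>.\<close>

definition kerPhi0 ::
  "('m::topological_space, 'e::euclidean_space) chart set \<Rightarrow> ('m, 'e) form2 \<Rightarrow> ('m, 'e) form1 \<Rightarrow>
   ('m \<Rightarrow> 'm) monoid" where
  "kerPhi0 A \<Omega> \<omega> = \<lparr>carrier = {g 1 | g. g \<in> kerPhi_paths A \<Omega> \<omega>}, mult = (\<circ>), one = id\<rparr>"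

text \<open>Homotopy relative to endpoints of paths in \<open>(ker \<Phi>)\<^sub>0\<close>: a smooth family over the unit square
  with values in \<open>(ker \<Phi>)\<^sub>0\<close>, so that its curves in both parameters are tangent to \<open>ker \<Phi>\<close>.\<close>

definition path_homotopic ::
  "('m::topological_space, 'e::euclidean_space) chart set \<Rightarrow> ('m, 'e) form2 \<Rightarrow> ('m, 'e) form1 \<Rightarrow>
   (real \<Rightarrow> 'm \<Rightarrow> 'm) \<Rightarrow> (real \<Rightarrow> 'm \<Rightarrow> 'm) \<Rightarrow> bool" where
  "path_homotopic A \<Omega> \<omega> g h \<longleftrightarrow> (\<exists>G::real \<times> real \<Rightarrow> 'm \<Rightarrow> 'm.
     diffeo_family A ({0..1} \<times> {0..1}) G \<and>
     (\<forall>s\<in>{0..1}. (\<lambda>t. G (s, t)) \<in> kerPhi_paths A \<Omega> \<omega> \<and> G (s, 1) = g 1) \<and>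
     (\<forall>s\<in>{0..1}. \<forall>t\<in>{0..1}. velocity A (\<lambda>r. G (r, t)) s \<in> kerPhi A \<Omega> \<omega>) \<and>
     (\<forall>t\<in>{0..1}. G (0, t) = g t \<and> G (1, t) = h t))"

definition homotopy_rel ::
  "('m::topological_space, 'e::euclidean_space) chart set \<Rightarrow> ('m, 'e) form2 \<Rightarrow> ('m, 'e) form1 \<Rightarrow>
   (real \<Rightarrow> 'm \<Rightarrow> 'm) rel" where
  "homotopy_rel A \<Omega> \<omega> = {(g, h). g \<in> kerPhi_paths A \<Omega> \<omega> \<and> h \<in> kerPhi_paths A \<Omega> \<omega> \<and>
     path_homotopic A \<Omega> \<omega> g h}"

definition kerPhi_cover ::
  "('m::topological_space, 'e::euclidean_space) chart set \<Rightarrow> ('m, 'e) form2 \<Rightarrow> ('m, 'e) form1 \<Rightarrow>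
   (real \<Rightarrow> 'm \<Rightarrow> 'm) set monoid" where
  "kerPhi_cover A \<Omega> \<omega> = \<lparr>carrier = kerPhi_paths A \<Omega> \<omega> // homotopy_rel A \<Omega> \<omega>,
     mult = (\<lambda>P Q. homotopy_rel A \<Omega> \<omega> `` {\<lambda>t. g t \<circ> h t | g h. g \<in> P \<and> h \<in> Q}),
     one = homotopy_rel A \<Omega> \<omega> `` {\<lambda>t. id}\<rparr>"

definition cover_proj :: "(real \<Rightarrow> 'm \<Rightarrow> 'm) set \<Rightarrow> 'm \<Rightarrow> 'm" where
  "cover_proj P = the_elem ((\<lambda>g. g 1) ` P)"

definition kerPhi_pi1 ::
  "('m::topological_space, 'e::euclidean_space) chart set \<Rightarrow> ('m, 'e) form2 \<Rightarrow> ('m, 'e) form1 \<Rightarrow>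
   (real \<Rightarrow> 'm \<Rightarrow> 'm) set set" where
  "kerPhi_pi1 A \<Omega> \<omega> = {P \<in> carrier (kerPhi_cover A \<Omega> \<omega>). cover_proj P = id}"


section \<open>The flux homomorphism\<close>

definition flux_form ::
  "('m::topological_space, 'e::euclidean_space) chart set \<Rightarrow> ('m, 'e) form2 \<Rightarrow>
   (real \<Rightarrow> 'm \<Rightarrow> 'm) \<Rightarrow> ('m, 'e) form1" where
  "flux_form A \<Omega> g = (\<lambda>c x v. integral {0..1} (\<lambda>t. contract2 \<Omega> (velocity A g t) c x v))"

text \<open>The flux of a homotopy class is the common class of the flux forms of its members.\<close>

definition flux ::
  "('m::topological_space, 'e::euclidean_space) chart set \<Rightarrow> ('m, 'e) form2 \<Rightarrow> ('m, 'e) form1 \<Rightarrow>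
   (real \<Rightarrow> 'm \<Rightarrow> 'm) set \<Rightarrow> ('m, 'e) form1 set" where
  "flux A \<Omega> \<omega> P = the_elem ((\<lambda>g. class1 A \<omega> (flux_form A \<Omega> g)) ` P)"

definition period_group ::
  "('m::topological_space, 'e::euclidean_space) chart set \<Rightarrow> ('m, 'e) form2 \<Rightarrow> ('m, 'e) form1 \<Rightarrow>
   ('m, 'e) form1 set set" where
  "period_group A \<Omega> \<omega> = flux A \<Omega> \<omega> ` kerPhi_pi1 A \<Omega> \<omega>"

definition Ham ::
  "('m::topological_space, 'e::euclidean_space) chart set \<Rightarrow> ('m, 'e) form2 \<Rightarrow> ('m, 'e) form1 \<Rightarrow>
   ('m \<Rightarrow> 'm) set" where
  "Ham A \<Omega> \<omega> = cover_proj ` kernel (kerPhi_cover A \<Omega> \<omega>) (H1 A \<omega>) (flux A \<Omega> \<omega>)"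

text \<open>The induced flux of \<open>g\<close> is the common coset of the fluxes of all (classes of) paths
  from the identity to \<open>g\<close>.\<close>

definition induced_flux ::
  "('m::topological_space, 'e::euclidean_space) chart set \<Rightarrow> ('m, 'e) form2 \<Rightarrow> ('m, 'e) form1 \<Rightarrow>
   ('m \<Rightarrow> 'm) \<Rightarrow> ('m, 'e) form1 set set" where
  "induced_flux A \<Omega> \<omega> g = (THE K. \<forall>P\<in>carrier (kerPhi_cover A \<Omega> \<omega>). cover_proj P = g \<longrightarrow>
     K = period_group A \<Omega> \<omega> #>\<^bsub>H1 A \<omega>\<^esub> flux A \<Omega> \<omega> P)"


section \<open>Short exact sequences\<close>

text \<open>The notion of the library requires all groups to be of the same type.\<close>

definition short_exact ::
  "('a, 'x) monoid_scheme \<Rightarrow> ('a \<Rightarrow> 'b) \<Rightarrow> ('b, 'y) monoid_scheme \<Rightarrow> ('b \<Rightarrow> 'c) \<Rightarrow>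
   ('c, 'z) monoid_scheme \<Rightarrow> bool" where
  "short_exact K i G p Q \<longleftrightarrow> Group.group K \<and> Group.group G \<and> Group.group Q \<and>
     i \<in> mon K G \<and> i ` carrier K = kernel G Q p \<and> p \<in> epi G Q"

end

theory Submission
  imports Defs
begin

text \<open>The whole proof rests on two properties of the flux of paths in \<open>(ker \<Phi>)\<^sub>0\<close>: it depends only on the homotopy class
  of a path, and it turns pointwise products of paths into sums. Both are instances of one theorem of Stokes type,
  \<open>square_flux\<close>. Let \<open>G\<close> be a family of diffeomorphisms over the unit square with coordinates \<open>(s, t)\<close> whose velocities \<open>X\<close>
  in \<open>t\<close> and \<open>Y\<close> in \<open>s\<close> lie in \<open>ker \<Phi>\<close>. Equality of the mixed derivatives of \<open>G\<close> says that \<open>\<partial>\<^sub>s X - \<partial>\<^sub>t Y\<close> is, up to sign, the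
  bracket of \<open>X\<close> and \<open>Y\<close> (\<open>velocity_commutator\<close>), and the contraction of \<open>\<Omega>\<close> with the bracket of two elements of \<open>ker \<Phi>\<close> is
  exact, with primitive \<open>\<Omega>(X, Y)\<close> up to sign (\<open>contract_bracket_exact\<close>). By Green's formula the flux around the boundary of
  the square is therefore exact. A homotopy relative to endpoints is a square with two constant sides, which gives
  homotopy invariance; the square \<open>g\<^sub>s\<^sub>t \<circ> h\<^sub>t\<close> has the sides \<open>h\<^sub>t\<close>, \<open>g\<^sub>t \<circ> h\<^sub>t\<close>, \<open>g\<^sub>s \<circ> h\<^sub>1\<close> and the identity, which gives additivity.

  The velocity of a product \<open>g\<^sub>t \<circ> h\<^sub>t\<close> is the sum of the velocity of \<open>g\<close> and the push-forward of the velocity of \<open>h\<close>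
  (\<open>product_has_vector_derivative\<close>). So products and inverses of paths stay in \<open>(ker \<Phi>)\<^sub>0\<close> once \<open>ker \<Phi>\<close> is invariant under
  LCS diffeomorphisms. On a compact manifold, \<open>X\<close> belongs to \<open>ker \<Phi>\<close> if and only if \<open>i\<^sub>X \<Omega>\<close> is \<open>d\<^sup>\<omega>\<close>-closed (\<open>kerPhi_iff\<close>). If
  \<open>g\<^sup>*\<Omega> = a\<^sup>-\<^sup>1 \<Omega>\<close>, then the contraction of \<open>\<Omega>\<close> with the push-forward of \<open>X\<close> pulls back to \<open>a\<^sup>-\<^sup>1 i\<^sub>X \<Omega>\<close>, and the factor \<open>a\<^sup>-\<^sup>1\<close>
  compensates the change of the Lee form from \<open>\<omega>\<close> to \<open>\<omega> + d (ln a)\<close> (\<open>related_dw1\<close>).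

  The rest is algebra. Two paths with the same endpoint differ by a loop, so their fluxes differ by a period, and the
  induced flux is a well-defined homomorphism (\<open>induced_flux_eq\<close>, \<open>induced_flux_hom\<close>). If the flux of a path is a period,
  then multiplying the path by the inverse of a loop with the same flux leaves its endpoint unchanged and makes its flux
  vanish; hence the kernel of the induced flux is the Hamiltonian group (\<open>Ham_kernel\<close>).\<close>

section \<open>Smooth functions between Euclidean spaces\<close>

lemma Ck_on_subset: "Ck_on k S f \<Longrightarrow> T \<subseteq> S \<Longrightarrow> Ck_on k T f"
  by (induction k arbitrary: f) (auto intro: continuous_on_subset)

lemma Ck_on_cong:
  assumes "open S" "Ck_on k S f" "\<And>x. x \<in> S \<Longrightarrow> f x = g x"
  shows "Ck_on k S g"
  using assms(2,3)
proof (induction k arbitrary: f g)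
  case 0
  then show ?case by (metis Ck_on.simps(1) continuous_on_cong)
next
  case (Suc k)
  have d: "f differentiable at x" if "x \<in> S" for x using Suc.prems(1) that by auto
  have g: "g differentiable at x" if "x \<in> S" for x
    using d[OF that] Suc.prems(2) that assms(1)
    by (metis differentiable_def has_derivative_transform_within_open)
  have "frechet_derivative f (at x) = frechet_derivative g (at x)" if "x \<in> S" for x
    using frechet_derivative_transform_within_open[OF d[OF that] assms(1) that] Suc.prems(2) by auto
  then show ?case using g Suc.IH Suc.prems(1) by (auto intro: Suc.IH)
qed

lemma Ck_on_lower: "Ck_on (Suc k) S f \<Longrightarrow> Ck_on k S f"
proof (induction k arbitrary: f)
  case 0
  then show ?case
    by (auto intro!: continuous_at_imp_continuous_on differentiable_imp_continuous_within)
next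
  case (Suc k)
  note Ck = iffD1[OF Ck_on.simps(2) Suc.prems]
  have "Ck_on k S (\<lambda>x. frechet_derivative f (at x) v)" for v
    using Ck by (intro Suc.IH) blast
  with Ck show ?case by simp
qed

lemma Ck_on_local:
  assumes "\<And>x. x \<in> S \<Longrightarrow> \<exists>U. open U \<and> x \<in> U \<and> Ck_on k U f"
  shows "Ck_on k S f"
  using assms
proof (induction k arbitrary: f)
  case 0
  have "continuous (at x) f" if "x \<in> S" for x
    using 0[OF that] by (auto simp: continuous_on_eq_continuous_at)
  then show ?case by (simp add: continuous_at_imp_continuous_on)
next
  case (Suc k)
  have Ck: "\<exists>U. open U \<and> x \<in> U \<and> (\<forall>x\<in>U. f differentiable at x) \<and>
      (\<forall>v. Ck_on k U (\<lambda>x. frechet_derivative f (at x) v))" if "x \<in> S" for x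
    using Suc.prems[OF that] by simp
  then have "f differentiable at x" if "x \<in> S" for x using that by blast
  moreover have "Ck_on k S (\<lambda>x. frechet_derivative f (at x) v)" for v
    using Ck by (intro Suc.IH) blast
  ultimately show ?case by simp
qed

lemma Ck_on_const: "Ck_on k S (\<lambda>x. c)"
  by (induction k arbitrary: c) auto

lemma Ck_on_bounded_linear:
  assumes "bounded_linear L" shows "Ck_on k S L"
proof (cases k)
  case 0
  then show ?thesis using assms by (simp add: bounded_linear.linear linear_continuous_on)
next
  case (Suc n)
  have "(L has_derivative L) (at x)" for x
    using assms bounded_linear_imp_has_derivative by blast
  then have "frechet_derivative L (at x) = L" "L differentiable at x" for x
    using frechet_derivative_at differentiable_def by metis+
  then show ?thesis using Suc by (simp add: Ck_on_const)
qed

lemma frechet_derivative_eqI: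
  "(f has_derivative f') (at x) \<Longrightarrow> frechet_derivative f (at x) = f'"
  using frechet_derivative_at by metis

lemma Ck_on_SucI:
  assumes "open S" "\<And>x. x \<in> S \<Longrightarrow> (f has_derivative f' x) (at x)" "\<And>v. Ck_on k S (\<lambda>x. f' x v)"
  shows "Ck_on (Suc k) S f"
proof -
  have "frechet_derivative f (at x) = f' x" if "x \<in> S" for x
    using assms(2)[OF that] frechet_derivative_eqI by blast
  then have "Ck_on k S (\<lambda>x. frechet_derivative f (at x) v)" for v
    by (intro Ck_on_cong[OF assms(1,3)]) auto
  then show ?thesis using assms(2) by (auto intro: differentiableI)
qed

lemma Ck_on_has_derivative:
  "Ck_on (Suc k) S f \<Longrightarrow> x \<in> S \<Longrightarrow> (f has_derivative frechet_derivative f (at x)) (at x)"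
  by (simp add: frechet_derivative_works)

lemma Ck_on_add:
  assumes "open S" "Ck_on k S f" "Ck_on k S g"
  shows "Ck_on k S (\<lambda>x. f x + g x)"
  using assms(2,3)
proof (induction k arbitrary: f g)
  case 0
  then show ?case by (auto intro: continuous_intros)
next
  case (Suc k)
  show ?case
    by (rule Ck_on_SucI[OF assms(1) has_derivative_add[OF Ck_on_has_derivative[OF Suc.prems(1)]
         Ck_on_has_derivative[OF Suc.prems(2)]]])
       (use Suc in auto)
qed

lemma Ck_on_sum:
  assumes "open S" "\<And>i. i \<in> I \<Longrightarrow> Ck_on k S (f i)"
  shows "Ck_on k S (\<lambda>x. \<Sum>i\<in>I. f i x)"
  using assms(2)
  by (induction I rule: infinite_finite_induct) (auto intro: Ck_on_const Ck_on_add assms(1))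

lemma Ck_on_bilinear:
  assumes "bounded_bilinear B" "open S" "Ck_on k S f" "Ck_on k S g"
  shows "Ck_on k S (\<lambda>x. B (f x) (g x))"
  using assms(3,4)
proof (induction k arbitrary: f g)
  case 0
  then show ?case using bounded_bilinear.continuous_on[OF assms(1)] by auto
next
  case (Suc k)
  show ?case
    by (rule Ck_on_SucI[OF assms(2) bounded_bilinear.FDERIV[OF assms(1) Ck_on_has_derivative[OF Suc.prems(1)]
         Ck_on_has_derivative[OF Suc.prems(2)]]])
       (use Suc Ck_on_lower[OF Suc.prems(1)] Ck_on_lower[OF Suc.prems(2)] in 
         \<open>auto intro!: Ck_on_add[OF assms(2)] Suc.IH\<close>)
qed

text \<open>The derivative of a composition expands over a basis into products of functions that are
  again compositions, which is what makes the induction on the order close up.\<close>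

lemma Ck_on_compose:
  fixes f :: "'a::euclidean_space \<Rightarrow> 'b::euclidean_space" and g :: "'b \<Rightarrow> 'c::real_normed_vector"
  assumes "open S" "open T" "Ck_on k S f" "Ck_on k T g" "f ` S \<subseteq> T"
  shows "Ck_on k S (\<lambda>x. g (f x))"
  using assms(3-)
proof (induction k arbitrary: g)
  case 0
  then show ?case by (auto intro: continuous_on_compose2)
next
  case (Suc k)
  let ?f' = "\<lambda>x. frechet_derivative f (at x)" and ?g' = "\<lambda>x. frechet_derivative g (at x)"
  have der: "((\<lambda>x. g (f x)) has_derivative (\<lambda>v. ?g' (f x) (?f' x v))) (at x)" if "x \<in> S" for x
    using has_derivative_compose[OF Ck_on_has_derivative[OF Suc.prems(1) that]
       Ck_on_has_derivative[OF Suc.prems(2), of "f x"]] that Suc.prems(3) by auto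
  have "Ck_on k S (\<lambda>x. ?g' (f x) (?f' x v))" for v
  proof -
    have "?g' (f x) w = (\<Sum>b\<in>Basis. (w \<bullet> b) *\<^sub>R ?g' (f x) b)" if "x \<in> S" for x w
    proof -
      interpret bounded_linear "?g' (f x)"
        using Ck_on_has_derivative[OF Suc.prems(2), of "f x"] Suc.prems(3) that has_derivative_bounded_linear by blast
      show ?thesis
        by (subst euclidean_representation[symmetric]) (simp add: sum scaleR)
    qed
    moreover have "Ck_on k S (\<lambda>x. ?g' (f x) b)" for b
      using Suc.IH[OF Ck_on_lower[OF Suc.prems(1)] _ Suc.prems(3), of "\<lambda>y. ?g' y b"] Suc.prems(2) by simp
    then have "Ck_on k S (\<lambda>x. \<Sum>b\<in>Basis. (?f' x v \<bullet> b) *\<^sub>R ?g' (f x) b)"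
      using Suc.prems(1)
      by (intro Ck_on_sum[OF assms(1)] Ck_on_bilinear[OF bounded_bilinear_scaleR assms(1)]
           Ck_on_bilinear[OF bounded_bilinear_inner assms(1)] Ck_on_const) auto
    ultimately show ?thesis by (auto intro: Ck_on_cong[OF assms(1)])
  qed
  with der show ?case by (rule Ck_on_SucI[OF assms(1)])
qed

lemma Ck_on_inverse:
  assumes "open S" "\<And>x. x \<in> S \<Longrightarrow> f x \<noteq> (0::real)" "Ck_on k S f"
  shows "Ck_on k S (\<lambda>x. inverse (f x))"
  using assms(3)
proof (induction k)
  case 0
  then show ?case using assms(2) by (auto intro: continuous_intros)
next
  case (Suc k)
  have i: "Ck_on k S (\<lambda>x. inverse (f x))" using Suc Ck_on_lower by blast
  show ?case
  proof (rule Ck_on_SucI[OF assms(1) Deriv.has_derivative_inverse])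
    fix x assume "x \<in> S"
    then show "f x \<noteq> 0" "(f has_derivative frechet_derivative f (at x)) (at x)"
      using assms(2) Ck_on_has_derivative[OF Suc.prems] by auto
  next
    fix v
    have "Ck_on k S (\<lambda>x. (- inverse (f x)) * (frechet_derivative f (at x) v * inverse (f x)))"
      using Suc.prems i Ck_on_bilinear[OF bounded_bilinear_mult assms(1) Ck_on_const[of k S "-1"] i]
      by (intro Ck_on_bilinear[OF bounded_bilinear_mult assms(1)]) auto
    then show "Ck_on k S (\<lambda>x. - (inverse (f x) * frechet_derivative f (at x) v * inverse (f x)))"
      by (simp add: mult.assoc)
  qed
qed

lemma smooth_onE:
  assumes "smooth_on S f" "x \<in> S"
  obtains U g where "open U" "x \<in> U" "\<forall>k. Ck_on k U g" "\<forall>y\<in>S \<inter> U. f y = g y"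
  using bspec[OF assms(1)[unfolded smooth_on_def] assms(2)] by (elim exE conjE)

lemma smooth_onI_open:
  assumes "open S" "\<And>k. Ck_on k S f" shows "smooth_on S f"
  unfolding smooth_on_def
  by (intro ballI exI[of _ S] exI[of _ f] conjI allI assms) auto

lemma smooth_onI_local:
  assumes "\<And>x. x \<in> S \<Longrightarrow> \<exists>U. open U \<and> x \<in> U \<and> smooth_on (S \<inter> U) f"
  shows "smooth_on S f"
  unfolding smooth_on_def
proof
  fix x assume x: "x \<in> S"
  then obtain U where U: "open U" "x \<in> U" "smooth_on (S \<inter> U) f" using assms by blast
  obtain V g where V: "open V" "x \<in> V" "\<forall>k. Ck_on k V g" "\<forall>y\<in>S \<inter> U \<inter> V. f y = g y"
    by (rule smooth_onE[OF U(3)]) (use x U(2) in auto)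
  show "\<exists>U g. open U \<and> x \<in> U \<and> (\<forall>k. Ck_on k U g) \<and> (\<forall>y\<in>S \<inter> U. f y = g y)"
    by (rule exI[of _ "U \<inter> V"], rule exI[of _ g]) (use U V Ck_on_subset[of _ V g "U \<inter> V"] in auto)
qed

lemma smooth_on_subset: "smooth_on S f \<Longrightarrow> T \<subseteq> S \<Longrightarrow> smooth_on T f"
  unfolding smooth_on_def
proof
  fix x assume S: "\<forall>x\<in>S. \<exists>U g. open U \<and> x \<in> U \<and> (\<forall>k. Ck_on k U g) \<and> (\<forall>y\<in>S \<inter> U. f y = g y)"
    and "T \<subseteq> S" "x \<in> T"
  then obtain U g where "open U" "x \<in> U" "\<forall>k. Ck_on k U g" "\<forall>y\<in>S \<inter> U. f y = g y"
    using bspec[OF S, of x] by blast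
  moreover from this(4) have "\<forall>y\<in>T \<inter> U. f y = g y" using \<open>T \<subseteq> S\<close> by blast
  ultimately show "\<exists>U g. open U \<and> x \<in> U \<and> (\<forall>k. Ck_on k U g) \<and> (\<forall>y\<in>T \<inter> U. f y = g y)"
    by blast
qed

lemma smooth_on_cong:
  assumes "smooth_on S f" "\<And>x. x \<in> S \<Longrightarrow> f x = g x" shows "smooth_on S g"
  unfolding smooth_on_def
proof
  fix x assume "x \<in> S"
  then obtain U h where "open U" "x \<in> U" "\<forall>k. Ck_on k U h" "\<forall>y\<in>S \<inter> U. f y = h y"
    by (rule smooth_onE[OF assms(1)])
  moreover from this(4) have "\<forall>y\<in>S \<inter> U. g y = h y" using assms(2) by auto
  ultimately show "\<exists>U h. open U \<and> x \<in> U \<and> (\<forall>k. Ck_on k U h) \<and> (\<forall>y\<in>S \<inter> U. g y = h y)"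
    by blast
qed

text \<open>On an open set the extensions in the definition of smoothness can be restricted to the set itself,
  where they agree with the function.\<close>

lemma smooth_on_openD:
  assumes "open S" "smooth_on S f" shows "Ck_on k S f"
proof (rule Ck_on_local)
  fix x assume "x \<in> S"
  then obtain U g where U: "open U" "x \<in> U" "\<forall>k. Ck_on k U g" "\<forall>y\<in>S \<inter> U. f y = g y"
    by (rule smooth_onE[OF assms(2)])
  then have "Ck_on k (S \<inter> U) f"
    using assms(1) Ck_on_subset[of k U g "S \<inter> U"] by - (rule Ck_on_cong[where f = g], auto)
  then show "\<exists>U. open U \<and> x \<in> U \<and> Ck_on k U f"
    using \<open>x \<in> S\<close> U assms(1) by (intro exI[of _ "S \<inter> U"]) auto
qed

lemma smooth_on_continuous:
  assumes "smooth_on S f" shows "continuous_on S f"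
  unfolding continuous_on_eq_continuous_within
proof
  fix x assume x: "x \<in> S"
  then obtain U g where U: "open U" "x \<in> U" "\<forall>k. Ck_on k U g" "\<forall>y\<in>S \<inter> U. f y = g y"
    by (rule smooth_onE[OF assms])
  have "continuous_on U g" using U(3) Ck_on.simps(1) by blast
  then have "continuous_on (S \<inter> U) g" by (rule continuous_on_subset) simp
  then have "continuous_on (S \<inter> U) f" using U(4) continuous_on_cong by metis
  then have "continuous (at x within (S \<inter> U)) f"
    using U(2) x by (simp add: continuous_on_eq_continuous_within)
  moreover have "at x within (S \<inter> U) = at x within S"
    by (rule at_within_nhd[OF U(2,1)]) auto
  ultimately show "continuous (at x within S) f" by simp
qed

lemma smooth_on_const: "smooth_on S (\<lambda>x. c)"
  by (rule smooth_on_subset[OF smooth_onI_open[OF open_UNIV Ck_on_const]]) simp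

lemma smooth_on_bounded_linear: "bounded_linear L \<Longrightarrow> smooth_on S L"
  by (rule smooth_on_subset[OF smooth_onI_open[OF open_UNIV Ck_on_bounded_linear]]) auto

lemma smooth_on_bilinear:
  assumes "bounded_bilinear B" "smooth_on S f" "smooth_on S g"
  shows "smooth_on S (\<lambda>x. B (f x) (g x))"
  unfolding smooth_on_def
proof
  fix x assume x: "x \<in> S"
  then obtain U f' where U: "open U" "x \<in> U" "\<forall>k. Ck_on k U f'" "\<forall>y\<in>S \<inter> U. f y = f' y"
    by (rule smooth_onE[OF assms(2)])
  obtain V g' where V: "open V" "x \<in> V" "\<forall>k. Ck_on k V g'" "\<forall>y\<in>S \<inter> V. g y = g' y"
    by (rule smooth_onE[OF assms(3) x])
  have "Ck_on k (U \<inter> V) (\<lambda>x. B (f' x) (g' x))" for k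
    using U V Ck_on_subset[of k U f' "U \<inter> V"] Ck_on_subset[of k V g' "U \<inter> V"]
    by (intro Ck_on_bilinear[OF assms(1)]) auto
  then show "\<exists>U h. open U \<and> x \<in> U \<and> (\<forall>k. Ck_on k U h) \<and> (\<forall>y\<in>S \<inter> U. B (f y) (g y) = h y)"
    using U V by (intro exI[of _ "U \<inter> V"] exI[of _ "\<lambda>x. B (f' x) (g' x)"]) auto
qed

lemma smooth_on_add:
  assumes "smooth_on S f" "smooth_on S g"
  shows "smooth_on S (\<lambda>x. f x + g x)"
  unfolding smooth_on_def
proof
  fix x assume x: "x \<in> S"
  then obtain U f' where U: "open U" "x \<in> U" "\<forall>k. Ck_on k U f'" "\<forall>y\<in>S \<inter> U. f y = f' y"
    by (rule smooth_onE[OF assms(1)])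
  obtain V g' where V: "open V" "x \<in> V" "\<forall>k. Ck_on k V g'" "\<forall>y\<in>S \<inter> V. g y = g' y"
    by (rule smooth_onE[OF assms(2) x])
  have "Ck_on k (U \<inter> V) (\<lambda>x. f' x + g' x)" for k
    using U V Ck_on_subset[of k U f' "U \<inter> V"] Ck_on_subset[of k V g' "U \<inter> V"]
    by (intro Ck_on_add) auto
  then show "\<exists>U h. open U \<and> x \<in> U \<and> (\<forall>k. Ck_on k U h) \<and> (\<forall>y\<in>S \<inter> U. f y + g y = h y)"
    using U V by (intro exI[of _ "U \<inter> V"] exI[of _ "\<lambda>x. f' x + g' x"]) auto
qed

lemma smooth_on_sum:
  assumes "\<And>i. i \<in> I \<Longrightarrow> smooth_on S (f i)"
  shows "smooth_on S (\<lambda>x. \<Sum>i\<in>I. f i x)"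
  using assms
  by (induction I rule: infinite_finite_induct) (auto intro: smooth_on_const smooth_on_add)

lemmas smooth_on_mult = smooth_on_bilinear[OF bounded_bilinear_mult]
lemmas smooth_on_scaleR = smooth_on_bilinear[OF bounded_bilinear_scaleR]
lemmas smooth_on_inner = smooth_on_bilinear[OF bounded_bilinear_inner]

lemma smooth_on_compose:
  fixes f :: "'a::euclidean_space \<Rightarrow> 'b::euclidean_space" and g :: "'b \<Rightarrow> 'c::real_normed_vector"
  assumes g: "smooth_on T g" and f: "smooth_on S f" and "f ` S \<subseteq> T"
  shows "smooth_on S (\<lambda>x. g (f x))"
  unfolding smooth_on_def
proof
  fix x assume x: "x \<in> S"
  then obtain U f' where U: "open U" "x \<in> U" "\<forall>k. Ck_on k U f'" "\<forall>y\<in>S \<inter> U. f y = f' y"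
    by (rule smooth_onE[OF f])
  have "f x \<in> T" using x assms(3) by blast
  then obtain V g' where V: "open V" "f x \<in> V" "\<forall>k. Ck_on k V g'" "\<forall>y\<in>T \<inter> V. g y = g' y"
    by (rule smooth_onE[OF g])
  have "continuous_on U f'" using U(3) Ck_on.simps(1) by blast
  then have o: "open (U \<inter> f' -` V)" using U(1) V(1) continuous_open_preimage by blast
  have "Ck_on k (U \<inter> f' -` V) (\<lambda>x. g' (f' x))" for k
    using U V Ck_on_subset[of k U f' "U \<inter> f' -` V"] by - (rule Ck_on_compose[OF o V(1)], auto)
  moreover have "g (f y) = g' (f' y)" if "y \<in> S" "y \<in> U" "f' y \<in> V" for y
  proof -
    have "f y = f' y" using U(4) that by blast
    then show ?thesis using V(4) assms(3) that by (metis IntI image_subset_iff)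
  qed
  moreover have "f' x \<in> V" using U(2,4) V(2) x by (metis IntI)
  ultimately show "\<exists>U h. open U \<and> x \<in> U \<and> (\<forall>k. Ck_on k U h) \<and> (\<forall>y\<in>S \<inter> U. g (f y) = h y)"
    using U(2) o
    by (intro exI[of _ "U \<inter> f' -` V"] exI[of _ "\<lambda>x. g' (f' x)"]) blast
qed

lemma smooth_on_inverse:
  assumes "smooth_on S f" "\<And>x. x \<in> S \<Longrightarrow> f x \<noteq> (0::real)"
  shows "smooth_on S (\<lambda>x. inverse (f x))"
proof -
  have "Ck_on k (-{0}) (\<lambda>x::real. inverse x)" for k
    by (rule Ck_on_inverse[OF _ _ Ck_on_bounded_linear[OF bounded_linear_ident]]) auto
  then have i: "smooth_on (-{0}) (\<lambda>x::real. inverse x)"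
    by (rule smooth_onI_open[rotated]) auto
  have "f ` S \<subseteq> -{0}" using assms(2) by auto
  then show ?thesis by (rule smooth_on_compose[OF i assms(1)])
qed

lemma smooth_on_linear:
  fixes f :: "'a::euclidean_space \<Rightarrow> 'b::euclidean_space"
  assumes "bounded_linear L" "smooth_on S f" shows "smooth_on S (\<lambda>x. L (f x))"
  using smooth_on_compose[OF smooth_on_bounded_linear[OF assms(1)] assms(2)] by blast

lemma smooth_on_Pair:
  fixes f :: "'a::euclidean_space \<Rightarrow> 'b::euclidean_space" and g :: "'a \<Rightarrow> 'c::euclidean_space"
  assumes "smooth_on S f" "smooth_on S g"
  shows "smooth_on S (\<lambda>x. (f x, g x))"
proof -
  have "bounded_linear (\<lambda>x::'b. (x, 0::'c))" "bounded_linear (\<lambda>x::'c. (0::'b, x))"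
    by (auto intro!: bounded_linear_Pair bounded_linear_ident bounded_linear_zero)
  from smooth_on_add[OF smooth_on_linear[OF this(1) assms(1)] smooth_on_linear[OF this(2) assms(2)]]
  show ?thesis by simp
qed

lemmas smooth_on_fst = smooth_on_linear[OF bounded_linear_fst]
lemmas smooth_on_snd = smooth_on_linear[OF bounded_linear_snd]
lemmas smooth_on_ident = smooth_on_bounded_linear[OF bounded_linear_ident]

lemma smooth_on_differentiable:
  "open S \<Longrightarrow> smooth_on S f \<Longrightarrow> x \<in> S \<Longrightarrow> f differentiable at x"
  using smooth_on_openD[of S f "Suc 0"] by auto

lemma smooth_on_has_derivative:
  "open S \<Longrightarrow> smooth_on S f \<Longrightarrow> x \<in> S \<Longrightarrow> (f has_derivative frechet_derivative f (at x)) (at x)"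
  using smooth_on_differentiable frechet_derivative_works by blast

lemma smooth_on_derivative:
  assumes "open S" "smooth_on S f"
  shows "smooth_on S (\<lambda>x. frechet_derivative f (at x) v)"
  using smooth_on_openD[OF assms, of "Suc _"] by (intro smooth_onI_open assms) auto

text \<open>Expanding the direction over a basis reduces a derivative whose point and direction both vary
  to compositions and products. Velocity fields have this form.\<close>

lemma smooth_on_derivative_compose:
  fixes f :: "'b::euclidean_space \<Rightarrow> 'c::real_normed_vector"
    and h w :: "'a::euclidean_space \<Rightarrow> 'b"
  assumes "open U" "smooth_on U f" "smooth_on S h" "h ` S \<subseteq> U" "smooth_on S w"
  shows "smooth_on S (\<lambda>x. frechet_derivative f (at (h x)) (w x))"
proof -
  have "smooth_on S (\<lambda>x. \<Sum>b\<in>Basis. (w x \<bullet> b) *\<^sub>R frechet_derivative f (at (h x)) b)"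
    by (intro smooth_on_sum smooth_on_scaleR smooth_on_inner assms smooth_on_const
        smooth_on_compose[OF smooth_on_derivative[OF assms(1,2)] assms(3,4)])
  then show ?thesis
  proof (rule smooth_on_cong)
    fix x assume "x \<in> S"
    then interpret bounded_linear "frechet_derivative f (at (h x))"
      using smooth_on_has_derivative[OF assms(1,2)] assms(4) has_derivative_bounded_linear by blast
    show "(\<Sum>b\<in>Basis. (w x \<bullet> b) *\<^sub>R frechet_derivative f (at (h x)) b) = frechet_derivative f (at (h x)) (w x)"
      by (subst (3) euclidean_representation[symmetric]) (simp add: sum scaleR)
  qed
qed

section \<open>Symmetry of second derivatives\<close>

lemma has_real_derivative_along_line:
  fixes f :: "'a::real_normed_vector \<Rightarrow> real"
  assumes "(f has_derivative f') (at (p + s *\<^sub>R v))"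
  shows "((\<lambda>s. f (p + s *\<^sub>R v)) has_real_derivative f' v) (at s)"
proof -
  have "((\<lambda>s. p + s *\<^sub>R v) has_derivative (\<lambda>h. h *\<^sub>R v)) (at s)"
    by (auto intro!: derivative_eq_intros)
  from has_derivative_compose[OF this assms]
  have "((\<lambda>s. f (p + s *\<^sub>R v)) has_derivative (\<lambda>h. f' (h *\<^sub>R v))) (at s)" .
  moreover have "f' (h *\<^sub>R v) = f' v * h" for h
    using has_derivative_linear[OF assms] by (simp add: linear_scale)
  ultimately show ?thesis by (simp add: has_field_derivative_def)
qed

text \<open>Two applications of the mean value theorem. The second difference is symmetric in \<open>v\<close> and \<open>w\<close> while the right-hand
  side is a second derivative at a point close to \<open>x\<close>, so that letting \<open>h\<close> tend to \<open>0\<close> gives the symmetry of second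
  derivatives.\<close>

lemma second_difference_mean_value:
  fixes f :: "'a::euclidean_space \<Rightarrow> real"
  assumes h: "h > 0" and U: "\<And>s t. s \<in> {0..h} \<Longrightarrow> t \<in> {0..h} \<Longrightarrow> x + s *\<^sub>R v + t *\<^sub>R w \<in> U"
    and "open U" "smooth_on U f"
  shows "\<exists>s\<in>{0..h}. \<exists>t\<in>{0..h}. f (x + h *\<^sub>R v + h *\<^sub>R w) - f (x + h *\<^sub>R v) - f (x + h *\<^sub>R w) + f x
     = h * h * frechet_derivative (\<lambda>z. frechet_derivative f (at z) v) (at (x + s *\<^sub>R v + t *\<^sub>R w)) w"
proof -
  let ?D = "\<lambda>z. frechet_derivative f (at z) v"
  note der = smooth_on_has_derivative[OF assms(3,4)]
  note der2 = smooth_on_has_derivative[OF assms(3) smooth_on_derivative[OF assms(3,4), of v]]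
  have "((\<lambda>s. f (x + s *\<^sub>R v + h *\<^sub>R w) - f (x + s *\<^sub>R v)) has_real_derivative
      ?D (x + s *\<^sub>R v + h *\<^sub>R w) - ?D (x + s *\<^sub>R v)) (at s)" if "0 \<le> s" "s \<le> h" for s
  proof -
    have "x + s *\<^sub>R v + h *\<^sub>R w \<in> U" "x + s *\<^sub>R v + 0 *\<^sub>R w \<in> U" using U[of s h] U[of s 0] that h by auto
    then have "(f has_derivative frechet_derivative f (at (x + h *\<^sub>R w + s *\<^sub>R v))) (at (x + h *\<^sub>R w + s *\<^sub>R v))"
      "(f has_derivative frechet_derivative f (at (x + s *\<^sub>R v))) (at (x + s *\<^sub>R v))"
      using der by (auto simp: algebra_simps)
    from DERIV_diff[OF has_real_derivative_along_line[OF this(1)] has_real_derivative_along_line[OF this(2)]]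
    show ?thesis by (simp add: algebra_simps)
  qed
  from MVT2[of 0 h "\<lambda>s. f (x + s *\<^sub>R v + h *\<^sub>R w) - f (x + s *\<^sub>R v)", OF h this] h
  obtain s where s: "0 < s" "s < h" "f (x + h *\<^sub>R v + h *\<^sub>R w) - f (x + h *\<^sub>R v) - (f (x + h *\<^sub>R w) - f x)
    = h * (?D (x + s *\<^sub>R v + h *\<^sub>R w) - ?D (x + s *\<^sub>R v))" by auto
  have "((\<lambda>t. ?D (x + s *\<^sub>R v + t *\<^sub>R w)) has_real_derivative
      frechet_derivative ?D (at (x + s *\<^sub>R v + t *\<^sub>R w)) w) (at t)" if "0 \<le> t" "t \<le> h" for t
    using that s(1,2) by (intro has_real_derivative_along_line der2 U) auto
  from MVT2[of 0 h "\<lambda>t. ?D (x + s *\<^sub>R v + t *\<^sub>R w)", OF h this] h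
  obtain t where t: "0 < t" "t < h" "?D (x + s *\<^sub>R v + h *\<^sub>R w) - ?D (x + s *\<^sub>R v)
    = h * frechet_derivative ?D (at (x + s *\<^sub>R v + t *\<^sub>R w)) w" by auto
  show ?thesis
    by (rule bexI[of _ s], rule bexI[of _ t]) (use s t in \<open>auto simp: algebra_simps\<close>)
qed

lemma second_derivative_symmetric_real:
  fixes f :: "'a::euclidean_space \<Rightarrow> real"
  assumes "open U" "smooth_on U f" "x \<in> U"
  shows "frechet_derivative (\<lambda>z. frechet_derivative f (at z) v) (at x) w =
    frechet_derivative (\<lambda>z. frechet_derivative f (at z) w) (at x) v"
proof -
  define P where "P a b = (\<lambda>z. frechet_derivative (\<lambda>z. frechet_derivative f (at z) a) (at z) b)" for a b
  have cont: "continuous (at x) (P a b)" for a b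
    using smooth_on_continuous[OF smooth_on_derivative[OF assms(1) smooth_on_derivative[OF assms(1,2)]]]
      assms(1,3) by (simp add: P_def continuous_on_eq_continuous_at)
  have "\<bar>P v w x - P w v x\<bar> \<le> e" if "e > 0" for e
  proof -
    have ev: "\<forall>\<^sub>F z in nhds x. dist (P a b z) (P a b x) < e / 2" for a b
      using cont[of a b] that
      by (intro tendstoD) (simp_all add: continuous_at tendsto_at_iff_tendsto_nhds)
    have "\<forall>\<^sub>F z in nhds x. z \<in> U \<and> dist (P v w z) (P v w x) < e / 2 \<and> dist (P w v z) (P w v x) < e / 2"
      using assms(1,3) by (intro eventually_conj ev eventually_nhds_in_open)
    then obtain d where d: "d > 0" "\<And>z. dist z x < d \<Longrightarrow> z \<in> U \<and> dist (P v w z) (P v w x) < e / 2 \<and>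
        dist (P w v z) (P w v x) < e / 2"
      unfolding eventually_nhds_metric by blast
    \<comment> \<open>All corners of the parallelograms with sides \<open>h v\<close> and \<open>h w\<close> stay within distance \<open>d\<close> of \<open>x\<close>.\<close>
    define N where "N = norm v + norm w + 1"
    define h where "h = d / (2 * N)"
    have n: "N > 0" using norm_ge_zero[of v] norm_ge_zero[of w] unfolding N_def by linarith
    have h: "h > 0" using n d(1) by (simp add: h_def)
    have near: "dist (x + s *\<^sub>R a + t *\<^sub>R b) x < d"
      if "s \<in> {0..h}" "t \<in> {0..h}" "{a, b} = {v, w}" for s t a b
    proof -
      have "dist (x + s *\<^sub>R a + t *\<^sub>R b) x \<le> s * norm a + t * norm b"
        using norm_triangle_ineq[of "s *\<^sub>R a" "t *\<^sub>R b"] that by (simp add: dist_norm add.assoc)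
      also have "\<dots> \<le> h * norm a + h * norm b"
        using that by (intro add_mono mult_right_mono) auto
      also have "\<dots> = h * (norm v + norm w)" using that(3) by (auto simp: doubleton_eq_iff algebra_simps)
      also have "\<dots> \<le> h * N" using h by (simp add: N_def)
      also have "\<dots> = d / 2" using n by (simp add: h_def)
      also have "\<dots> < d" using d(1) by simp
      finally show ?thesis .
    qed
    have inU: "x + s *\<^sub>R a + t *\<^sub>R b \<in> U" if "s \<in> {0..h}" "t \<in> {0..h}" "{a, b} = {v, w}" for s t a b
      using d(2) near[OF that] by blast
    note inU = inU[OF _ _ refl] inU[OF _ _ insert_commute]
    obtain s t where st: "s \<in> {0..h}" "t \<in> {0..h}" "f (x + h *\<^sub>R v + h *\<^sub>R w) - f (x + h *\<^sub>R v) - f (x + h *\<^sub>R w) + f x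
       = h * h * P v w (x + s *\<^sub>R v + t *\<^sub>R w)"
      using second_difference_mean_value[OF h inU(1) assms(1,2)] unfolding P_def by blast
    obtain s' t' where st': "s' \<in> {0..h}" "t' \<in> {0..h}" "f (x + h *\<^sub>R w + h *\<^sub>R v) - f (x + h *\<^sub>R w) - f (x + h *\<^sub>R v) + f x
       = h * h * P w v (x + s' *\<^sub>R w + t' *\<^sub>R v)"
      using second_difference_mean_value[OF h inU(2) assms(1,2)] unfolding P_def by blast
    have "h * h * P v w (x + s *\<^sub>R v + t *\<^sub>R w) = h * h * P w v (x + s' *\<^sub>R w + t' *\<^sub>R v)"
      using st(3) st'(3) by (simp add: algebra_simps)
    then have "P v w (x + s *\<^sub>R v + t *\<^sub>R w) = P w v (x + s' *\<^sub>R w + t' *\<^sub>R v)" using h by simp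
    moreover have "dist (P v w (x + s *\<^sub>R v + t *\<^sub>R w)) (P v w x) < e / 2" using d(2)[OF near[OF st(1,2) refl]] by blast
    moreover have "dist (P w v (x + s' *\<^sub>R w + t' *\<^sub>R v)) (P w v x) < e / 2" using d(2)[OF near[OF st'(1,2) insert_commute]] by blast
    ultimately show ?thesis unfolding dist_real_def by linarith
  qed
  then have "\<bar>P v w x - P w v x\<bar> \<le> 0" by - (rule field_le_epsilon, simp)
  then show ?thesis by (simp add: P_def)
qed

lemma second_derivative_symmetric:
  fixes f :: "'a::euclidean_space \<Rightarrow> 'b::euclidean_space"
  assumes "open U" "smooth_on U f" "x \<in> U"
  shows "frechet_derivative (\<lambda>z. frechet_derivative f (at z) v) (at x) w =
    frechet_derivative (\<lambda>z. frechet_derivative f (at z) w) (at x) v"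
proof (rule euclidean_eqI)
  fix b :: 'b assume "b \<in> Basis"
  have sm: "smooth_on U (\<lambda>z. f z \<bullet> b)" by (intro smooth_on_inner assms smooth_on_const)
  have D1: "frechet_derivative (\<lambda>z. g z \<bullet> b) (at z) a = frechet_derivative g (at z) a \<bullet> b"
    if "smooth_on U g" "z \<in> U" for g z a
    using has_derivative_inner_left[OF smooth_on_has_derivative[OF assms(1) that]]
    by (metis frechet_derivative_eqI)
  have D2: "frechet_derivative (\<lambda>z. frechet_derivative (\<lambda>z. f z \<bullet> b) (at z) a) (at x) c =
     frechet_derivative (\<lambda>z. frechet_derivative f (at z) a) (at x) c \<bullet> b" for a c
  proof -
    have "frechet_derivative (\<lambda>z. frechet_derivative (\<lambda>z. f z \<bullet> b) (at z) a) (at x) =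
       frechet_derivative (\<lambda>z. frechet_derivative f (at z) a \<bullet> b) (at x)"
      by (rule frechet_derivative_transform_within_open[OF
           smooth_on_differentiable[OF assms(1) smooth_on_derivative[OF assms(1) sm] assms(3)] assms(1,3)])
         (rule D1[OF assms(2)])
    then show ?thesis using D1[OF smooth_on_derivative[OF assms(1,2)] assms(3)] by simp
  qed
  show "frechet_derivative (\<lambda>z. frechet_derivative f (at z) v) (at x) w \<bullet> b =
    frechet_derivative (\<lambda>z. frechet_derivative f (at z) w) (at x) v \<bullet> b"
    using second_derivative_symmetric_real[OF assms(1) sm assms(3), of v w] by (simp add: D2)
qed

section \<open>Functions depending on parameters\<close>

text \<open>The parameter set \<open>S\<close> need not be open, so the function may have no derivative in all variables together.
  The derivative in the variable \<open>y\<close>, which ranges over an open set, is determined, and any local extension computes it.\<close>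

lemma smooth_on_slice_extension:
  assumes "open V" "open U" "\<forall>z\<in>(S \<times> V) \<inter> U. f (fst z) (snd z) = g z"
    and "Ck_on (Suc 0) U g" "p \<in> S" "y \<in> V" "(p, y) \<in> U"
  shows "(f p has_derivative (\<lambda>v. frechet_derivative g (at (p, y)) (0, v))) (at y)"
proof -
  have "(Pair p has_derivative (\<lambda>v. (0, v))) (at y)"
    by (auto intro!: derivative_eq_intros)
  from has_derivative_compose[OF this Ck_on_has_derivative[OF assms(4,7)]]
  have der: "((\<lambda>y. g (p, y)) has_derivative (\<lambda>v. frechet_derivative g (at (p, y)) (0, v))) (at y)" .
  have "open (Pair p -` U)" using assms(2) by (intro open_vimage) (auto intro: continuous_intros)
  then have "open (V \<inter> Pair p -` U)" using assms(1) by auto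
  then show ?thesis
    by (rule has_derivative_transform_within_open[OF der]) (use assms(3,5-7) in force)+
qed

lemma
  assumes "open V" "smooth_on (S \<times> V) (\<lambda>(p, y). f p y)"
  shows smooth_on_partial: "smooth_on (S \<times> V) (\<lambda>(p, y). frechet_derivative (f p) (at y) v)"
    and has_derivative_partial:
      "p \<in> S \<Longrightarrow> y \<in> V \<Longrightarrow> (f p has_derivative frechet_derivative (f p) (at y)) (at y)"
proof -
  show "smooth_on (S \<times> V) (\<lambda>(p, y). frechet_derivative (f p) (at y) v)"
  proof (rule smooth_onI_local)
    fix z assume "z \<in> S \<times> V"
    then obtain U g where U: "open U" "z \<in> U" "\<forall>k. Ck_on k U g" "\<forall>z\<in>(S \<times> V) \<inter> U. (case z of (p, y) \<Rightarrow> f p y) = g z"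
      by (rule smooth_onE[OF assms(2)])
    have sm: "smooth_on U g" using U(1,3) by (simp add: smooth_onI_open)
    have "smooth_on ((S \<times> V) \<inter> U) (\<lambda>z. frechet_derivative g (at z) (0, v))"
      by (rule smooth_on_subset[OF smooth_on_derivative[OF U(1) sm]]) auto
    then have "smooth_on ((S \<times> V) \<inter> U) (\<lambda>(p, y). frechet_derivative (f p) (at y) v)"
    proof (rule smooth_on_cong)
      fix z assume z: "z \<in> (S \<times> V) \<inter> U"
      then have "(f (fst z) has_derivative (\<lambda>v. frechet_derivative g (at (fst z, snd z)) (0, v))) (at (snd z))"
        using U smooth_on_slice_extension[OF assms(1) U(1), of S f g "fst z" "snd z"] by (auto simp: case_prod_unfold)
      then show "frechet_derivative g (at z) (0, v) = (case z of (p, y) \<Rightarrow> frechet_derivative (f p) (at y) v)"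
        using frechet_derivative_eqI by (fastforce simp: case_prod_unfold)
    qed
    then show "\<exists>U. open U \<and> z \<in> U \<and> smooth_on ((S \<times> V) \<inter> U) (\<lambda>(p, y). frechet_derivative (f p) (at y) v)"
      using U by blast
  qed
  assume "p \<in> S" "y \<in> V"
  then have "(p, y) \<in> S \<times> V" by simp
  then obtain U g where U: "open U" "(p, y) \<in> U" "\<forall>k. Ck_on k U g" "\<forall>z\<in>(S \<times> V) \<inter> U. (case z of (p, y) \<Rightarrow> f p y) = g z"
    by (rule smooth_onE[OF assms(2)])
  then have "(f p has_derivative (\<lambda>v. frechet_derivative g (at (p, y)) (0, v))) (at y)"
    using smooth_on_slice_extension[OF assms(1) U(1), of S f g p y] \<open>p \<in> S\<close> \<open>y \<in> V\<close> by (auto simp: case_prod_unfold)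
  then show "(f p has_derivative frechet_derivative (f p) (at y)) (at y)"
    using frechet_derivative_eqI by fastforce
qed

lemma has_derivative_integral_parameter:
  fixes f :: "'p::euclidean_space \<Rightarrow> 'e::euclidean_space \<Rightarrow> real"
  assumes V: "open V" and f: "smooth_on (cbox a b \<times> V) (\<lambda>(p, y). f p y)" and y: "y \<in> V"
  shows "((\<lambda>y. integral (cbox a b) (\<lambda>p. f p y)) has_derivative
     (\<lambda>v. integral (cbox a b) (\<lambda>p. frechet_derivative (f p) (at y) v))) (at y)"
proof -
  \<comment> \<open>A ball around the point provides the convex domain that the Leibniz rule asks for.\<close>
  obtain r where r: "r > 0" "ball y r \<subseteq> V" using V y open_contains_ball by blast
  let ?D = "\<lambda>y p. frechet_derivative (f p) (at y)"
  define D where "D y p = Blinfun (?D y p)" for y p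
  have bl: "bounded_linear (?D y p)" if "y \<in> V" "p \<in> cbox a b" for y p
    using has_derivative_partial[OF V f] that has_derivative_bounded_linear by blast
  have app: "blinfun_apply (D y p) = ?D y p" if "y \<in> V" "p \<in> cbox a b" for y p
    using bl[OF that] by (simp add: D_def bounded_linear_Blinfun_apply)
  have swap: "continuous_on (V \<times> cbox a b) (\<lambda>(y, p). h p y)"
    if "smooth_on (cbox a b \<times> V) (\<lambda>(p, y). h p y)" for h :: "'p \<Rightarrow> 'e \<Rightarrow> real"
  proof -
    have c: "continuous_on (V \<times> cbox a b) (\<lambda>z. (snd z, fst z))" by (intro continuous_intros)
    have "continuous_on (V \<times> cbox a b) (\<lambda>z. (\<lambda>(p, y). h p y) (snd z, fst z))"
      by (rule continuous_on_compose2[OF smooth_on_continuous[OF that] c]) auto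
    then show ?thesis by (simp add: case_prod_unfold)
  qed
  have cont: "continuous_on (V \<times> cbox a b) (\<lambda>(y, p). D y p)"
  proof (rule continuous_on_blinfun_componentwise)
    fix i :: 'e assume "i \<in> Basis"
    have "continuous_on (V \<times> cbox a b) (\<lambda>(y, p). ?D y p i)"
      by (rule swap[OF smooth_on_partial[OF V f]])
    then show "continuous_on (V \<times> cbox a b) (\<lambda>x. blinfun_apply (case x of (y, p) \<Rightarrow> D y p) i)"
      by (rule continuous_on_cong[THEN iffD1, rotated 2]) (auto simp: app)
  qed
  have int: "f' y integrable_on cbox a b" if "continuous_on (V \<times> cbox a b) (\<lambda>(y, p). f' y p)" "y \<in> V"
    for y and f' :: "'e \<Rightarrow> 'p \<Rightarrow> 'z::banach"
  proof (rule integrable_continuous)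
    have c: "continuous_on (cbox a b) (Pair y)" by (intro continuous_intros)
    have "continuous_on (cbox a b) (\<lambda>p. (\<lambda>(y, p). f' y p) (y, p))"
      by (rule continuous_on_compose2[OF that(1) c]) (use that(2) in auto)
    then show "continuous_on (cbox a b) (f' y)" by simp
  qed
  have "((\<lambda>y. integral (cbox a b) (\<lambda>p. f p y)) has_derivative integral (cbox a b) (D y)) (at y within ball y r)"
  proof (rule leibniz_rule)
    fix x t assume "x \<in> ball y r" "t \<in> cbox a b"
    then have "x \<in> V" "t \<in> cbox a b" using r(2) by auto
    then show "((\<lambda>x. f t x) has_derivative blinfun_apply (D x t)) (at x within ball y r)"
      using has_derivative_partial[OF V f, of t x] app[of x t] by (simp add: has_derivative_at_withinI)
  next
    show "(\<lambda>p. f p x) integrable_on cbox a b" if "x \<in> ball y r" for x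
      using int[OF swap[OF f]] that r by auto
    show "continuous_on (ball y r \<times> cbox a b) (\<lambda>(x, y). D x y)"
      by (rule continuous_on_subset[OF cont]) (use r in auto)
  qed (use r in auto)
  moreover have "blinfun_apply (integral (cbox a b) (D y)) v = integral (cbox a b) (\<lambda>p. ?D y p v)" for v
    by (subst blinfun_apply_integral[OF int[OF cont y]]) (rule integral_cong, use y app in auto)
  then have "blinfun_apply (integral (cbox a b) (D y)) = (\<lambda>v. integral (cbox a b) (\<lambda>p. ?D y p v))" by auto
  ultimately show ?thesis using r(1) by (simp add: at_within_open[of y "ball y r"])
qed

lemma smooth_on_integral_parameter:
  fixes f :: "'p::euclidean_space \<Rightarrow> 'e::euclidean_space \<Rightarrow> real"
  assumes V: "open V" and f: "smooth_on (cbox a b \<times> V) (\<lambda>(p, y). f p y)"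
  shows "smooth_on V (\<lambda>y. integral (cbox a b) (\<lambda>p. f p y))"
proof (rule smooth_onI_open[OF V])
  fix k show "Ck_on k V (\<lambda>y. integral (cbox a b) (\<lambda>p. f p y))"
    using f
  proof (induction k arbitrary: f)
    case 0
    show ?case
      unfolding Ck_on.simps continuous_on_eq_continuous_at[OF V]
      using has_derivative_integral_parameter[OF V 0] has_derivative_continuous by blast
  next
    case (Suc k)
    show ?case
      by (rule Ck_on_SucI[OF V has_derivative_integral_parameter[OF V Suc.prems]])
         (auto intro: Suc.IH smooth_on_partial[OF V Suc.prems])
  qed
qed

section \<open>Charts of a manifold\<close>

lemma charts_atD: "c \<in> charts_at A x \<Longrightarrow> c \<in> A" "c \<in> charts_at A x \<Longrightarrow> x \<in> fst c"
  by (auto simp: charts_at_def)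

locale atlas =
  fixes A :: "('m::{t2_space,second_countable_topology}, 'e::euclidean_space) chart set"
  assumes atlas: "smooth_atlas A"
begin

lemma
  assumes "c \<in> A"
  shows open_chart: "open (fst c)" and open_chart_image: "open (snd c ` fst c)"
    and homeomorphism_chart: "homeomorphism (fst c) (snd c ` fst c) (snd c) (chart_inv c)"
  using atlas assms by (auto simp: smooth_atlas_def)

lemma
  assumes "c \<in> A"
  shows chart_inv_chart: "x \<in> fst c \<Longrightarrow> chart_inv c (snd c x) = x"
    and chart_chart_inv: "y \<in> snd c ` fst c \<Longrightarrow> snd c (chart_inv c y) = y"
    and chart_inv_in: "y \<in> snd c ` fst c \<Longrightarrow> chart_inv c y \<in> fst c"
    and continuous_chart_inv: "continuous_on (snd c ` fst c) (chart_inv c)"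
  using homeomorphism_chart[OF assms] unfolding homeomorphism_def by auto

lemma chart_at_in: "chart_at A x \<in> charts_at A x"
proof -
  have "\<exists>c. c \<in> charts_at A x" using atlas unfolding smooth_atlas_def charts_at_def by blast
  then show ?thesis unfolding chart_at_def by (rule someI_ex)
qed

lemma chart_image_Int:
  assumes "c \<in> A"
  shows "snd c ` (fst c \<inter> W) = snd c ` fst c \<inter> chart_inv c -` W"
  using chart_inv_chart[OF assms] by auto

lemma open_chart_image_Int:
  assumes "c \<in> A" "open W"
  shows "open (snd c ` (fst c \<inter> W))"
  unfolding chart_image_Int[OF assms(1)]
  using assms by (intro continuous_open_preimage continuous_chart_inv open_chart_image)

lemma smooth_map_id: "smooth_map A id"
proof -
  have "smooth_on (snd c ` (fst c \<inter> fst d)) (snd d \<circ> chart_inv c)" if "c \<in> A" "d \<in> A" for c d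
    using atlas that by (simp add: smooth_atlas_def)
  then show ?thesis by (simp add: smooth_map_def)
qed

section \<open>Derivatives in charts\<close>

definition chart_differentiable :: "('m, 'e) chart \<Rightarrow> ('m \<Rightarrow> 'b::real_normed_vector) \<Rightarrow> 'm \<Rightarrow> bool" where
  "chart_differentiable c F x \<longleftrightarrow> (F \<circ> chart_inv c) differentiable (at (snd c x))"

lemma chart_has_derivative:
  "chart_differentiable c F x \<Longrightarrow> (F \<circ> chart_inv c has_derivative chart_deriv c F x) (at (snd c x))"
  by (simp add: chart_differentiable_def chart_deriv_def frechet_derivative_works)

lemma chart_derivI:
  assumes "(F \<circ> chart_inv c has_derivative D) (at (snd c x))"
  shows "chart_differentiable c F x" "chart_deriv c F x = D"
  using assms by (auto simp: chart_differentiable_def chart_deriv_def intro: frechet_derivative_eqI differentiableI)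

lemma linear_chart_deriv: "chart_differentiable c F x \<Longrightarrow> linear (chart_deriv c F x)"
  using chart_has_derivative has_derivative_linear by blast

lemma chart_deriv_transform:
  assumes "c \<in> charts_at A x" "open W" "x \<in> W" "\<And>z. z \<in> fst c \<Longrightarrow> z \<in> W \<Longrightarrow> F z = G z"
    and "(F \<circ> chart_inv c has_derivative D) (at (snd c x))"
  shows "(G \<circ> chart_inv c has_derivative D) (at (snd c x))"
proof (rule has_derivative_transform_within_open[OF assms(5)])
  have c: "c \<in> A" "x \<in> fst c" using assms(1) by (auto simp: charts_at_def)
  show "open (snd c ` (fst c \<inter> W))" using c assms open_chart_image_Int by blast
  show "snd c x \<in> snd c ` (fst c \<inter> W)" using c assms by blast
  show "(F \<circ> chart_inv c) y = (G \<circ> chart_inv c) y" if "y \<in> snd c ` (fst c \<inter> W)" for y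
    using that assms(4) chart_inv_chart[OF c(1)] by auto
qed

lemma chart_deriv_cong:
  assumes "c \<in> charts_at A x" "\<And>z. z \<in> fst c \<Longrightarrow> F z = G z" "chart_differentiable c F x"
  shows "chart_differentiable c G x" "chart_deriv c G x = chart_deriv c F x"
proof -
  have "(G \<circ> chart_inv c has_derivative chart_deriv c F x) (at (snd c x))"
    by (rule chart_deriv_transform[OF assms(1) open_UNIV UNIV_I _ chart_has_derivative[OF assms(3)]])
       (rule assms(2))
  from chart_derivI[OF this] show "chart_differentiable c G x" "chart_deriv c G x = chart_deriv c F x" .
qed

lemma smooth_on_chart_differentiable:
  assumes "c \<in> charts_at A x" "smooth_on (snd c ` fst c) (F \<circ> chart_inv c)"
  shows "chart_differentiable c F x"
  using smooth_on_differentiable[OF open_chart_image assms(2)] charts_atD[OF assms(1)]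
  by (auto simp: chart_differentiable_def)

lemma chart_deriv_const: "chart_deriv c (\<lambda>z. k) x v = 0"
  by (simp add: chart_deriv_def comp_def)

lemma
  assumes "c \<in> charts_at A x" "chart_differentiable c F x" "chart_differentiable c G x"
  shows chart_deriv_add: "chart_deriv c (\<lambda>z. F z + G z) x v = chart_deriv c F x v + chart_deriv c G x v"
    and chart_deriv_diff: "chart_deriv c (\<lambda>z. F z - G z) x v = chart_deriv c F x v - chart_deriv c G x v"
proof -
  have "((\<lambda>z. F z + G z) \<circ> chart_inv c has_derivative (\<lambda>v. chart_deriv c F x v + chart_deriv c G x v)) (at (snd c x))"
    using has_derivative_add[OF chart_has_derivative[OF assms(2)] chart_has_derivative[OF assms(3)]]
    by (simp add: comp_def)
  from chart_derivI(2)[OF this]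
  show "chart_deriv c (\<lambda>z. F z + G z) x v = chart_deriv c F x v + chart_deriv c G x v" by simp
  have "((\<lambda>z. F z - G z) \<circ> chart_inv c has_derivative (\<lambda>v. chart_deriv c F x v - chart_deriv c G x v)) (at (snd c x))"
    using has_derivative_diff[OF chart_has_derivative[OF assms(2)] chart_has_derivative[OF assms(3)]]
    by (simp add: comp_def)
  from chart_derivI(2)[OF this]
  show "chart_deriv c (\<lambda>z. F z - G z) x v = chart_deriv c F x v - chart_deriv c G x v" by simp
qed

lemma chart_deriv_mult:
  fixes F G :: "'m \<Rightarrow> real"
  assumes "c \<in> charts_at A x" "chart_differentiable c F x" "chart_differentiable c G x"
  shows "chart_deriv c (\<lambda>z. F z * G z) x v = F x * chart_deriv c G x v + chart_deriv c F x v * G x"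
proof -
  have x: "chart_inv c (snd c x) = x" using chart_inv_chart charts_atD[OF assms(1)] by blast
  have "((\<lambda>z. F z * G z) \<circ> chart_inv c has_derivative
      (\<lambda>v. F x * chart_deriv c G x v + chart_deriv c F x v * G x)) (at (snd c x))"
    using has_derivative_mult[OF chart_has_derivative[OF assms(2)] chart_has_derivative[OF assms(3)]]
    by (simp add: comp_def x)
  from chart_derivI(2)[OF this] show ?thesis by simp
qed

text \<open>Continuity keeps \<open>g\<close> inside the domain of the chart \<open>d\<close> near \<open>x\<close>; there the coordinate expression of
  \<open>F \<circ> g\<close> factors through the one of \<open>g\<close>.\<close>

lemma chart_deriv_compose:
  assumes c: "c \<in> charts_at A x" and d: "d \<in> charts_at A (g x)" and g: "continuous_on UNIV g"
    and "chart_differentiable c (snd d \<circ> g) x" and "chart_differentiable d F (g x)"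
  shows "chart_differentiable c (F \<circ> g) x"
    and "chart_deriv c (F \<circ> g) x v = chart_deriv d F (g x) (chart_deriv c (snd d \<circ> g) x v)"
proof -
  have x: "chart_inv c (snd c x) = x" using chart_inv_chart charts_atD[OF c] by blast
  have "(F \<circ> chart_inv d has_derivative chart_deriv d F (g x))
      (at ((snd d \<circ> g \<circ> chart_inv c) (snd c x)))"
    using chart_has_derivative[OF assms(5)] by (simp add: x)
  from diff_chain_at[OF chart_has_derivative[OF assms(4)] this]
  have 1: "((F \<circ> chart_inv d \<circ> snd d \<circ> g) \<circ> chart_inv c has_derivative
     chart_deriv d F (g x) \<circ> chart_deriv c (snd d \<circ> g) x) (at (snd c x))"
    by (simp only: o_assoc)
  have W: "open (g -` fst d)" "x \<in> g -` fst d"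
    using g d open_chart by (auto simp: charts_at_def continuous_on_open_vimage)
  have "(F \<circ> g \<circ> chart_inv c has_derivative chart_deriv d F (g x) \<circ> chart_deriv c (snd d \<circ> g) x) (at (snd c x))"
    by (rule chart_deriv_transform[OF c W _ 1]) (use chart_inv_chart[OF charts_atD(1)[OF d]] in auto)
  from chart_derivI[OF this] show "chart_differentiable c (F \<circ> g) x"
     "chart_deriv c (F \<circ> g) x v = chart_deriv d F (g x) (chart_deriv c (snd d \<circ> g) x v)" by auto
qed

lemma smooth_map_chart_differentiable:
  assumes "smooth_map A g" "c \<in> charts_at A x" "d \<in> charts_at A (g x)"
  shows "chart_differentiable c (snd d \<circ> g) x"
proof -
  have "open (g -` fst d)"
    using assms open_chart by (auto simp: smooth_map_def charts_at_def continuous_on_open_vimage)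
  then have "open (snd c ` (fst c \<inter> g -` fst d))"
    using charts_atD[OF assms(2)] open_chart_image_Int by blast
  then have "(snd d \<circ> g \<circ> chart_inv c) differentiable (at (snd c x))"
    using assms by (intro smooth_on_differentiable) (auto simp: smooth_map_def charts_at_def)
  then show ?thesis by (simp add: chart_differentiable_def)
qed

lemma chart_differentiable_chart:
  "c \<in> charts_at A x \<Longrightarrow> d \<in> charts_at A x \<Longrightarrow> chart_differentiable c (snd d) x"
  using smooth_map_chart_differentiable[OF smooth_map_id, of c x d] by simp

lemma chart_deriv_change:
  assumes "c \<in> charts_at A x" "d \<in> charts_at A x" "chart_differentiable d F x"
  shows "chart_differentiable c F x"
    and "chart_deriv c F x v = chart_deriv d F x (chart_deriv c (snd d) x v)"
  using chart_deriv_compose[of c x d id F] assms chart_differentiable_chart[OF assms(1,2)] by auto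

lemma chart_deriv_chart_self:
  assumes "c \<in> charts_at A x" shows "chart_deriv c (snd c) x v = v"
proof -
  have "((\<lambda>y. y) has_derivative (\<lambda>v. v)) (at (snd c x))" by simp
  then have "(snd c \<circ> chart_inv c has_derivative (\<lambda>v. v)) (at (snd c x))"
    by (rule has_derivative_transform_within_open[OF _ open_chart_image[OF charts_atD(1)[OF assms]]])
       (use charts_atD[OF assms] chart_chart_inv in auto)
  then show ?thesis using chart_derivI(2) by fastforce
qed

section \<open>Functions and one-forms\<close>

lemma smooth_function_chart_differentiable:
  "f \<in> smooth_functions A \<Longrightarrow> c \<in> charts_at A x \<Longrightarrow> chart_differentiable c f x"
  by (rule smooth_on_chart_differentiable) (auto simp: smooth_functions_def charts_at_def)

lemma
  assumes "\<alpha> \<in> one_forms A"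
  shows one_form_smooth: "c \<in> A \<Longrightarrow> smooth_on (snd c ` fst c) (\<lambda>y. \<alpha> c (chart_inv c y) v)"
    and one_form_linear: "c \<in> charts_at A x \<Longrightarrow> linear (\<alpha> c x)"
    and one_form_change: "c \<in> charts_at A x \<Longrightarrow> d \<in> charts_at A x \<Longrightarrow>
       \<alpha> c x v = \<alpha> d x (chart_deriv c (snd d) x v)"
    and one_form_outside: "c \<notin> charts_at A x \<Longrightarrow> \<alpha> c x v = 0"
  using assms unfolding one_forms_def mem_Collect_eq by blast+

lemma one_formsI:
  assumes "\<And>c v. c \<in> A \<Longrightarrow> smooth_on (snd c ` fst c) (\<lambda>y. \<alpha> c (chart_inv c y) v)"
    and "\<And>c x. c \<in> charts_at A x \<Longrightarrow> linear (\<alpha> c x)"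
    and "\<And>c d x v. c \<in> charts_at A x \<Longrightarrow> d \<in> charts_at A x \<Longrightarrow>
       \<alpha> c x v = \<alpha> d x (chart_deriv c (snd d) x v)"
    and "\<And>c x v. c \<notin> charts_at A x \<Longrightarrow> \<alpha> c x v = 0"
  shows "\<alpha> \<in> one_forms A"
  unfolding one_forms_def by (intro CollectI conjI ballI allI impI assms)

lemma one_form_chart_differentiable:
  assumes "\<alpha> \<in> one_forms A" "c \<in> charts_at A x"
  shows "chart_differentiable c (\<lambda>z. \<alpha> c z v) x"
  using one_form_smooth[OF assms(1) charts_atD(1)[OF assms(2)], of v]
  by (intro smooth_on_chart_differentiable assms) (simp add: comp_def)

lemma smooth_function_add: "f \<in> smooth_functions A \<Longrightarrow> g \<in> smooth_functions A \<Longrightarrow> (\<lambda>x. f x + g x) \<in> smooth_functions A"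
  by (auto simp: smooth_functions_def comp_def intro!: smooth_on_add)

lemma smooth_function_mult: "f \<in> smooth_functions A \<Longrightarrow> g \<in> smooth_functions A \<Longrightarrow> (\<lambda>x. f x * g x) \<in> smooth_functions A"
  by (auto simp: smooth_functions_def comp_def intro!: smooth_on_mult)

lemma smooth_function_const: "(\<lambda>x. k) \<in> smooth_functions A"
  by (auto simp: smooth_functions_def comp_def intro!: smooth_on_const)

lemma one_form_add:
  assumes "\<alpha> \<in> one_forms A" "\<beta> \<in> one_forms A"
  shows "(\<lambda>c x v. \<alpha> c x v + \<beta> c x v) \<in> one_forms A"
proof (rule one_formsI)
  fix c :: "('m, 'e) chart" and d x v assume "c \<in> charts_at A x" "d \<in> charts_at A x"
  from one_form_change[OF assms(1) this] one_form_change[OF assms(2) this]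
  show "\<alpha> c x v + \<beta> c x v = \<alpha> d x (chart_deriv c (snd d) x v) + \<beta> d x (chart_deriv c (snd d) x v)" by metis
qed (simp_all add: smooth_on_add one_form_smooth linear_compose_add one_form_linear one_form_outside assms)

lemma one_form_mult:
  assumes "f \<in> smooth_functions A" "\<alpha> \<in> one_forms A"
  shows "(\<lambda>c x v. f x * \<alpha> c x v) \<in> one_forms A"
proof (rule one_formsI)
  fix c :: "('m, 'e) chart" and d x v assume "c \<in> charts_at A x" "d \<in> charts_at A x"
  from one_form_change[OF assms(2) this]
  show "f x * \<alpha> c x v = f x * \<alpha> d x (chart_deriv c (snd d) x v)" by metis
next
  fix c :: "('m, 'e) chart" and v assume "c \<in> A"
  then show "smooth_on (snd c ` fst c) (\<lambda>y. f (chart_inv c y) * \<alpha> c (chart_inv c y) v)"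
    using smooth_on_mult[OF _ one_form_smooth[OF assms(2)], of c "f \<circ> chart_inv c"] assms(1)
    by (simp add: smooth_functions_def)
next
  fix c :: "('m, 'e) chart" and x assume "c \<in> charts_at A x"
  from one_form_linear[OF assms(2) this] show "linear (\<lambda>v. f x * \<alpha> c x v)"
    using linear_compose_scale_right[of "\<alpha> c x" "f x"] by simp
qed (simp add: one_form_outside[OF assms(2)])

lemma one_form_zero: "(\<lambda>c x v. 0) \<in> one_forms A"
  by (rule one_formsI) (simp_all add: linear_zero smooth_on_const)

lemma d0_in_chart:
  assumes "c \<in> A" "y \<in> snd c ` fst c"
  shows "d0 A f c (chart_inv c y) v = frechet_derivative (f \<circ> chart_inv c) (at y) v"
  using assms by (simp add: d0_def chart_deriv_def charts_at_def chart_inv_in chart_chart_inv)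

lemma d0_one_form:
  assumes "f \<in> smooth_functions A"
  shows "d0 A f \<in> one_forms A"
proof -
  have 1: "smooth_on (snd c ` fst c) (\<lambda>y. d0 A f c (chart_inv c y) v)" if "c \<in> A" for c v
  proof -
    have "smooth_on (snd c ` fst c) (f \<circ> chart_inv c)" using assms that by (simp add: smooth_functions_def)
    from smooth_on_derivative[OF open_chart_image[OF that] this, of v]
    show ?thesis by (rule smooth_on_cong) (simp add: d0_in_chart that)
  qed
  have 2: "linear (d0 A f c x)" if "c \<in> charts_at A x" for c x
    using linear_chart_deriv[OF smooth_function_chart_differentiable[OF assms that]] that by (simp add: d0_def)
  have 3: "d0 A f c x v = d0 A f d x (chart_deriv c (snd d) x v)"
    if "c \<in> charts_at A x" "d \<in> charts_at A x" for c d x v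
    using chart_deriv_change(2)[OF that smooth_function_chart_differentiable[OF assms that(2)]] that
    by (simp add: d0_def)
  show ?thesis by (rule one_formsI, erule 1, erule 2, erule (1) 3, simp add: d0_def)
qed

lemma d1_d0:
  assumes "f \<in> smooth_functions A"
  shows "d1 A (d0 A f) c x v w = 0"
proof (cases "c \<in> charts_at A x")
  case True
  note cA = charts_atD[OF True]
  have sm: "smooth_on (snd c ` fst c) (f \<circ> chart_inv c)" using assms cA by (simp add: smooth_functions_def)
  have "chart_deriv c (\<lambda>z. d0 A f c z b) x = frechet_derivative (\<lambda>y. frechet_derivative (f \<circ> chart_inv c) (at y) b) (at (snd c x))" for b
  proof (rule chart_derivI(2))
    have x: "snd c x \<in> snd c ` fst c" using cA by blast
    show "((\<lambda>z. d0 A f c z b) \<circ> chart_inv c has_derivative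
        frechet_derivative (\<lambda>y. frechet_derivative (f \<circ> chart_inv c) (at y) b) (at (snd c x))) (at (snd c x))"
      by (rule has_derivative_transform_within_open[OF smooth_on_has_derivative[OF open_chart_image[OF cA(1)]
             smooth_on_derivative[OF open_chart_image[OF cA(1)] sm] x] open_chart_image[OF cA(1)] x])
         (simp add: d0_in_chart cA(1))
  qed
  then show ?thesis
    using second_derivative_symmetric[OF open_chart_image[OF cA(1)] sm, of "snd c x" v w] cA True
    by (simp add: d1_def)
qed (simp add: d1_def)

lemma d1_add:
  assumes "\<alpha> \<in> one_forms A" "\<beta> \<in> one_forms A"
  shows "d1 A (\<lambda>c x v. \<alpha> c x v + \<beta> c x v) c x v w = d1 A \<alpha> c x v w + d1 A \<beta> c x v w"
  using assms by (simp add: d1_def chart_deriv_add one_form_chart_differentiable)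

lemma d1_mult:
  assumes "f \<in> smooth_functions A" "\<alpha> \<in> one_forms A"
  shows "d1 A (\<lambda>c x v. f x * \<alpha> c x v) c x v w = wedge11 (d0 A f) \<alpha> c x v w + f x * d1 A \<alpha> c x v w"
proof (cases "c \<in> charts_at A x")
  case True
  then show ?thesis
    using chart_deriv_mult[OF True smooth_function_chart_differentiable[OF assms(1) True]
       one_form_chart_differentiable[OF assms(2) True]]
    by (simp add: d1_def d0_def wedge11_def algebra_simps)
qed (simp add: d1_def d0_def wedge11_def)

end

section \<open>Forms and vector fields on LCS manifolds\<close>

locale lcs = atlas A
  for A :: "('m::{t2_space,second_countable_topology}, 'e::euclidean_space) chart set" +
  fixes \<Omega> :: "('m, 'e) form2" and \<omega> :: "('m, 'e) form1"
  assumes lcs: "lcs_manifold A \<Omega> \<omega>" and compact: "compact (UNIV :: 'm set)"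
begin

lemma two_form: "\<Omega> \<in> two_forms A" and lee_form: "\<omega> \<in> one_forms A"
  using lcs unfolding lcs_manifold_def by blast+

lemma d1_lee: "d1 A \<omega> c x v w = 0" and d2_form: "d2 A \<Omega> c x u v w = - wedge12 \<omega> \<Omega> c x u v w"
proof -
  have "d1 A \<omega> = (\<lambda>c x v w. 0)" "d2 A \<Omega> = (\<lambda>c x u v w. - wedge12 \<omega> \<Omega> c x u v w)"
    using lcs unfolding lcs_manifold_def by blast+
  then show "d1 A \<omega> c x v w = 0" "d2 A \<Omega> c x u v w = - wedge12 \<omega> \<Omega> c x u v w" by simp_all
qed

lemma form_smooth: "c \<in> A \<Longrightarrow> smooth_on (snd c ` fst c) (\<lambda>y. \<Omega> c (chart_inv c y) v w)"
  and form_bilinear: "c \<in> charts_at A x \<Longrightarrow> bilinear (\<Omega> c x)"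
  and form_alternating: "c \<in> charts_at A x \<Longrightarrow> \<Omega> c x v v = 0"
  and form_change: "c \<in> charts_at A x \<Longrightarrow> d \<in> charts_at A x \<Longrightarrow>
       \<Omega> c x v w = \<Omega> d x (chart_deriv c (snd d) x v) (chart_deriv c (snd d) x w)"
  and form_outside: "c \<notin> charts_at A x \<Longrightarrow> \<Omega> c x v w = 0"
  using two_form unfolding two_forms_def mem_Collect_eq by blast+

lemma form_linear: "c \<in> charts_at A x \<Longrightarrow> linear (\<Omega> c x v)" "c \<in> charts_at A x \<Longrightarrow> linear (\<lambda>v. \<Omega> c x v w)"
  using form_bilinear unfolding bilinear_def by blast+

lemma form_antisym: "\<Omega> c x v w = - \<Omega> c x w v"
proof (cases "c \<in> charts_at A x")
  case True
  have "\<Omega> c x (v + w) (v + w) = 0" by (rule form_alternating[OF True])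
  then have "\<Omega> c x v v + \<Omega> c x v w + (\<Omega> c x w v + \<Omega> c x w w) = 0"
    by (simp only: linear_add[OF form_linear(1)[OF True]] linear_add[OF form_linear(2)[OF True]])
  then show ?thesis using form_alternating[OF True] by simp
qed (simp add: form_outside)

lemma form_chart_differentiable:
  assumes "c \<in> charts_at A x"
  shows "chart_differentiable c (\<lambda>z. \<Omega> c z v w) x"
  using form_smooth[OF charts_atD(1)[OF assms], of v w]
  by (intro smooth_on_chart_differentiable assms) (simp add: comp_def)

end

context atlas begin

lemma
  assumes "X \<in> vector_fields A"
  shows vector_field_smooth: "c \<in> A \<Longrightarrow> smooth_on (snd c ` fst c) (X c \<circ> chart_inv c)"
    and vector_field_change: "c \<in> charts_at A x \<Longrightarrow> d \<in> charts_at A x \<Longrightarrow>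
       X d x = chart_deriv c (snd d) x (X c x)"
    and vector_field_outside: "c \<notin> charts_at A x \<Longrightarrow> X c x = 0"
  using assms unfolding vector_fields_def mem_Collect_eq by blast+

lemma vector_fieldsI:
  assumes "\<And>c. c \<in> A \<Longrightarrow> smooth_on (snd c ` fst c) (X c \<circ> chart_inv c)"
    and "\<And>c d x. c \<in> charts_at A x \<Longrightarrow> d \<in> charts_at A x \<Longrightarrow> X d x = chart_deriv c (snd d) x (X c x)"
    and "\<And>c x. c \<notin> charts_at A x \<Longrightarrow> X c x = 0"
  shows "X \<in> vector_fields A"
  unfolding vector_fields_def by (intro CollectI conjI ballI allI impI assms)

lemma vector_field_chart_differentiable:
  assumes "X \<in> vector_fields A" "c \<in> charts_at A x"
  shows "chart_differentiable c (X c) x"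
  using smooth_on_chart_differentiable[OF assms(2) vector_field_smooth[OF assms(1) charts_atD(1)[OF assms(2)]]] .

lemma vector_field_combine:
  assumes "X \<in> vector_fields A" "Y \<in> vector_fields A"
  shows "(\<lambda>c x. r *\<^sub>R X c x + s *\<^sub>R Y c x) \<in> vector_fields A"
proof (rule vector_fieldsI)
  fix c :: "('m, 'e) chart" assume c: "c \<in> A"
  show "smooth_on (snd c ` fst c) ((\<lambda>x. r *\<^sub>R X c x + s *\<^sub>R Y c x) \<circ> chart_inv c)"
    using smooth_on_add[OF smooth_on_scaleR[OF smooth_on_const[of _ r] vector_field_smooth[OF assms(1) c]]
       smooth_on_scaleR[OF smooth_on_const[of _ s] vector_field_smooth[OF assms(2) c]]]
    by (simp add: comp_def)
next
  fix c d :: "('m, 'e) chart" and x assume cd: "c \<in> charts_at A x" "d \<in> charts_at A x"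
  have "linear (chart_deriv c (snd d) x)"
    by (rule linear_chart_deriv[OF chart_differentiable_chart[OF cd]])
  then have "chart_deriv c (snd d) x (r *\<^sub>R X c x + s *\<^sub>R Y c x)
     = r *\<^sub>R chart_deriv c (snd d) x (X c x) + s *\<^sub>R chart_deriv c (snd d) x (Y c x)"
    by (simp add: linear_add linear_scale)
  then show "r *\<^sub>R X d x + s *\<^sub>R Y d x = chart_deriv c (snd d) x (r *\<^sub>R X c x + s *\<^sub>R Y c x)"
    using vector_field_change[OF assms(1) cd] vector_field_change[OF assms(2) cd] by metis
qed (simp add: vector_field_outside assms)

text \<open>The product rule for a linear form applied to a vector, both depending on the point; it follows by expanding
  the vector over a basis. It differentiates the contractions of forms with vector fields.\<close>

lemma
  fixes L :: "'m \<Rightarrow> 'e \<Rightarrow> real" and X :: "'m \<Rightarrow> 'e"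
  assumes c: "c \<in> charts_at A x" and L: "\<And>z. z \<in> fst c \<Longrightarrow> linear (L z)"
    and d: "\<And>b. chart_differentiable c (\<lambda>z. L z b) x" and X: "chart_differentiable c X x"
  shows chart_differentiable_linear_family: "chart_differentiable c (\<lambda>z. L z (X z)) x"
    and chart_deriv_linear_family:
      "chart_deriv c (\<lambda>z. L z (X z)) x v = chart_deriv c (\<lambda>z. L z (X x)) x v + L x (chart_deriv c X x v)"
proof -
  let ?S = "\<lambda>D X' v. (\<Sum>b\<in>Basis. (X x \<bullet> b) * chart_deriv c (\<lambda>z. L z b) x v) + L x (X' v)"
  have x: "chart_inv c (snd c x) = x" using chart_inv_chart charts_atD[OF c] by blast
  have expand: "L z w = (\<Sum>b\<in>Basis. (w \<bullet> b) * L z b)" if "z \<in> fst c" for z w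
    by (subst euclidean_representation[of w, symmetric])
       (simp only: linear_sum[OF L[OF that]] linear_scale[OF L[OF that]] real_scaleR_def)
  have main: "((\<lambda>z. L z (Z z)) \<circ> chart_inv c has_derivative
      (\<lambda>v. (\<Sum>b\<in>Basis. (X x \<bullet> b) * chart_deriv c (\<lambda>z. L z b) x v) + L x (chart_deriv c Z x v))) (at (snd c x))"
    if Z: "chart_differentiable c Z x" and "Z x = X x" for Z
  proof -
    have 1: "((\<lambda>y. (Z (chart_inv c y) \<bullet> b) * L (chart_inv c y) b) has_derivative
       (\<lambda>v. (X x \<bullet> b) * chart_deriv c (\<lambda>z. L z b) x v + (chart_deriv c Z x v \<bullet> b) * L x b)) (at (snd c x))" for b
      using has_derivative_mult[OF has_derivative_inner_left[OF chart_has_derivative[OF Z]] chart_has_derivative[OF d], of b b] that(2)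
      by (simp add: comp_def x)
    have "((\<lambda>y. \<Sum>b\<in>Basis. (Z (chart_inv c y) \<bullet> b) * L (chart_inv c y) b) has_derivative
       (\<lambda>v. \<Sum>b\<in>Basis. (X x \<bullet> b) * chart_deriv c (\<lambda>z. L z b) x v + (chart_deriv c Z x v \<bullet> b) * L x b)) (at (snd c x))"
      by (rule has_derivative_sum) (rule 1)
    then have "((\<lambda>z. \<Sum>b\<in>Basis. (Z z \<bullet> b) * L z b) \<circ> chart_inv c has_derivative
       (\<lambda>v. (\<Sum>b\<in>Basis. (X x \<bullet> b) * chart_deriv c (\<lambda>z. L z b) x v) + L x (chart_deriv c Z x v))) (at (snd c x))"
      by (simp add: comp_def sum.distrib expand[OF charts_atD(2)[OF c], of "chart_deriv c Z x _"])
    then show ?thesis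
      by (rule chart_deriv_transform[OF c open_UNIV UNIV_I, rotated]) (rule expand[symmetric])
  qed
  have const: "chart_differentiable c (\<lambda>z. X x) x"
    by (simp add: chart_differentiable_def comp_def)
  have "L x (chart_deriv c (\<lambda>z. X x) x v) = 0"
    by (simp only: chart_deriv_const linear_0[OF L[OF charts_atD(2)[OF c]]])
  then have "chart_deriv c (\<lambda>z. L z (X x)) x v = (\<Sum>b\<in>Basis. (X x \<bullet> b) * chart_deriv c (\<lambda>z. L z b) x v)"
    using chart_derivI(2)[OF main[OF const refl]] by simp
  then show "chart_deriv c (\<lambda>z. L z (X z)) x v = chart_deriv c (\<lambda>z. L z (X x)) x v + L x (chart_deriv c X x v)"
    using chart_derivI(2)[OF main[OF X refl]] by simp
  show "chart_differentiable c (\<lambda>z. L z (X z)) x"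
    using chart_derivI(1)[OF main[OF X refl]] .
qed

text \<open>The contraction is defined through a selected chart at each point; the transformation laws of the form and of
  the field cancel, so that any chart serves.\<close>

lemma contract1_in_chart:
  assumes "\<alpha> \<in> one_forms A" "X \<in> vector_fields A" "c \<in> charts_at A x"
  shows "contract1 A \<alpha> X x = \<alpha> c x (X c x)"
  unfolding contract1_def
  using one_form_change[OF assms(1,3) chart_at_in, of "X c x"] vector_field_change[OF assms(2,3) chart_at_in]
  by simp

lemma smooth_on_contraction:
  fixes L :: "'a::euclidean_space \<Rightarrow> 'e \<Rightarrow> real" and X :: "'a \<Rightarrow> 'e"
  assumes "\<And>y. y \<in> S \<Longrightarrow> linear (L y)" "\<And>b. smooth_on S (\<lambda>y. L y b)" "smooth_on S X"
  shows "smooth_on S (\<lambda>y. L y (X y))"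
proof -
  have "smooth_on S (\<lambda>y. \<Sum>b\<in>Basis. (X y \<bullet> b) * L y b)"
    by (intro smooth_on_sum smooth_on_mult smooth_on_inner assms smooth_on_const)
  then show ?thesis
  proof (rule smooth_on_cong)
    fix y assume "y \<in> S"
    show "(\<Sum>b\<in>Basis. (X y \<bullet> b) * L y b) = L y (X y)"
      by (subst (2) euclidean_representation[of "X y", symmetric])
         (simp only: linear_sum[OF assms(1)[OF \<open>y \<in> S\<close>]] linear_scale[OF assms(1)[OF \<open>y \<in> S\<close>]] real_scaleR_def)
  qed
qed

lemma contract1_smooth:
  assumes "\<alpha> \<in> one_forms A" "X \<in> vector_fields A"
  shows "contract1 A \<alpha> X \<in> smooth_functions A"
  unfolding smooth_functions_def
proof (intro CollectI ballI)
  fix c assume c: "c \<in> A"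
  have ch: "c \<in> charts_at A (chart_inv c y)" if "y \<in> snd c ` fst c" for y
    using c chart_inv_in[OF c that] by (simp add: charts_at_def)
  have "smooth_on (snd c ` fst c) (\<lambda>y. \<alpha> c (chart_inv c y) (X c (chart_inv c y)))"
    using vector_field_smooth[OF assms(2) c]
    by - (rule smooth_on_contraction[where L = "\<lambda>y. \<alpha> c (chart_inv c y)" and X = "\<lambda>y. X c (chart_inv c y)"],
      rule one_form_linear[OF assms(1) ch], assumption, rule one_form_smooth[OF assms(1) c], simp add: comp_def)
  then show "smooth_on (snd c ` fst c) (contract1 A \<alpha> X \<circ> chart_inv c)"
    by (rule smooth_on_cong) (simp add: contract1_in_chart[OF assms ch])
qed

end

context lcs begin

lemma contract2_one_form:
  assumes X: "X \<in> vector_fields A"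
  shows "contract2 \<Omega> X \<in> one_forms A"
proof (rule one_formsI)
  fix c :: "('m, 'e) chart" and v assume c: "c \<in> A"
  have ch: "c \<in> charts_at A (chart_inv c y)" if "y \<in> snd c ` fst c" for y
    using c chart_inv_in[OF c that] by (simp add: charts_at_def)
  show "smooth_on (snd c ` fst c) (\<lambda>y. contract2 \<Omega> X c (chart_inv c y) v)"
    using vector_field_smooth[OF X c] unfolding contract2_def
    by - (rule smooth_on_contraction[where L = "\<lambda>y w. \<Omega> c (chart_inv c y) w v" and X = "\<lambda>y. X c (chart_inv c y)"],
      rule form_linear(2)[OF ch], assumption, rule form_smooth[OF c], simp add: comp_def)
next
  fix c d :: "('m, 'e) chart" and x v assume "c \<in> charts_at A x" "d \<in> charts_at A x"
  from form_change[OF this, of "X c x" v] vector_field_change[OF X this]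
  show "contract2 \<Omega> X c x v = contract2 \<Omega> X d x (chart_deriv c (snd d) x v)"
    by (simp add: contract2_def)
next
  fix c :: "('m, 'e) chart" and x assume "c \<in> charts_at A x"
  then show "linear (contract2 \<Omega> X c x)" using form_linear(1) by (simp add: contract2_def)
qed (simp add: contract2_def form_outside)

section \<open>Lichnerowicz cohomology\<close>

lemma dw0_one_form: "f \<in> smooth_functions A \<Longrightarrow> dw0 A \<omega> f \<in> one_forms A"
  unfolding dw0_def by (intro one_form_add d0_one_form one_form_mult lee_form)

lemma dw1_add:
  assumes "\<alpha> \<in> one_forms A" "\<beta> \<in> one_forms A"
  shows "dw1 A \<omega> (\<lambda>c x v. \<alpha> c x v + \<beta> c x v) c x v w = dw1 A \<omega> \<alpha> c x v w + dw1 A \<omega> \<beta> c x v w"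
  unfolding dw1_def d1_add[OF assms] by (simp add: wedge11_def algebra_simps)

lemma dw1_mult:
  assumes "f \<in> smooth_functions A" "\<alpha> \<in> one_forms A"
  shows "dw1 A \<omega> (\<lambda>c x v. f x * \<alpha> c x v) c x v w = wedge11 (d0 A f) \<alpha> c x v w + f x * dw1 A \<omega> \<alpha> c x v w"
  unfolding dw1_def d1_mult[OF assms] by (simp add: wedge11_def algebra_simps)

lemma dw1_scale:
  assumes "\<alpha> \<in> one_forms A"
  shows "dw1 A \<omega> (\<lambda>c x v. k * \<alpha> c x v) c x v w = k * dw1 A \<omega> \<alpha> c x v w"
  using dw1_mult[OF smooth_function_const[of k] assms] by (simp add: wedge11_def d0_def chart_deriv_const)

lemma dw1_dw0:
  assumes "f \<in> smooth_functions A"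
  shows "dw1 A \<omega> (dw0 A \<omega> f) c x v w = 0"
proof -
  have "d1 A (dw0 A \<omega> f) c x v w = d1 A (d0 A f) c x v w + d1 A (\<lambda>c x v. f x * \<omega> c x v) c x v w"
    unfolding dw0_def by (rule d1_add[OF d0_one_form[OF assms] one_form_mult[OF assms lee_form]])
  then show ?thesis
    by (simp add: dw1_def d1_d0[OF assms] d1_mult[OF assms lee_form] d1_lee wedge11_def dw0_def algebra_simps)
qed

lemma dw0_add:
  assumes "f \<in> smooth_functions A" "g \<in> smooth_functions A"
  shows "dw0 A \<omega> (\<lambda>x. f x + g x) c x v = dw0 A \<omega> f c x v + dw0 A \<omega> g c x v"
  using assms by (simp add: dw0_def d0_def chart_deriv_add smooth_function_chart_differentiable algebra_simps)

lemma dw0_scale: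
  assumes "f \<in> smooth_functions A"
  shows "dw0 A \<omega> (\<lambda>x. k * f x) c x v = k * dw0 A \<omega> f c x v"
  using assms chart_deriv_mult[of c x "\<lambda>_. k" f v]
    smooth_function_chart_differentiable[OF smooth_function_const[of k], of c x]
  by (simp add: dw0_def d0_def smooth_function_chart_differentiable chart_deriv_const algebra_simps)

lemma exact_zero: "(\<lambda>c x v. 0) \<in> exact1 A \<omega>"
  unfolding exact1_def
  by (rule image_eqI[OF _ smooth_function_const[of 0]]) (auto simp: dw0_def d0_def chart_deriv_const fun_eq_iff)

lemma exact_add:
  assumes "\<alpha> \<in> exact1 A \<omega>" "\<beta> \<in> exact1 A \<omega>"
  shows "(\<lambda>c x v. \<alpha> c x v + \<beta> c x v) \<in> exact1 A \<omega>"
proof -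
  obtain f g where "\<alpha> = dw0 A \<omega> f" "\<beta> = dw0 A \<omega> g" "f \<in> smooth_functions A" "g \<in> smooth_functions A"
    using assms unfolding exact1_def by blast
  then show ?thesis unfolding exact1_def
    by (intro image_eqI[OF _ smooth_function_add[of f g]]) (simp_all add: dw0_add fun_eq_iff)
qed

lemma exact_scale:
  assumes "\<alpha> \<in> exact1 A \<omega>"
  shows "(\<lambda>c x v. k * \<alpha> c x v) \<in> exact1 A \<omega>"
proof -
  obtain f where "\<alpha> = dw0 A \<omega> f" "f \<in> smooth_functions A" using assms unfolding exact1_def by blast
  then show ?thesis unfolding exact1_def
    by (intro image_eqI[OF _ smooth_function_mult[OF smooth_function_const[of k], of f]]) (simp_all add: dw0_scale fun_eq_iff)
qed

lemma exact_minus: "\<alpha> \<in> exact1 A \<omega> \<Longrightarrow> (\<lambda>c x v. - \<alpha> c x v) \<in> exact1 A \<omega>"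
  using exact_scale[of \<alpha> "-1"] by simp

lemma carrier_closed1: "\<alpha> \<in> carrier (closed1 A \<omega>) \<longleftrightarrow> \<alpha> \<in> one_forms A \<and> (\<forall>c x v w. dw1 A \<omega> \<alpha> c x v w = 0)"
  by (auto simp: closed1_def fun_eq_iff)

lemma comm_group_closed1: "comm_group (closed1 A \<omega>)"
proof (rule comm_groupI)
  fix \<alpha> \<beta> assume a: "\<alpha> \<in> carrier (closed1 A \<omega>)" "\<beta> \<in> carrier (closed1 A \<omega>)"
  show "\<alpha> \<otimes>\<^bsub>closed1 A \<omega>\<^esub> \<beta> \<in> carrier (closed1 A \<omega>)"
    using a unfolding carrier_closed1 by (simp add: closed1_def dw1_add one_form_add)
next
  show "\<one>\<^bsub>closed1 A \<omega>\<^esub> \<in> carrier (closed1 A \<omega>)"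
    using dw1_scale[OF one_form_zero, of 0] unfolding carrier_closed1 by (simp add: closed1_def one_form_zero)
next
  fix \<alpha> assume a: "\<alpha> \<in> carrier (closed1 A \<omega>)"
  then have "(\<lambda>c x v. -1 * \<alpha> c x v) \<in> carrier (closed1 A \<omega>)"
    unfolding carrier_closed1 using one_form_mult[OF smooth_function_const[of "-1"], of \<alpha>] dw1_scale[of \<alpha> "-1"] by simp
  moreover have "(\<lambda>c x v. -1 * \<alpha> c x v) \<otimes>\<^bsub>closed1 A \<omega>\<^esub> \<alpha> = \<one>\<^bsub>closed1 A \<omega>\<^esub>"
    by (simp add: closed1_def)
  ultimately show "\<exists>\<beta>\<in>carrier (closed1 A \<omega>). \<beta> \<otimes>\<^bsub>closed1 A \<omega>\<^esub> \<alpha> = \<one>\<^bsub>closed1 A \<omega>\<^esub>" by blast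
qed (simp_all add: closed1_def add_ac)

lemma exact_closed: "exact1 A \<omega> \<subseteq> carrier (closed1 A \<omega>)"
  unfolding exact1_def using carrier_closed1 dw0_one_form dw1_dw0 by auto

lemma subgroup_exact: "subgroup (exact1 A \<omega>) (closed1 A \<omega>)"
proof -
  interpret comm_group "closed1 A \<omega>" by (rule comm_group_closed1)
  show ?thesis
  proof (rule subgroupI[OF exact_closed])
    show "exact1 A \<omega> \<noteq> {}" using exact_zero by blast
    show "\<alpha> \<otimes>\<^bsub>closed1 A \<omega>\<^esub> \<beta> \<in> exact1 A \<omega>" if "\<alpha> \<in> exact1 A \<omega>" "\<beta> \<in> exact1 A \<omega>" for \<alpha> \<beta>
      using exact_add[OF that] by (simp add: closed1_def)
    show "inv\<^bsub>closed1 A \<omega>\<^esub> \<alpha> \<in> exact1 A \<omega>" if "\<alpha> \<in> exact1 A \<omega>" for \<alpha>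
    proof -
      have "(\<lambda>c x v. - \<alpha> c x v) \<otimes>\<^bsub>closed1 A \<omega>\<^esub> \<alpha> = \<one>\<^bsub>closed1 A \<omega>\<^esub>" by (simp add: closed1_def)
      then have "inv\<^bsub>closed1 A \<omega>\<^esub> \<alpha> = (\<lambda>c x v. - \<alpha> c x v)"
        using inv_equality exact_closed exact_minus[OF that] that by blast
      then show ?thesis using exact_minus[OF that] by simp
    qed
  qed
qed

lemma comm_group_H1: "comm_group (H1 A \<omega>)"
  unfolding H1_def by (rule comm_group.abelian_FactGroup[OF comm_group_closed1 subgroup_exact])

lemma class1_iff: "\<gamma> \<in> class1 A \<omega> \<alpha> \<longleftrightarrow> (\<exists>h\<in>exact1 A \<omega>. \<gamma> = (\<lambda>c x v. h c x v + \<alpha> c x v))"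
  by (auto simp: class1_def r_coset_def closed1_def)

lemma class1_eqI:
  assumes "(\<lambda>c x v. \<alpha> c x v - \<beta> c x v) \<in> exact1 A \<omega>"
  shows "class1 A \<omega> \<alpha> = class1 A \<omega> \<beta>"
proof -
  have "class1 A \<omega> \<alpha> \<subseteq> class1 A \<omega> \<beta>" if a: "(\<lambda>c x v. \<alpha> c x v - \<beta> c x v) \<in> exact1 A \<omega>" for \<alpha> \<beta>
  proof
    fix \<gamma> assume "\<gamma> \<in> class1 A \<omega> \<alpha>"
    then obtain h where h: "h \<in> exact1 A \<omega>" "\<gamma> = (\<lambda>c x v. h c x v + \<alpha> c x v)"
      unfolding class1_iff by blast
    have "\<gamma> = (\<lambda>c x v. (h c x v + (\<alpha> c x v - \<beta> c x v)) + \<beta> c x v)" by (simp add: h)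
    then show "\<gamma> \<in> class1 A \<omega> \<beta>"
      unfolding class1_iff by (rule bexI[OF _ exact_add[OF h(1) a]])
  qed
  then show ?thesis using assms exact_minus[OF assms] by (intro equalityI) simp_all
qed

lemma class1_mult: "class1 A \<omega> \<alpha> \<otimes>\<^bsub>H1 A \<omega>\<^esub> class1 A \<omega> \<beta> = class1 A \<omega> (\<lambda>c x v. \<alpha> c x v + \<beta> c x v)"
proof (rule Set.set_eqI)
  fix \<gamma>
  have "\<gamma> \<in> class1 A \<omega> \<alpha> \<otimes>\<^bsub>H1 A \<omega>\<^esub> class1 A \<omega> \<beta> \<longleftrightarrow>
    (\<exists>\<gamma>1\<in>class1 A \<omega> \<alpha>. \<exists>\<gamma>2\<in>class1 A \<omega> \<beta>. \<gamma> = (\<lambda>c x v. \<gamma>1 c x v + \<gamma>2 c x v))"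
    by (auto simp: H1_def FactGroup_def set_mult_def closed1_def)
  also have "\<dots> \<longleftrightarrow> (\<exists>h\<in>exact1 A \<omega>. \<exists>k\<in>exact1 A \<omega>. \<gamma> = (\<lambda>c x v. (h c x v + \<alpha> c x v) + (k c x v + \<beta> c x v)))"
  proof -
    have im: "class1 A \<omega> \<alpha> = (\<lambda>h c x v. h c x v + \<alpha> c x v) ` exact1 A \<omega>" for \<alpha>
      unfolding image_def using class1_iff[of _ \<alpha>] by (intro Set.set_eqI) simp
    show ?thesis unfolding im by simp
  qed
  also have "\<dots> \<longleftrightarrow> \<gamma> \<in> class1 A \<omega> (\<lambda>c x v. \<alpha> c x v + \<beta> c x v)"
  proof
    assume "\<exists>h\<in>exact1 A \<omega>. \<exists>k\<in>exact1 A \<omega>. \<gamma> = (\<lambda>c x v. (h c x v + \<alpha> c x v) + (k c x v + \<beta> c x v))"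
    then obtain h k where hk: "h \<in> exact1 A \<omega>" "k \<in> exact1 A \<omega>"
      "\<gamma> = (\<lambda>c x v. (h c x v + \<alpha> c x v) + (k c x v + \<beta> c x v))" by blast
    show "\<gamma> \<in> class1 A \<omega> (\<lambda>c x v. \<alpha> c x v + \<beta> c x v)"
      unfolding class1_iff by (rule bexI[OF _ exact_add[OF hk(1,2)]]) (simp add: hk(3) algebra_simps)
  next
    assume "\<gamma> \<in> class1 A \<omega> (\<lambda>c x v. \<alpha> c x v + \<beta> c x v)"
    then obtain h where h: "h \<in> exact1 A \<omega>" "\<gamma> = (\<lambda>c x v. h c x v + (\<alpha> c x v + \<beta> c x v))"
      unfolding class1_iff by blast
    show "\<exists>h\<in>exact1 A \<omega>. \<exists>k\<in>exact1 A \<omega>. \<gamma> = (\<lambda>c x v. (h c x v + \<alpha> c x v) + (k c x v + \<beta> c x v))"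
      by (rule bexI[OF _ h(1)], rule bexI[OF _ exact_zero]) (simp add: h(2) algebra_simps)
  qed
  finally show "\<gamma> \<in> class1 A \<omega> \<alpha> \<otimes>\<^bsub>H1 A \<omega>\<^esub> class1 A \<omega> \<beta> \<longleftrightarrow>
    \<gamma> \<in> class1 A \<omega> (\<lambda>c x v. \<alpha> c x v + \<beta> c x v)" .
qed

lemma class1_zero: "class1 A \<omega> (\<lambda>c x v. 0) = \<one>\<^bsub>H1 A \<omega>\<^esub>"
  by (auto simp: H1_def FactGroup_def class1_def r_coset_def closed1_def)

end

section \<open>The Lie algebra of the kernel\<close>

context lcs begin

lemma charts_at_inside: "c \<in> charts_at A x \<Longrightarrow> z \<in> fst c \<Longrightarrow> c \<in> charts_at A z"
  by (simp add: charts_at_def)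

lemma chart_deriv_antisym:
  assumes "c \<in> charts_at A x"
  shows "chart_deriv c (\<lambda>z. \<Omega> c z v w) x u = - chart_deriv c (\<lambda>z. \<Omega> c z w v) x u"
proof -
  have "chart_deriv c (\<lambda>z. \<Omega> c z v w + \<Omega> c z w v) x u = 0"
    using form_antisym[of c _ v w] chart_deriv_const[of c 0 x u] by simp
  then show ?thesis
    using chart_deriv_add[OF assms form_chart_differentiable[OF assms] form_chart_differentiable[OF assms], of v w w v u]
    by simp
qed

lemma chart_deriv_contract2:
  assumes "X \<in> vector_fields A" "c \<in> charts_at A x"
  shows "chart_deriv c (\<lambda>z. contract2 \<Omega> X c z w) x v =
    chart_deriv c (\<lambda>z. \<Omega> c z (X c x) w) x v + \<Omega> c x (chart_deriv c (X c) x v) w"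
  unfolding contract2_def
  by (rule chart_deriv_linear_family[OF assms(2), where L = "\<lambda>z u. \<Omega> c z u w"])
     (use assms in \<open>simp_all add: form_linear(2) charts_at_inside[OF assms(2)] form_chart_differentiable
        vector_field_chart_differentiable\<close>)

lemma dw1_contract2:
  assumes "X \<in> vector_fields A" "c \<in> charts_at A x"
  shows "dw1 A \<omega> (contract2 \<Omega> X) c x v w =
     chart_deriv c (\<lambda>z. \<Omega> c z (X c x) w) x v + \<Omega> c x (chart_deriv c (X c) x v) w
     - (chart_deriv c (\<lambda>z. \<Omega> c z (X c x) v) x w + \<Omega> c x (chart_deriv c (X c) x w) v)
     + (\<omega> c x v * \<Omega> c x (X c x) w - \<omega> c x w * \<Omega> c x (X c x) v)"
  using assms by (simp add: dw1_def d1_def chart_deriv_contract2 wedge11_def) (simp add: contract2_def)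

lemma dw1_outside: "c \<notin> charts_at A x \<Longrightarrow> dw1 A \<omega> \<alpha> c x v w = 0"
  by (simp add: dw1_def d1_def wedge11_def one_form_outside[OF lee_form])

lemma d2_in_chart:
  assumes "c \<in> charts_at A x"
  shows "chart_deriv c (\<lambda>z. \<Omega> c z v w) x u - chart_deriv c (\<lambda>z. \<Omega> c z u w) x v
        + chart_deriv c (\<lambda>z. \<Omega> c z u v) x w
     = - (\<omega> c x u * \<Omega> c x v w - \<omega> c x v * \<Omega> c x u w + \<omega> c x w * \<Omega> c x u v)"
  using d2_form[of c x u v w] assms by (simp add: d2_def wedge12_def)

text \<open>Cartan's formula \<open>L\<^sub>X \<Omega> = d i\<^sub>X \<Omega> + i\<^sub>X d\<Omega>\<close>, rewritten with \<open>d\<Omega> = - \<omega> \<and> \<Omega>\<close>.\<close>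

lemma lie2_eq:
  assumes X: "X \<in> vector_fields A"
  shows "lie2 A X \<Omega> c x v w = dw1 A \<omega> (contract2 \<Omega> X) c x v w - contract1 A \<omega> X x * \<Omega> c x v w"
proof (cases "c \<in> charts_at A x")
  case True
  show ?thesis
    using d2_in_chart[OF True, where u = "X c x" and v = v and w = w]
      form_antisym[of c x v "chart_deriv c (X c) x w"]
    unfolding dw1_contract2[OF X True] lie2_def contract1_in_chart[OF lee_form X True] 
    by (simp add: True algebra_simps)
qed (simp add: lie2_def dw1_outside form_outside)

lemma lie1_eq:
  assumes X: "X \<in> vector_fields A"
  shows "lie1 A X \<omega> = d0 A (contract1 A \<omega> X)"
proof (intro ext)
  fix c x v
  show "lie1 A X \<omega> c x v = d0 A (contract1 A \<omega> X) c x v"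
  proof (cases "c \<in> charts_at A x")
    case True
    have lin: "linear (\<omega> c z)" if "z \<in> fst c" for z
      by (rule one_form_linear[OF lee_form charts_at_inside[OF True that]])
    note L = lin one_form_chart_differentiable[OF lee_form True] vector_field_chart_differentiable[OF X True]
    have "chart_deriv c (contract1 A \<omega> X) x = chart_deriv c (\<lambda>z. \<omega> c z (X c z)) x"
      by (rule chart_deriv_cong(2)[OF True _ chart_differentiable_linear_family[OF True L]])
         (simp add: contract1_in_chart[OF lee_form X charts_at_inside[OF True]])
    then have "d0 A (contract1 A \<omega> X) c x v = chart_deriv c (\<lambda>z. \<omega> c z (X c x)) x v + \<omega> c x (chart_deriv c (X c) x v)"
      using chart_deriv_linear_family[OF True L] True by (simp add: d0_def)
    then show ?thesis
      using d1_lee[of c x v "X c x"] True by (simp add: lie1_def d1_def)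
  qed (simp add: lie1_def d0_def)
qed

text \<open>By the preceding lemmas the condition \<open>L\<^sub>X \<Omega> = - \<omega>(X) \<Omega>\<close> amounts to the closedness of \<open>i\<^sub>X \<Omega>\<close>, and \<open>L\<^sub>X \<omega> = d (\<omega>(X))\<close> holds
  because \<open>\<omega>\<close> is closed; the supports are compact because the manifold is.\<close>

lemma kerPhi_iff:
  "X \<in> kerPhi A \<Omega> \<omega> \<longleftrightarrow> X \<in> vector_fields A \<and> (\<forall>c x v w. dw1 A \<omega> (contract2 \<Omega> X) c x v w = 0)"
proof
  assume "X \<in> kerPhi A \<Omega> \<omega>"
  then have X: "X \<in> vector_fields A"
    and l: "lie2 A X \<Omega> = (\<lambda>c x v w. - contract1 A \<omega> X x * \<Omega> c x v w)"
    unfolding kerPhi_def lcs_field_with_def by blast+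
  have "lie2 A X \<Omega> c x v w = - contract1 A \<omega> X x * \<Omega> c x v w" for c x v w by (simp add: l)
  then show "X \<in> vector_fields A \<and> (\<forall>c x v w. dw1 A \<omega> (contract2 \<Omega> X) c x v w = 0)"
    using X unfolding lie2_eq[OF X] by simp
next
  assume X: "X \<in> vector_fields A \<and> (\<forall>c x v w. dw1 A \<omega> (contract2 \<Omega> X) c x v w = 0)"
  have "compact (closure {x. \<exists>c\<in>charts_at A x. X c x \<noteq> 0})"
    using compact_Int_closed[OF compact closed_closure] by simp
  moreover have closed: "dw1 A \<omega> (contract2 \<Omega> X) c x v w = 0" for c x v w using X by blast
  have "lie2 A X \<Omega> = (\<lambda>c x v w. - contract1 A \<omega> X x * \<Omega> c x v w)"
    by (intro ext) (simp add: lie2_eq[OF conjunct1[OF X]] closed)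
  ultimately show "X \<in> kerPhi A \<Omega> \<omega>"
    using X contract1_smooth[OF lee_form, of X] lie1_eq[of X] unfolding kerPhi_def lcs_field_with_def by blast
qed

lemma kerPhi_vector_field: "X \<in> kerPhi A \<Omega> \<omega> \<Longrightarrow> X \<in> vector_fields A"
  by (simp add: kerPhi_iff)

lemma kerPhi_combine:
  assumes "X \<in> kerPhi A \<Omega> \<omega>" "Y \<in> kerPhi A \<Omega> \<omega>"
  shows "(\<lambda>c x. r *\<^sub>R X c x + s *\<^sub>R Y c x) \<in> kerPhi A \<Omega> \<omega>"
proof -
  have X: "X \<in> vector_fields A" "\<And>c x v w. dw1 A \<omega> (contract2 \<Omega> X) c x v w = 0"
    and Y: "Y \<in> vector_fields A" "\<And>c x v w. dw1 A \<omega> (contract2 \<Omega> Y) c x v w = 0"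
    using assms unfolding kerPhi_iff by blast+
  have "contract2 \<Omega> (\<lambda>c x. r *\<^sub>R X c x + s *\<^sub>R Y c x) c x v = r * contract2 \<Omega> X c x v + s * contract2 \<Omega> Y c x v" for c x v
    by (cases "c \<in> charts_at A x")
       (simp_all add: contract2_def form_outside linear_add[OF form_linear(2)] linear_scale[OF form_linear(2)])
  then have "contract2 \<Omega> (\<lambda>c x. r *\<^sub>R X c x + s *\<^sub>R Y c x) = (\<lambda>c x v. r * contract2 \<Omega> X c x v + s * contract2 \<Omega> Y c x v)"
    by (intro ext)
  then show ?thesis
    using dw1_add[OF one_form_mult[OF smooth_function_const contract2_one_form[OF X(1)]]
      one_form_mult[OF smooth_function_const contract2_one_form[OF Y(1)]]]
    by (simp add: kerPhi_iff vector_field_combine X Y dw1_scale contract2_one_form)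
qed

lemma kerPhi_zero: "(\<lambda>c x. 0) \<in> kerPhi A \<Omega> \<omega>"
proof -
  have vf: "(\<lambda>c x. 0) \<in> vector_fields A"
  proof (rule vector_fieldsI)
    show "smooth_on (snd c ` fst c) ((\<lambda>x. 0::'e) \<circ> chart_inv c)" for c :: "('m, 'e) chart"
      by (simp add: comp_def smooth_on_const)
    show "0 = chart_deriv c (snd d) x 0" if "c \<in> charts_at A x" "d \<in> charts_at A x" for c d x
      using linear_0[OF linear_chart_deriv[OF chart_differentiable_chart[OF that]]] by simp
  qed simp
  have "contract2 \<Omega> (\<lambda>c x. 0) c x v = 0" for c x v
    by (cases "c \<in> charts_at A x") (simp_all add: contract2_def form_outside linear_0[OF form_linear(2)])
  then have "contract2 \<Omega> (\<lambda>c x. 0) = (\<lambda>c x v. 0)" by (intro ext)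
  then show ?thesis using dw1_scale[OF one_form_zero, of 0] vf by (simp add: kerPhi_iff)
qed

text \<open>In coordinates the bracket of \<open>X\<close> and \<open>Y\<close> is \<open>DY(X) - DX(Y)\<close>, so this says that \<open>i\<^bsub>[X,Y]\<^esub> \<Omega>\<close> is
  exact, with primitive \<open>- \<Omega>(X, Y)\<close>. It is obtained from the closedness of \<open>i\<^sub>X \<Omega>\<close>, evaluated
  on \<open>(v, Y)\<close>, that of \<open>i\<^sub>Y \<Omega>\<close>, evaluated on \<open>(v, X)\<close>, and \<open>d\<Omega> = - \<omega> \<and> \<Omega>\<close>, evaluated on \<open>(v, X, Y)\<close>.\<close>

lemma contract_bracket_exact:
  assumes "X \<in> kerPhi A \<Omega> \<omega>" "Y \<in> kerPhi A \<Omega> \<omega>" and c: "c \<in> charts_at A x"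
  shows "\<Omega> c x (chart_deriv c (X c) x (Y c x) - chart_deriv c (Y c) x (X c x)) v
     = dw0 A \<omega> (contract1 A (contract2 \<Omega> X) Y) c x v"
proof -
  have X: "X \<in> vector_fields A" "dw1 A \<omega> (contract2 \<Omega> X) c x v (Y c x) = 0"
    and Y: "Y \<in> vector_fields A" "dw1 A \<omega> (contract2 \<Omega> Y) c x v (X c x) = 0"
    using assms unfolding kerPhi_iff by blast+
  have \<alpha>: "contract2 \<Omega> X \<in> one_forms A" by (rule contract2_one_form[OF X(1)])
  have lin: "linear (contract2 \<Omega> X c z)" if "z \<in> fst c" for z
    by (rule one_form_linear[OF \<alpha> charts_at_inside[OF c that]])
  note L = lin one_form_chart_differentiable[OF \<alpha> c] vector_field_chart_differentiable[OF Y(1) c]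
  have "chart_deriv c (contract1 A (contract2 \<Omega> X) Y) x = chart_deriv c (\<lambda>z. contract2 \<Omega> X c z (Y c z)) x"
    by (rule chart_deriv_cong(2)[OF c _ chart_differentiable_linear_family[OF c L]])
       (simp add: contract1_in_chart[OF \<alpha> Y(1) charts_at_inside[OF c]])
  then have d: "dw0 A \<omega> (contract1 A (contract2 \<Omega> X) Y) c x v =
      chart_deriv c (\<lambda>z. \<Omega> c z (X c x) (Y c x)) x v + \<Omega> c x (chart_deriv c (X c) x v) (Y c x)
      + \<Omega> c x (X c x) (chart_deriv c (Y c) x v) + \<Omega> c x (X c x) (Y c x) * \<omega> c x v"
    using chart_deriv_linear_family[OF c L] c chart_deriv_contract2[OF X(1) c]
    by (simp add: dw0_def d0_def contract1_in_chart[OF \<alpha> Y(1) c]) (simp add: contract2_def)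
  have sub: "\<Omega> c x (a - b) v = \<Omega> c x a v - \<Omega> c x b v" for a b
    by (rule linear_diff[OF form_linear(2)[OF c]])
  show ?thesis
    unfolding sub d
    using X(2)[unfolded dw1_contract2[OF X(1) c]] Y(2)[unfolded dw1_contract2[OF Y(1) c]]
      d2_in_chart[OF c, where u = v and v = "X c x" and w = "Y c x"]
      form_antisym[of c x "Y c x" "X c x"] form_antisym[of c x v "X c x"] form_antisym[of c x "Y c x" v]
      form_antisym[of c x "chart_deriv c (Y c) x v" "X c x"]
      chart_deriv_antisym[OF c, of "Y c x" "X c x" v] chart_deriv_antisym[OF c, of v "X c x" "Y c x"]
      chart_deriv_antisym[OF c, of v "Y c x" "X c x"]
    by (simp add: algebra_simps)
qed

end

section \<open>Tangent maps and LCS diffeomorphisms\<close>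

context atlas begin

lemma smooth_mapD: "smooth_map A g \<Longrightarrow> continuous_on UNIV g"
  by (simp add: smooth_map_def)

text \<open>The tangent map of \<open>g\<close> at \<open>x\<close> in the charts \<open>c\<close> and \<open>d\<close> is \<open>chart_deriv c (snd d \<circ> g) x\<close>.\<close>

lemma tangent_map_compose:
  assumes "smooth_map A g" "smooth_map A h"
    and "c \<in> charts_at A x" "d \<in> charts_at A (h x)" "e \<in> charts_at A (g (h x))"
  shows "chart_deriv c (snd e \<circ> (g \<circ> h)) x v = chart_deriv d (snd e \<circ> g) (h x) (chart_deriv c (snd d \<circ> h) x v)"
  using chart_deriv_compose(2)[OF assms(3,4) smooth_mapD[OF assms(2)]
      smooth_map_chart_differentiable[OF assms(2-4)] smooth_map_chart_differentiable[OF assms(1,4,5)]]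
  by (simp only: o_assoc)

lemma tangent_map_change:
  assumes "smooth_map A g" "c \<in> charts_at A x" "d \<in> charts_at A (g x)" "e \<in> charts_at A (g x)"
  shows "chart_deriv c (snd e \<circ> g) x v = chart_deriv d (snd e) (g x) (chart_deriv c (snd d \<circ> g) x v)"
  using chart_deriv_compose(2)[OF assms(2,3) smooth_mapD[OF assms(1)]
      smooth_map_chart_differentiable[OF assms(1-3)] chart_differentiable_chart[OF assms(3,4)]] .

lemma tangent_map_inverse:
  assumes "diffeo A g" "d \<in> charts_at A q" "c \<in> charts_at A (g q)"
  shows "chart_deriv d (snd c \<circ> g) q (chart_deriv c (snd d \<circ> inv_into UNIV g) (g q) v) = v"
proof -
  have b: "bij g" and s: "smooth_map A g" "smooth_map A (inv_into UNIV g)" using assms(1) by (auto simp: diffeo_def)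
  have q: "(inv_into UNIV g) (g q) = q" using b by (simp add: bij_is_inj)
  have gi: "g \<circ> inv_into UNIV g = id" using b surj_iff bij_is_surj by blast
  have "chart_deriv c (snd c \<circ> (g \<circ> inv_into UNIV g)) (g q) v =
     chart_deriv d (snd c \<circ> g) q (chart_deriv c (snd d \<circ> inv_into UNIV g) (g q) v)"
    using tangent_map_compose[OF s assms(3), of d c v] assms q by simp
  then show ?thesis using chart_deriv_chart_self[OF assms(3)] by (simp add: gi)
qed

lemma smooth_function_compose:
  assumes f: "f \<in> smooth_functions A" and h: "smooth_map A h"
  shows "f \<circ> h \<in> smooth_functions A"
  unfolding smooth_functions_def
proof (intro CollectI ballI smooth_onI_local)
  fix c y assume c: "c \<in> A" and y: "y \<in> snd c ` fst c"
  define d where "d = chart_at A (h (chart_inv c y))"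
  have d: "d \<in> A" "h (chart_inv c y) \<in> fst d"
    using chart_at_in[of "h (chart_inv c y)"] by (simp_all add: d_def charts_at_def)
  define U where "U = snd c ` (fst c \<inter> h -` fst d)"
  have "open (h -` fst d)" using smooth_mapD[OF h] open_chart[OF d(1)] by (simp add: continuous_on_open_vimage)
  then have oU: "open U" unfolding U_def by (rule open_chart_image_Int[OF c])
  have yU: "y \<in> U" using y d(2) chart_image_Int[OF c] by (simp add: U_def)
  have 1: "smooth_on U (snd d \<circ> h \<circ> chart_inv c)" using h c d(1) by (simp add: smooth_map_def U_def)
  have 2: "smooth_on (snd d ` fst d) (f \<circ> chart_inv d)" using f d(1) by (simp add: smooth_functions_def)
  have hin: "h (chart_inv c y) \<in> fst d" if "y \<in> U" for y
    using that chart_image_Int[OF c] by (simp add: U_def)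
  have "smooth_on U (\<lambda>y. (f \<circ> chart_inv d) ((snd d \<circ> h \<circ> chart_inv c) y))"
    by (rule smooth_on_compose[OF 2 1]) (use hin in auto)
  then have "smooth_on U (f \<circ> h \<circ> chart_inv c)"
    by (rule smooth_on_cong) (simp add: chart_inv_chart[OF d(1) hin])
  then have "smooth_on (snd c ` fst c \<inter> U) (f \<circ> h \<circ> chart_inv c)" by (rule smooth_on_subset) simp
  then show "\<exists>U. open U \<and> y \<in> U \<and> smooth_on (snd c ` fst c \<inter> U) (f \<circ> h \<circ> chart_inv c)"
    using oU yU by blast
qed

lemma smooth_function_inverse:
  assumes "f \<in> smooth_functions A" "\<And>x. f x \<noteq> 0"
  shows "(\<lambda>x. inverse (f x)) \<in> smooth_functions A"
  unfolding smooth_functions_def comp_def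
proof (intro CollectI ballI)
  fix c assume "c \<in> A"
  then have "smooth_on (snd c ` fst c) (\<lambda>y. f (chart_inv c y))"
    using assms(1) by (simp add: smooth_functions_def comp_def)
  then show "smooth_on (snd c ` fst c) (\<lambda>y. inverse (f (chart_inv c y)))"
    by (rule smooth_on_inverse) (rule assms(2))
qed

lemma
  assumes "f \<in> smooth_functions A" "\<And>x. f x > 0" "c \<in> charts_at A x"
  shows chart_differentiable_ln: "chart_differentiable c (\<lambda>z. ln (f z)) x"
    and chart_deriv_ln: "chart_deriv c (\<lambda>z. ln (f z)) x v = inverse (f x) * chart_deriv c f x v"
    and chart_deriv_inv: "chart_deriv c (\<lambda>z. inverse (f z)) x v = - (inverse (f x) * inverse (f x) * chart_deriv c f x v)"
proof -
  have x: "chart_inv c (snd c x) = x" using chart_inv_chart charts_atD[OF assms(3)] by blast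
  note D = chart_has_derivative[OF smooth_function_chart_differentiable[OF assms(1,3)]]
  have "((\<lambda>z. ln (f z)) \<circ> chart_inv c has_derivative (\<lambda>v. inverse (f x) * chart_deriv c f x v)) (at (snd c x))"
    using has_derivative_ln[OF _ D] assms(2)[of x] by (simp add: comp_def x divide_inverse mult.commute)
  from chart_derivI[OF this] show "chart_differentiable c (\<lambda>z. ln (f z)) x"
    "chart_deriv c (\<lambda>z. ln (f z)) x v = inverse (f x) * chart_deriv c f x v" by auto
  have "((\<lambda>z. inverse (f z)) \<circ> chart_inv c has_derivative (\<lambda>v. - (inverse (f x) * chart_deriv c f x v * inverse (f x)))) (at (snd c x))"
    using Deriv.has_derivative_inverse[OF _ D] assms(2)[of x] by (simp add: comp_def x)
  from chart_derivI(2)[OF this]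
  show "chart_deriv c (\<lambda>z. inverse (f z)) x v = - (inverse (f x) * inverse (f x) * chart_deriv c f x v)" by simp
qed

lemma second_tangent_derivative:
  assumes g: "smooth_map A g" and d: "d \<in> charts_at A q" and c: "c \<in> charts_at A (g q)"
  shows "chart_differentiable d (\<lambda>z. chart_deriv d (snd c \<circ> g) z w) q"
    and "chart_deriv d (\<lambda>z. chart_deriv d (snd c \<circ> g) z w) q v = chart_deriv d (\<lambda>z. chart_deriv d (snd c \<circ> g) z v) q w"
proof -
  define U where "U = snd d ` (fst d \<inter> g -` fst c)"
  note dA = charts_atD[OF d] and cA = charts_atD[OF c]
  have "open (g -` fst c)" using smooth_mapD[OF g] open_chart[OF cA(1)] by (simp add: continuous_on_open_vimage)
  then have oU: "open U" unfolding U_def by (rule open_chart_image_Int[OF dA(1)])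
  have qU: "snd d q \<in> U" using dA cA unfolding U_def by blast
  have sm: "smooth_on U (snd c \<circ> g \<circ> chart_inv d)" using g cA dA by (simp add: smooth_map_def U_def)
  have 1: "((\<lambda>z. chart_deriv d (snd c \<circ> g) z w) \<circ> chart_inv d has_derivative
      frechet_derivative (\<lambda>y. frechet_derivative (snd c \<circ> g \<circ> chart_inv d) (at y) w) (at (snd d q))) (at (snd d q))" for w
  proof (rule has_derivative_transform_within_open[OF smooth_on_has_derivative[OF oU smooth_on_derivative[OF oU sm] qU] oU qU])
    fix y assume "y \<in> U"
    then have "y \<in> snd d ` fst d" unfolding U_def by blast
    then show "frechet_derivative (snd c \<circ> g \<circ> chart_inv d) (at y) w = ((\<lambda>z. chart_deriv d (snd c \<circ> g) z w) \<circ> chart_inv d) y"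
      by (simp add: chart_deriv_def chart_chart_inv[OF dA(1)])
  qed
  show "chart_differentiable d (\<lambda>z. chart_deriv d (snd c \<circ> g) z w) q" by (rule chart_derivI(1)[OF 1])
  show "chart_deriv d (\<lambda>z. chart_deriv d (snd c \<circ> g) z w) q v = chart_deriv d (\<lambda>z. chart_deriv d (snd c \<circ> g) z v) q w"
    unfolding chart_derivI(2)[OF 1] by (rule second_derivative_symmetric[OF oU sm qU])
qed

text \<open>The exterior derivative commutes with pullback: the terms containing second derivatives of \<open>g\<close> cancel.\<close>

lemma d1_pullback:
  assumes g: "smooth_map A g" and d: "d \<in> charts_at A q" and c: "c \<in> charts_at A (g q)"
    and \<alpha>: "\<alpha> \<in> one_forms A"
    and \<beta>: "\<And>z w. z \<in> fst d \<Longrightarrow> g z \<in> fst c \<Longrightarrow> \<beta> d z w = \<alpha> c (g z) (chart_deriv d (snd c \<circ> g) z w)"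
  shows "d1 A \<beta> d q v w = d1 A \<alpha> c (g q) (chart_deriv d (snd c \<circ> g) q v) (chart_deriv d (snd c \<circ> g) q w)"
proof -
  let ?T = "\<lambda>z. chart_deriv d (snd c \<circ> g) z"
  note dA = charts_atD[OF d] and cA = charts_atD[OF c]
  have lin: "linear (\<alpha> c (g z))" for z
  proof (cases "c \<in> charts_at A (g z)")
    case False
    then have "\<alpha> c (g z) = (\<lambda>v. 0)" using one_form_outside[OF \<alpha>] by blast
    then show ?thesis by (simp add: linear_zero)
  qed (rule one_form_linear[OF \<alpha>])
  have comp: "chart_differentiable d (\<lambda>z. \<alpha> c (g z) b) q"
    "chart_deriv d (\<lambda>z. \<alpha> c (g z) b) q v = chart_deriv c (\<lambda>z. \<alpha> c z b) (g q) (?T q v)" for b v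
    using chart_deriv_compose[OF d c smooth_mapD[OF g] smooth_map_chart_differentiable[OF g d c]
       one_form_chart_differentiable[OF \<alpha> c, of b]] by (simp_all add: comp_def)
  have op: "open (g -` fst c)" using smooth_mapD[OF g] open_chart[OF cA(1)] by (simp add: continuous_on_open_vimage)
  have "chart_deriv d (\<lambda>z. \<beta> d z w) q v =
     chart_deriv c (\<lambda>z. \<alpha> c z (?T q w)) (g q) (?T q v) + \<alpha> c (g q) (chart_deriv d (\<lambda>z. ?T z w) q v)" for v w
  proof -
    have "chart_deriv d (\<lambda>z. \<beta> d z w) q = chart_deriv d (\<lambda>z. \<alpha> c (g z) (?T z w)) q"
      by (rule chart_derivI(2)[OF chart_deriv_transform[OF d op _ _ chart_has_derivative[OF
           chart_differentiable_linear_family[OF d lin comp(1) second_tangent_derivative(1)[OF g d c]]]]])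
         (use cA \<beta> in auto)
    then show ?thesis
      using chart_deriv_linear_family[OF d lin comp(1) second_tangent_derivative(1)[OF g d c]] by (simp add: comp(2))
  qed
  then show ?thesis
    using second_tangent_derivative(2)[OF g d c, of v w] d c by (simp add: d1_def)
qed

end

context lcs begin

lemma Diff_OmegaI:
  assumes "diffeo A g" "a \<in> smooth_functions A" "\<And>x. a x > 0"
    and "\<And>c d x v w. c \<in> charts_at A x \<Longrightarrow> d \<in> charts_at A (g x) \<Longrightarrow>
      \<Omega> d (g x) (chart_deriv c (snd d \<circ> g) x v) (chart_deriv c (snd d \<circ> g) x w) = inverse (a x) * \<Omega> c x v w"
    and "\<And>c d x v. c \<in> charts_at A x \<Longrightarrow> d \<in> charts_at A (g x) \<Longrightarrow>
      \<omega> d (g x) (chart_deriv c (snd d \<circ> g) x v) = \<omega> c x v + chart_deriv c (\<lambda>z. ln (a z)) x v"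
  shows "g \<in> Diff_Omega A \<Omega> \<omega>"
proof -
  have "compact (closure {x. g x \<noteq> x})" using compact_Int_closed[OF compact closed_closure] by simp
  moreover have "pullback2 A g \<Omega> = (\<lambda>c x v w. inverse (a x) * \<Omega> c x v w)"
    by (intro ext) (simp add: pullback2_def Let_def assms(4)[OF _ chart_at_in] form_outside)
  moreover have "pullback1 A g \<omega> = (\<lambda>c x v. \<omega> c x v + d0 A (\<lambda>z. ln (a z)) c x v)"
    by (intro ext) (simp add: pullback1_def Let_def assms(5)[OF _ chart_at_in] d0_def one_form_outside[OF lee_form])
  ultimately show ?thesis using assms(1-3) unfolding Diff_Omega_def by blast
qed

text \<open>The pullback conditions of an LCS diffeomorphism, expressed in arbitrary charts at a point and at its image.\<close>

definition conformal_factor :: "('m \<Rightarrow> 'm) \<Rightarrow> ('m \<Rightarrow> real) \<Rightarrow> bool" where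
  "conformal_factor g a \<longleftrightarrow> diffeo A g \<and> a \<in> smooth_functions A \<and> (\<forall>x. a x > 0) \<and>
    (\<forall>x. \<forall>c\<in>charts_at A x. \<forall>d\<in>charts_at A (g x). \<forall>v w.
      \<Omega> d (g x) (chart_deriv c (snd d \<circ> g) x v) (chart_deriv c (snd d \<circ> g) x w) = inverse (a x) * \<Omega> c x v w) \<and>
    (\<forall>x. \<forall>c\<in>charts_at A x. \<forall>d\<in>charts_at A (g x). \<forall>v.
      \<omega> d (g x) (chart_deriv c (snd d \<circ> g) x v) = \<omega> c x v + chart_deriv c (\<lambda>z. ln (a z)) x v)"

lemma
  assumes "conformal_factor g a"
  shows factor_diffeo: "diffeo A g" and factor_smooth: "a \<in> smooth_functions A" and factor_pos: "a x > 0"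
    and factor_form: "c \<in> charts_at A x \<Longrightarrow> d \<in> charts_at A (g x) \<Longrightarrow>
      \<Omega> d (g x) (chart_deriv c (snd d \<circ> g) x v) (chart_deriv c (snd d \<circ> g) x w) = inverse (a x) * \<Omega> c x v w"
    and factor_lee: "c \<in> charts_at A x \<Longrightarrow> d \<in> charts_at A (g x) \<Longrightarrow>
      \<omega> d (g x) (chart_deriv c (snd d \<circ> g) x v) = \<omega> c x v + chart_deriv c (\<lambda>z. ln (a z)) x v"
  using assms unfolding conformal_factor_def diffeo_def by blast+

lemma Diff_Omega_factor:
  assumes "g \<in> Diff_Omega A \<Omega> \<omega>"
  obtains a where "conformal_factor g a"
proof -
  have g: "diffeo A g" using assms by (simp add: Diff_Omega_def)
  then have s: "smooth_map A g" by (simp add: diffeo_def)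
  obtain a where a: "a \<in> smooth_functions A" "\<forall>x. a x > 0"
    and p2: "pullback2 A g \<Omega> = (\<lambda>c x v w. inverse (a x) * \<Omega> c x v w)"
    and p1: "pullback1 A g \<omega> = (\<lambda>c x v. \<omega> c x v + d0 A (\<lambda>z. ln (a z)) c x v)"
    using assms unfolding Diff_Omega_def by blast
  have "conformal_factor g a"
    unfolding conformal_factor_def
  proof (intro conjI g a allI ballI)
    fix c d :: "('m, 'e) chart" and x v w assume cd: "c \<in> charts_at A x" "d \<in> charts_at A (g x)"
    note ch = tangent_map_change[OF s cd(1) cd(2) chart_at_in]
    show "\<Omega> d (g x) (chart_deriv c (snd d \<circ> g) x v) (chart_deriv c (snd d \<circ> g) x w) = inverse (a x) * \<Omega> c x v w"
      unfolding form_change[OF cd(2) chart_at_in, of "chart_deriv c (snd d \<circ> g) x v"] ch[symmetric]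
      using fun_cong[OF fun_cong[OF fun_cong[OF fun_cong[OF p2, of c], of x], of v], of w] cd(1)
      by (simp add: pullback2_def Let_def)
    show "\<omega> d (g x) (chart_deriv c (snd d \<circ> g) x v) = \<omega> c x v + chart_deriv c (\<lambda>z. ln (a z)) x v"
      unfolding one_form_change[OF lee_form cd(2) chart_at_in, of "chart_deriv c (snd d \<circ> g) x v"] ch[symmetric]
      using fun_cong[OF fun_cong[OF fun_cong[OF p1, of c], of x], of v] cd(1)
      by (simp add: pullback1_def d0_def Let_def)
  qed
  then show ?thesis by (rule that)
qed

lemma Diff_Omega_diffeo: "g \<in> Diff_Omega A \<Omega> \<omega> \<Longrightarrow> diffeo A g"
  by (simp add: Diff_Omega_def)

lemma Diff_Omega_id: "id \<in> Diff_Omega A \<Omega> \<omega>"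
proof (rule Diff_OmegaI[of id "\<lambda>x. 1"])
  show "diffeo A id" using smooth_map_id by (simp add: diffeo_def)
  fix c d :: "('m, 'e) chart" and x v w assume "c \<in> charts_at A x" "d \<in> charts_at A (id x)"
  then have cd: "c \<in> charts_at A x" "d \<in> charts_at A x" by simp_all
  show "\<Omega> d (id x) (chart_deriv c (snd d \<circ> id) x v) (chart_deriv c (snd d \<circ> id) x w) = inverse 1 * \<Omega> c x v w"
    using form_change[OF cd, of v w] by simp
  show "\<omega> d (id x) (chart_deriv c (snd d \<circ> id) x v) = \<omega> c x v + chart_deriv c (\<lambda>z. ln 1) x v"
    using one_form_change[OF lee_form cd, of v] by (simp add: chart_deriv_const)
qed (auto simp: smooth_function_const)

text \<open>The conformal factor of \<open>g \<circ> h\<close> is \<open>(a \<circ> h) \<cdot> b\<close>, where \<open>a\<close> and \<open>b\<close> are those of \<open>g\<close> and \<open>h\<close>.\<close>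

lemma Diff_Omega_compose:
  assumes g: "g \<in> Diff_Omega A \<Omega> \<omega>" and h: "h \<in> Diff_Omega A \<Omega> \<omega>" and gh: "diffeo A (g \<circ> h)"
  shows "g \<circ> h \<in> Diff_Omega A \<Omega> \<omega>"
proof -
  obtain a where fa: "conformal_factor g a" by (rule Diff_Omega_factor[OF g])
  note a = factor_diffeo[OF fa] factor_smooth[OF fa] factor_pos[OF fa] and a2 = factor_form[OF fa] and a1 = factor_lee[OF fa]
  obtain b where fb: "conformal_factor h b" by (rule Diff_Omega_factor[OF h])
  note b = factor_diffeo[OF fb] factor_smooth[OF fb] factor_pos[OF fb] and b2 = factor_form[OF fb] and b1 = factor_lee[OF fb]
  have s: "smooth_map A g" "smooth_map A h" using a(1) b(1) by (simp_all add: diffeo_def)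
  have sm: "a \<circ> h \<in> smooth_functions A" by (rule smooth_function_compose[OF a(2) s(2)])
  have pos: "(a \<circ> h) x > 0" for x using a(3) by simp
  show ?thesis
  proof (rule Diff_OmegaI[OF gh])
    show "(\<lambda>x. (a \<circ> h) x * b x) \<in> smooth_functions A" by (rule smooth_function_mult[OF sm b(2)])
    show "(a \<circ> h) x * b x > 0" for x using a(3) b(3) by simp
    fix c e :: "('m, 'e) chart" and x v w assume "c \<in> charts_at A x" "e \<in> charts_at A ((g \<circ> h) x)"
    then have ce: "c \<in> charts_at A x" "e \<in> charts_at A (g (h x))" by simp_all
    define d where "d = chart_at A (h x)"
    have d: "d \<in> charts_at A (h x)" unfolding d_def by (rule chart_at_in)
    note T = tangent_map_compose[OF s ce(1) d ce(2)]
    show "\<Omega> e ((g \<circ> h) x) (chart_deriv c (snd e \<circ> (g \<circ> h)) x v) (chart_deriv c (snd e \<circ> (g \<circ> h)) x w)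
        = inverse ((a \<circ> h) x * b x) * \<Omega> c x v w"
      unfolding T comp_apply[of g h x] a2[OF d ce(2)] b2[OF ce(1) d] by simp
    have "chart_deriv d (\<lambda>z. ln (a z)) (h x) (chart_deriv c (snd d \<circ> h) x v) = chart_deriv c (\<lambda>z. ln ((a \<circ> h) z)) x v"
      using chart_deriv_compose(2)[OF ce(1) d smooth_mapD[OF s(2)] smooth_map_chart_differentiable[OF s(2) ce(1) d]
         chart_differentiable_ln[OF a(2,3) d], of v] by (simp add: comp_def)
    moreover have "chart_deriv c (\<lambda>z. ln ((a \<circ> h) z * b z)) x v =
        chart_deriv c (\<lambda>z. ln ((a \<circ> h) z)) x v + chart_deriv c (\<lambda>z. ln (b z)) x v"
      using chart_deriv_add[OF ce(1) chart_differentiable_ln[OF sm pos ce(1)] chart_differentiable_ln[OF b(2,3) ce(1)]]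
      by (simp add: ln_mult_pos a(3) b(3))
    ultimately show "\<omega> e ((g \<circ> h) x) (chart_deriv c (snd e \<circ> (g \<circ> h)) x v)
        = \<omega> c x v + chart_deriv c (\<lambda>z. ln ((a \<circ> h) z * b z)) x v"
      unfolding T comp_apply[of g h x] a1[OF d ce(2)] b1[OF ce(1) d] by simp
  qed
qed

text \<open>The conformal factor of the inverse of \<open>g\<close> is \<open>1 / (a \<circ> g\<^sup>-\<^sup>1)\<close>.\<close>

lemma Diff_Omega_inv:
  assumes g: "g \<in> Diff_Omega A \<Omega> \<omega>"
  shows "(inv_into UNIV g) \<in> Diff_Omega A \<Omega> \<omega>"
proof -
  obtain a where fa: "conformal_factor g a" by (rule Diff_Omega_factor[OF g])
  note a = factor_diffeo[OF fa] factor_smooth[OF fa] factor_pos[OF fa] and a2 = factor_form[OF fa] and a1 = factor_lee[OF fa]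
  have b: "bij g" and s: "smooth_map A g" "smooth_map A (inv_into UNIV g)" using a(1) by (simp_all add: diffeo_def)
  have inv: "diffeo A (inv_into UNIV g)" using a(1) b by (simp add: diffeo_def inv_inv_eq bij_imp_bij_inv)
  have sm: "a \<circ> inv_into UNIV g \<in> smooth_functions A" by (rule smooth_function_compose[OF a(2) s(2)])
  have pos: "(a \<circ> inv_into UNIV g) x > 0" for x using a(3) by simp
  have gi: "g ((inv_into UNIV g) x) = x" for x using b by (simp add: bij_is_surj surj_f_inv_f)
  show ?thesis
  proof (rule Diff_OmegaI[OF inv smooth_function_inverse[OF sm]])
    show "(a \<circ> inv_into UNIV g) x \<noteq> 0" for x using pos[of x] by linarith
    show "inverse ((a \<circ> inv_into UNIV g) x) > 0" for x using pos[of x] by simp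
    fix c d :: "('m, 'e) chart" and x v w assume c: "c \<in> charts_at A x" and d: "d \<in> charts_at A ((inv_into UNIV g) x)"
    have c': "c \<in> charts_at A (g ((inv_into UNIV g) x))" using c by (simp add: gi)
    have T: "chart_deriv d (snd c \<circ> g) ((inv_into UNIV g) x) (chart_deriv c (snd d \<circ> inv_into UNIV g) x v) = v" for v
      using tangent_map_inverse[OF a(1) d c', of v] by (simp add: gi)
    have pos': "a ((inv_into UNIV g) x) \<noteq> 0" using a(3)[of "(inv_into UNIV g) x"] by simp
    from a2[OF d c', of "chart_deriv c (snd d \<circ> inv_into UNIV g) x v" "chart_deriv c (snd d \<circ> inv_into UNIV g) x w"]
    have "\<Omega> c x v w = inverse (a ((inv_into UNIV g) x)) * \<Omega> d ((inv_into UNIV g) x) (chart_deriv c (snd d \<circ> inv_into UNIV g) x v) (chart_deriv c (snd d \<circ> inv_into UNIV g) x w)"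
      unfolding T gi .
    then show "\<Omega> d ((inv_into UNIV g) x) (chart_deriv c (snd d \<circ> inv_into UNIV g) x v) (chart_deriv c (snd d \<circ> inv_into UNIV g) x w)
      = inverse (inverse ((a \<circ> inv_into UNIV g) x)) * \<Omega> c x v w" using pos' by (simp add: field_simps)
    have 1: "chart_deriv d (\<lambda>z. ln (a z)) ((inv_into UNIV g) x) (chart_deriv c (snd d \<circ> inv_into UNIV g) x v) = chart_deriv c (\<lambda>z. ln ((a \<circ> inv_into UNIV g) z)) x v"
      using chart_deriv_compose(2)[OF c d smooth_mapD[OF s(2)] smooth_map_chart_differentiable[OF s(2) c d]
         chart_differentiable_ln[OF a(2,3) d], of v] by (simp add: comp_def)
    have "chart_deriv c (\<lambda>z. 0 - ln ((a \<circ> inv_into UNIV g) z)) x v = 0 - chart_deriv c (\<lambda>z. ln ((a \<circ> inv_into UNIV g) z)) x v"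
      using chart_deriv_diff[OF c _ chart_differentiable_ln[OF sm pos c], of "\<lambda>_. 0" v]
        smooth_function_chart_differentiable[OF smooth_function_const c] by (simp add: chart_deriv_const)
    moreover have "(\<lambda>z. ln (inverse ((a \<circ> inv_into UNIV g) z))) = (\<lambda>z. 0 - ln ((a \<circ> inv_into UNIV g) z))"
      using pos by (intro ext) (simp add: ln_inverse)
    ultimately have 2: "chart_deriv c (\<lambda>z. ln (inverse ((a \<circ> inv_into UNIV g) z))) x v = - chart_deriv c (\<lambda>z. ln ((a \<circ> inv_into UNIV g) z)) x v"
      by simp
    from a1[OF d c', of "chart_deriv c (snd d \<circ> inv_into UNIV g) x v"]
    show "\<omega> d ((inv_into UNIV g) x) (chart_deriv c (snd d \<circ> inv_into UNIV g) x v) = \<omega> c x v + chart_deriv c (\<lambda>z. ln (inverse ((a \<circ> inv_into UNIV g) z))) x v"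
      unfolding T gi 1 2 by simp
  qed
qed

text \<open>The field \<open>Y\<close> is the push-forward of \<open>X\<close> by \<open>g\<close>.\<close>

definition related :: "('m \<Rightarrow> 'm) \<Rightarrow> ('m, 'e) vfield \<Rightarrow> ('m, 'e) vfield \<Rightarrow> bool" where
  "related g X Y \<longleftrightarrow> (\<forall>q. \<forall>d\<in>charts_at A q. \<forall>c\<in>charts_at A (g q). Y c (g q) = chart_deriv d (snd c \<circ> g) q (X d q))"

text \<open>If \<open>g\<^sup>*\<Omega> = a\<^sup>-\<^sup>1\<Omega>\<close>, then the pullback of \<open>i\<^sub>Y \<Omega>\<close> is \<open>a\<^sup>-\<^sup>1 i\<^sub>X \<Omega>\<close>, and that of \<open>\<omega>\<close> is \<open>\<omega> + d (ln a)\<close>. The derivative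
  of the factor \<open>a\<^sup>-\<^sup>1\<close> cancels exactly against the term \<open>d (ln a)\<close>, so that the twisted differential is preserved
  up to the factor \<open>a\<^sup>-\<^sup>1\<close>.\<close>

lemma related_dw1:
  assumes g: "g \<in> Diff_Omega A \<Omega> \<omega>" and X: "X \<in> vector_fields A" and Y: "Y \<in> vector_fields A"
    and r: "related g X Y"
  obtains a where "\<And>x. a x > 0"
    "\<And>c d q v w. d \<in> charts_at A q \<Longrightarrow> c \<in> charts_at A (g q) \<Longrightarrow>
     dw1 A \<omega> (contract2 \<Omega> Y) c (g q) (chart_deriv d (snd c \<circ> g) q v) (chart_deriv d (snd c \<circ> g) q w) =
     a q * dw1 A \<omega> (contract2 \<Omega> X) d q v w"
proof -
  obtain a where fa: "conformal_factor g a" by (rule Diff_Omega_factor[OF g])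
  note a = factor_diffeo[OF fa] factor_smooth[OF fa] factor_pos[OF fa] and a2 = factor_form[OF fa] and a1 = factor_lee[OF fa]
  have s: "smooth_map A g" using a(1) by (simp add: diffeo_def)
  have nz: "a x \<noteq> 0" for x using a(3)[of x] by simp
  have sm: "(\<lambda>x. inverse (a x)) \<in> smooth_functions A" by (rule smooth_function_inverse[OF a(2) nz])
  note \<alpha> = contract2_one_form[OF X] and \<alpha>' = contract2_one_form[OF Y]
  define \<beta> where "\<beta> = (\<lambda>c x v. inverse (a x) * contract2 \<Omega> X c x v)"
  have \<beta>_pull: "\<beta> d z w = contract2 \<Omega> Y c (g z) (chart_deriv d (snd c \<circ> g) z w)"
    if "d \<in> charts_at A z" "c \<in> charts_at A (g z)" for c d z w
    using r that a2[OF that, of "X d z" w] by (simp add: related_def \<beta>_def contract2_def)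
  show ?thesis
  proof (rule that[of "\<lambda>x. inverse (a x)"])
    show "inverse (a x) > 0" for x using a(3)[of x] by simp
    fix c d :: "('m, 'e) chart" and q v w assume d: "d \<in> charts_at A q" and c: "c \<in> charts_at A (g q)"
    let ?T = "chart_deriv d (snd c \<circ> g) q"
    have "d1 A \<beta> d q v w = d1 A (contract2 \<Omega> Y) c (g q) (?T v) (?T w)"
      using charts_atD[OF d] charts_atD[OF c]
      by (intro d1_pullback[OF s d c \<alpha>'] \<beta>_pull) (simp_all add: charts_at_def)
    moreover have "dw1 A \<omega> \<beta> d q v w = wedge11 (d0 A (\<lambda>x. inverse (a x))) (contract2 \<Omega> X) d q v w
        + inverse (a q) * dw1 A \<omega> (contract2 \<Omega> X) d q v w"
      unfolding \<beta>_def by (rule dw1_mult[OF sm \<alpha>])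
    moreover have "contract2 \<Omega> Y c (g q) (?T u) = inverse (a q) * contract2 \<Omega> X d q u" for u
      using \<beta>_pull[OF d c, of u] by (simp add: \<beta>_def)
    moreover have "\<omega> c (g q) (?T u) = \<omega> d q u + inverse (a q) * chart_deriv d a q u" for u
      using a1[OF d c] chart_deriv_ln[OF a(2,3) d] by simp
    moreover have "d0 A (\<lambda>x. inverse (a x)) d q u = - (inverse (a q) * inverse (a q) * chart_deriv d a q u)" for u
      using chart_deriv_inv[OF a(2,3) d] d by (simp add: d0_def)
    ultimately show "dw1 A \<omega> (contract2 \<Omega> Y) c (g q) (?T v) (?T w) = inverse (a q) * dw1 A \<omega> (contract2 \<Omega> X) d q v w"
      by (simp add: dw1_def wedge11_def \<beta>_def algebra_simps)
  qed
qed

text \<open>Since tangent maps of diffeomorphisms are bijective, the previous lemma transports closedness in both directions.\<close>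

lemma related_kerPhi:
  assumes g: "g \<in> Diff_Omega A \<Omega> \<omega>" and X: "X \<in> vector_fields A" and Y: "Y \<in> vector_fields A"
    and r: "related g X Y"
  shows "X \<in> kerPhi A \<Omega> \<omega> \<longleftrightarrow> Y \<in> kerPhi A \<Omega> \<omega>"
proof -
  obtain a where a: "\<And>x. a x > 0" and dw: "\<And>c d q v w. d \<in> charts_at A q \<Longrightarrow> c \<in> charts_at A (g q) \<Longrightarrow>
     dw1 A \<omega> (contract2 \<Omega> Y) c (g q) (chart_deriv d (snd c \<circ> g) q v) (chart_deriv d (snd c \<circ> g) q w) =
     a q * dw1 A \<omega> (contract2 \<Omega> X) d q v w"
    by (rule related_dw1[OF assms]) metis
  have dif: "diffeo A g" using g by (rule Diff_Omega_diffeo)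
  have gi: "g ((inv_into UNIV g) x) = x" for x using dif by (simp add: diffeo_def bij_is_surj surj_f_inv_f)
  show ?thesis
  proof
    assume k: "X \<in> kerPhi A \<Omega> \<omega>"
    have "dw1 A \<omega> (contract2 \<Omega> Y) c x v w = 0" for c x v w
    proof (cases "c \<in> charts_at A x")
      case True
      then have c: "c \<in> charts_at A (g ((inv_into UNIV g) x))" by (simp add: gi)
      note d = chart_at_in[of "(inv_into UNIV g) x"]
      have "dw1 A \<omega> (contract2 \<Omega> X) (chart_at A ((inv_into UNIV g) x)) ((inv_into UNIV g) x) v w = 0" for v w
        using k unfolding kerPhi_iff by blast
      then show ?thesis
        using dw[OF d c, of "chart_deriv c (snd (chart_at A ((inv_into UNIV g) x)) \<circ> inv_into UNIV g) (g ((inv_into UNIV g) x)) v"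
          "chart_deriv c (snd (chart_at A ((inv_into UNIV g) x)) \<circ> inv_into UNIV g) (g ((inv_into UNIV g) x)) w"]
        unfolding tangent_map_inverse[OF dif d c] by (simp add: gi)
    qed (rule dw1_outside)
    then show "Y \<in> kerPhi A \<Omega> \<omega>" unfolding kerPhi_iff using Y by blast
  next
    assume k: "Y \<in> kerPhi A \<Omega> \<omega>"
    have "dw1 A \<omega> (contract2 \<Omega> X) d q v w = 0" for d q v w
    proof (cases "d \<in> charts_at A q")
      case True
      have "dw1 A \<omega> (contract2 \<Omega> Y) (chart_at A (g q)) (g q) v w = 0" for v w
        using k unfolding kerPhi_iff by blast
      then have "a q * dw1 A \<omega> (contract2 \<Omega> X) d q v w = 0" using dw[OF True chart_at_in, of v w] by simp
      then show ?thesis using a[of q] by simp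
    qed (rule dw1_outside)
    then show "X \<in> kerPhi A \<Omega> \<omega>" unfolding kerPhi_iff using X by blast
  qed
qed

end

context atlas begin

section \<open>Smooth families of maps\<close>

lemma
  assumes "smooth_family A S G"
  shows smooth_family_continuous: "continuous_on (S \<times> UNIV) (\<lambda>(p, x). G p x)"
    and smooth_family_chart: "c \<in> A \<Longrightarrow> d \<in> A \<Longrightarrow>
      smooth_on {(p, y). p \<in> S \<and> y \<in> snd c ` fst c \<and> G p (chart_inv c y) \<in> fst d} (\<lambda>(p, y). snd d (G p (chart_inv c y)))"
  using assms unfolding smooth_family_def by blast+

lemma smooth_family_continuous_compose:
  assumes G: "smooth_family A S G" and f: "continuous_on T f" and k: "continuous_on T k" and "\<And>z. z \<in> T \<Longrightarrow> f z \<in> S"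
  shows "continuous_on T (\<lambda>z. G (f z) (k z))"
proof -
  have "continuous_on T (\<lambda>z. (f z, k z))" by (intro continuous_intros f k)
  then have "continuous_on T (\<lambda>z. (\<lambda>(p, x). G p x) (f z, k z))"
    by (rule continuous_on_compose2[OF smooth_family_continuous[OF G]]) (use assms(4) in auto)
  then show ?thesis by simp
qed

lemma smooth_family_chart_compose:
  fixes f :: "'q::euclidean_space \<Rightarrow> 'p::euclidean_space"
  assumes G: "smooth_family A S G" and cd: "c \<in> A" "d \<in> A" and f: "smooth_on T f" and k: "smooth_on T k"
    and "\<And>z. z \<in> T \<Longrightarrow> f z \<in> S \<and> k z \<in> snd c ` fst c \<and> G (f z) (chart_inv c (k z)) \<in> fst d"
  shows "smooth_on T (\<lambda>z. snd d (G (f z) (chart_inv c (k z))))"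
proof -
  have "smooth_on T (\<lambda>z. (\<lambda>(p, y). snd d (G p (chart_inv c y))) (f z, k z))"
    by (rule smooth_on_compose[OF smooth_family_chart[OF G cd] smooth_on_Pair[OF f k]]) (use assms(6) in auto)
  then show ?thesis by simp
qed

lemma smooth_family_cong:
  assumes G: "smooth_family A S G" and eq: "\<And>p. p \<in> S \<Longrightarrow> G p = H p"
  shows "smooth_family A S H"
  unfolding smooth_family_def
proof (intro conjI ballI)
  show "continuous_on (S \<times> UNIV) (\<lambda>(p, x). H p x)"
    using smooth_family_continuous[OF G] by (rule continuous_on_cong[THEN iffD1, rotated 2]) (auto simp: eq)
  fix c d assume cd: "c \<in> A" "d \<in> A"
  have D: "{(p, y). p \<in> S \<and> y \<in> snd c ` fst c \<and> H p (chart_inv c y) \<in> fst d} =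
    {(p, y). p \<in> S \<and> y \<in> snd c ` fst c \<and> G p (chart_inv c y) \<in> fst d}" using eq by auto
  show "smooth_on {(p, y). p \<in> S \<and> y \<in> snd c ` fst c \<and> H p (chart_inv c y) \<in> fst d} (\<lambda>(p, y). snd d (H p (chart_inv c y)))"
    unfolding D by (rule smooth_on_cong[OF smooth_family_chart[OF G cd]]) (auto simp: eq)
qed

lemma smooth_family_neighbourhood:
  assumes G: "smooth_family A S G" and c: "c \<in> A" and W: "open W"
    and p: "p \<in> S" "y \<in> snd c ` fst c" "G p (chart_inv c y) \<in> W"
  obtains N where "open N" "(p, y) \<in> N"
    "\<And>p' y'. (p', y') \<in> N \<Longrightarrow> p' \<in> S \<Longrightarrow> y' \<in> snd c ` fst c \<Longrightarrow> G p' (chart_inv c y') \<in> W"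
proof -
  have cont: "continuous_on (S \<times> snd c ` fst c) (\<lambda>z. G (fst z) (chart_inv c (snd z)))"
    by (intro smooth_family_continuous_compose[OF G] continuous_intros
        continuous_on_compose2[OF continuous_chart_inv[OF c], of _ snd]) auto
  have "(p, y) \<in> S \<times> snd c ` fst c" using p by blast
  then obtain N where "open N" "(p, y) \<in> N" "\<forall>z\<in>S \<times> snd c ` fst c. z \<in> N \<longrightarrow> G (fst z) (chart_inv c (snd z)) \<in> W"
    using cont[unfolded continuous_on_topological, rule_format, of "(p, y)" W] W p(3) by auto
  then show ?thesis by (intro that[of N]) fastforce+
qed

lemma smooth_family_compose:
  assumes G: "smooth_family A S G" and H: "smooth_family A S H"
  shows "smooth_family A S (\<lambda>p. G p \<circ> H p)"
  unfolding smooth_family_def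
proof (intro conjI ballI)
  have "continuous_on (S \<times> UNIV) (\<lambda>z. G (fst z) (H (fst z) (snd z)))"
    by (rule smooth_family_continuous_compose[OF G _ smooth_family_continuous_compose[OF H]])
       (auto intro: continuous_intros)
  then show "continuous_on (S \<times> UNIV) (\<lambda>(p, x). (G p \<circ> H p) x)" by (simp add: case_prod_unfold)
  fix c e assume c: "c \<in> A" and e: "e \<in> A"
  let ?D = "{(p, y). p \<in> S \<and> y \<in> snd c ` fst c \<and> (G p \<circ> H p) (chart_inv c y) \<in> fst e}"
  show "smooth_on ?D (\<lambda>(p, y). snd e ((G p \<circ> H p) (chart_inv c y)))"
  proof (rule smooth_onI_local)
    fix z assume z: "z \<in> ?D"
    define d where "d = chart_at A (H (fst z) (chart_inv c (snd z)))"
    have d: "d \<in> A" "H (fst z) (chart_inv c (snd z)) \<in> fst d"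
      using chart_at_in[of "H (fst z) (chart_inv c (snd z))"] by (simp_all add: d_def charts_at_def)
    from z have "fst z \<in> S" "snd z \<in> snd c ` fst c" by auto
    from smooth_family_neighbourhood[OF H c open_chart[OF d(1)] this d(2)]
    obtain N where N: "open N" "z \<in> N"
      "\<And>p' y'. (p', y') \<in> N \<Longrightarrow> p' \<in> S \<Longrightarrow> y' \<in> snd c ` fst c \<Longrightarrow> H p' (chart_inv c y') \<in> fst d" by auto
    have 1: "smooth_on (?D \<inter> N) (\<lambda>(p, y). snd d (H p (chart_inv c y)))"
      by (rule smooth_on_subset[OF smooth_family_chart[OF H c d(1)]]) (use N(3) in auto)
    have "smooth_on (?D \<inter> N) (\<lambda>z. snd e (G (fst z) (chart_inv d ((\<lambda>(p, y). snd d (H p (chart_inv c y))) z))))"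
      by (rule smooth_family_chart_compose[OF G d(1) e smooth_on_fst[OF smooth_on_ident] 1])
         (use N(3) chart_inv_chart[OF d(1)] in auto)
    then have "smooth_on (?D \<inter> N) (\<lambda>(p, y). snd e ((G p \<circ> H p) (chart_inv c y)))"
      by (rule smooth_on_cong) (use N(3) chart_inv_chart[OF d(1)] in auto)
    then show "\<exists>U. open U \<and> z \<in> U \<and> smooth_on (?D \<inter> U) (\<lambda>(p, y). snd e ((G p \<circ> H p) (chart_inv c y)))"
      using N by blast
  qed
qed

lemma smooth_family_reparametrize:
  fixes \<sigma> :: "'q::euclidean_space \<Rightarrow> 'p::euclidean_space"
  assumes G: "smooth_family A S G" and \<sigma>: "smooth_on T \<sigma>" "\<sigma> ` T \<subseteq> S"
  shows "smooth_family A T (\<lambda>p. G (\<sigma> p))"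
  unfolding smooth_family_def
proof (intro conjI ballI)
  have "continuous_on (T \<times> UNIV) (\<lambda>z. \<sigma> (fst z))"
    by (rule continuous_on_compose2[OF smooth_on_continuous[OF \<sigma>(1)]]) (auto intro: continuous_intros)
  then have "continuous_on (T \<times> UNIV) (\<lambda>z. G (\<sigma> (fst z)) (snd z))"
    by (rule smooth_family_continuous_compose[OF G]) (use \<sigma>(2) in \<open>auto intro: continuous_intros\<close>)
  then show "continuous_on (T \<times> UNIV) (\<lambda>(p, x). G (\<sigma> p) x)" by (simp add: case_prod_unfold)
  fix c d assume cd: "c \<in> A" "d \<in> A"
  let ?D = "{(p, y). p \<in> T \<and> y \<in> snd c ` fst c \<and> G (\<sigma> p) (chart_inv c y) \<in> fst d}"
  have "smooth_on ?D (\<lambda>z. \<sigma> (fst z))"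
    by (rule smooth_on_compose[OF \<sigma>(1) smooth_on_fst[OF smooth_on_ident]]) auto
  then have "smooth_on ?D (\<lambda>z. snd d (G (\<sigma> (fst z)) (chart_inv c (snd z))))"
    by (rule smooth_family_chart_compose[OF G cd _ smooth_on_snd[OF smooth_on_ident]]) (use \<sigma>(2) in auto)
  then show "smooth_on ?D (\<lambda>(p, y). snd d (G (\<sigma> p) (chart_inv c y)))" by (simp add: case_prod_unfold)
qed

lemma smooth_family_slice:
  assumes G: "smooth_family A S G" and p: "p \<in> S"
  shows "smooth_map A (G p)"
  unfolding smooth_map_def
proof (intro conjI ballI)
  show "continuous_on UNIV (G p)"
    using smooth_family_continuous_compose[OF G continuous_on_const[of UNIV p] continuous_on_id] p by simp
  fix c d assume cd: "c \<in> A" "d \<in> A"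
  have "smooth_on (snd c ` (fst c \<inter> G p -` fst d)) (\<lambda>y. snd d (G p (chart_inv c y)))"
    by (rule smooth_family_chart_compose[OF G cd smooth_on_const smooth_on_ident])
       (use p chart_inv_chart[OF cd(1)] in auto)
  then show "smooth_on (snd c ` (fst c \<inter> G p -` fst d)) (snd d \<circ> G p \<circ> chart_inv c)" by (simp add: comp_def)
qed

lemma smooth_family_constant:
  assumes g: "smooth_map A g"
  shows "smooth_family A S (\<lambda>p. g)"
  unfolding smooth_family_def
proof (intro conjI ballI)
  have "continuous_on (S \<times> UNIV) (\<lambda>z. g (snd z))"
    by (rule continuous_on_compose2[OF smooth_mapD[OF g]]) (auto intro: continuous_intros)
  then show "continuous_on (S \<times> UNIV) (\<lambda>(p, x). g x)" by (simp add: case_prod_unfold)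
  fix c d assume cd: "c \<in> A" "d \<in> A"
  let ?D = "{(p, y). p \<in> S \<and> y \<in> snd c ` fst c \<and> g (chart_inv c y) \<in> fst d}"
  have "smooth_on (snd c ` (fst c \<inter> g -` fst d)) (snd d \<circ> g \<circ> chart_inv c)" using g cd by (simp add: smooth_map_def)
  then have "smooth_on ?D (\<lambda>z. (snd d \<circ> g \<circ> chart_inv c) (snd z))"
    by (rule smooth_on_compose[OF _ smooth_on_snd[OF smooth_on_ident]]) (auto simp: chart_image_Int[OF cd(1)])
  then show "smooth_on ?D (\<lambda>(p, y). snd d (g (chart_inv c y)))" by (simp add: case_prod_unfold comp_def)
qed

lemma
  assumes "diffeo_family A S G"
  shows diffeo_family_bij: "p \<in> S \<Longrightarrow> bij (G p)" and diffeo_family_smooth: "smooth_family A S G"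
    and diffeo_family_smooth_inv: "smooth_family A S (\<lambda>p. inv_into UNIV (G p))"
  using assms by (auto simp: diffeo_family_def)

lemma diffeo_family_diffeo: "diffeo_family A S G \<Longrightarrow> p \<in> S \<Longrightarrow> diffeo A (G p)"
  unfolding diffeo_def
  by (auto dest: diffeo_family_bij smooth_family_slice[OF diffeo_family_smooth] smooth_family_slice[OF diffeo_family_smooth_inv])

lemma diffeo_family_compose:
  assumes "diffeo_family A S G" "diffeo_family A S H"
  shows "diffeo_family A S (\<lambda>p. G p \<circ> H p)"
  unfolding diffeo_family_def
proof (intro conjI ballI)
  show "bij (G p \<circ> H p)" if "p \<in> S" for p
    using bij_comp[OF diffeo_family_bij[OF assms(2) that] diffeo_family_bij[OF assms(1) that]] .
  show "smooth_family A S (\<lambda>p. G p \<circ> H p)" by (intro smooth_family_compose diffeo_family_smooth assms)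
  show "smooth_family A S (\<lambda>p. inv_into UNIV (G p \<circ> H p))"
    by (rule smooth_family_cong[OF smooth_family_compose[OF diffeo_family_smooth_inv[OF assms(2)] diffeo_family_smooth_inv[OF assms(1)]]])
       (simp add: o_inv_distrib diffeo_family_bij[OF assms(1)] diffeo_family_bij[OF assms(2)])
qed

lemma diffeo_family_reparametrize:
  fixes \<sigma> :: "'q::euclidean_space \<Rightarrow> 'p::euclidean_space"
  assumes "diffeo_family A S G" "smooth_on T \<sigma>" "\<sigma> ` T \<subseteq> S"
  shows "diffeo_family A T (\<lambda>p. G (\<sigma> p))"
  unfolding diffeo_family_def
proof (intro conjI ballI)
  show "bij (G (\<sigma> p))" if "p \<in> T" for p using diffeo_family_bij[OF assms(1)] assms(3) that by blast
  show "smooth_family A T (\<lambda>p. G (\<sigma> p))"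
    by (rule smooth_family_reparametrize[OF diffeo_family_smooth[OF assms(1)] assms(2,3)])
  show "smooth_family A T (\<lambda>p. inv_into UNIV (G (\<sigma> p)))"
    by (rule smooth_family_reparametrize[OF diffeo_family_smooth_inv[OF assms(1)] assms(2,3)])
qed

lemma diffeo_family_inverse:
  assumes "diffeo_family A S G"
  shows "diffeo_family A S (\<lambda>p. inv_into UNIV (G p))"
  unfolding diffeo_family_def
proof (intro conjI ballI)
  show "bij (inv_into UNIV (G p))" if "p \<in> S" for p using diffeo_family_bij[OF assms that] by (rule bij_imp_bij_inv)
  show "smooth_family A S (\<lambda>p. inv_into UNIV (G p))" by (rule diffeo_family_smooth_inv[OF assms])
  show "smooth_family A S (\<lambda>p. inv_into UNIV (inv_into UNIV (G p)))"
    by (rule smooth_family_cong[OF diffeo_family_smooth[OF assms]]) (simp add: inv_inv_eq diffeo_family_bij[OF assms])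
qed

lemma diffeo_family_constant:
  assumes "diffeo A g"
  shows "diffeo_family A S (\<lambda>p. g)"
  using assms smooth_family_constant[of g S] smooth_family_constant[of "inv_into UNIV g" S]
  by (simp add: diffeo_family_def diffeo_def)

section \<open>Velocity fields\<close>

lemma velocity_constant: "t \<in> {0..1} \<Longrightarrow> velocity A (\<lambda>r. g) t = (\<lambda>c x. 0)"
  using vector_derivative_within_closed_interval[OF zero_less_one, of t "\<lambda>r. k" 0 for k :: 'e]
  by (intro ext) (simp add: velocity_def)

lemma velocity_right_translate:
  assumes "bij (g t)" "bij h"
  shows "velocity A (\<lambda>r. g r \<circ> h) t = velocity A g t"
proof (intro ext)
  fix c x
  have "(g s \<circ> h) (inv_into UNIV (g t \<circ> h) x) = g s (inv_into UNIV (g t) x)" for s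
    using assms by (simp add: o_inv_distrib bij_is_surj surj_f_inv_f)
  then show "velocity A (\<lambda>r. g r \<circ> h) t c x = velocity A g t c x" by (simp add: velocity_def)
qed

lemma velocity_eqI:
  assumes "bij (g t)" "c \<in> charts_at A (g t q)" "t \<in> {0..1}"
    and "((\<lambda>s. snd c (g s q)) has_vector_derivative D) (at t within {0..1})"
  shows "velocity A g t c (g t q) = D"
  using assms vector_derivative_within_closed_interval[OF _ assms(3,4)]
  by (simp add: velocity_def bij_is_inj)

text \<open>The velocity of a family along a line of parameters, read in charts, is a directional derivative
  of any smooth extension of the coordinate expression of the family.\<close>

lemma line_has_vector_derivative:
  fixes e :: "'p::euclidean_space" and h :: "'p \<times> 'e \<Rightarrow> 'e"
  assumes G: "smooth_family A S G" and p: "p \<in> S" and t: "t \<in> {0..1}"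
    and line: "\<And>r. r \<in> {0..1} \<Longrightarrow> p + (r - t) *\<^sub>R e \<in> S"
    and c: "c \<in> charts_at A (G p q)" and d: "d \<in> charts_at A q"
    and U: "open U" "(p, snd d q) \<in> U" and h: "Ck_on (Suc 0) U h"
    and ext: "\<And>p y. (p, y) \<in> U \<Longrightarrow> p \<in> S \<Longrightarrow> y \<in> snd d ` fst d \<Longrightarrow> G p (chart_inv d y) \<in> fst c \<Longrightarrow>
       snd c (G p (chart_inv d y)) = h (p, y)"
  shows "((\<lambda>r. snd c (G (p + (r - t) *\<^sub>R e) q)) has_vector_derivative
    frechet_derivative h (at (p, snd d q)) (e, 0)) (at t within {0..1})"
proof -
  let ?L = "\<lambda>r. p + (r - t) *\<^sub>R e"
  note dA = charts_atD[OF d] and cA = charts_atD[OF c]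
  have q: "chart_inv d (snd d q) = q" by (rule chart_inv_chart[OF dA])
  have cv: "((\<lambda>r. (?L r, snd d q)) has_vector_derivative (e, 0)) (at t within {0..1})"
    unfolding has_vector_derivative_def by (auto intro!: derivative_eq_intros simp: zero_prod_def)
  have hd: "(h has_derivative frechet_derivative h (at (p, snd d q)))
     (at (?L t, snd d q) within (\<lambda>r. (?L r, snd d q)) ` {0..1})"
    using Ck_on_has_derivative[OF h U(2)] by (simp add: has_derivative_at_withinI)
  have der: "((\<lambda>r. h (?L r, snd d q)) has_vector_derivative frechet_derivative h (at (p, snd d q)) (e, 0)) (at t within {0..1})"
    using vector_derivative_diff_chain_within[OF cv hd] by (simp add: comp_def)
  have "((\<lambda>r. (?L r, snd d q)) \<longlongrightarrow> (?L t, snd d q)) (at t within {0..1})"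
    by (intro tendsto_intros)
  then have 1: "\<forall>\<^sub>F r in at t within {0..1}. (?L r, snd d q) \<in> U"
    by (rule topological_tendstoD) (use U in auto)
  have "continuous_on {0..1} (\<lambda>r. G (?L r) q)"
    by (rule smooth_family_continuous_compose[OF G _ continuous_on_const line]) (auto intro!: continuous_intros)
  then have "((\<lambda>r. G (?L r) q) \<longlongrightarrow> G (?L t) q) (at t within {0..1})"
    using t unfolding continuous_on by blast
  then have 2: "\<forall>\<^sub>F r in at t within {0..1}. G (?L r) q \<in> fst c"
    by (rule topological_tendstoD) (use open_chart[OF cA(1)] cA(2) in auto)
  have 3: "\<forall>\<^sub>F r in at t within {0..1}. r \<in> {0..1}" by (simp add: eventually_at_filter)
  have ev: "\<forall>\<^sub>F r in at t within {0..1}. h (?L r, snd d q) = snd c (G (?L r) q)"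
    using 1 2 3
  proof eventually_elim
    case (elim r)
    have "snd c (G (?L r) (chart_inv d (snd d q))) = h (?L r, snd d q)"
      by (rule ext[OF elim(1) line[OF elim(3)]]) (use elim(2) dA in \<open>auto simp: q\<close>)
    then show ?case by (simp add: q)
  qed
  have "h (?L t, snd d q) = snd c (G (?L t) q)"
    using ext[of p "snd d q"] U(2) p dA cA by (simp add: q)
  then show ?thesis
    by (rule has_derivative_transform_eventually[OF der[unfolded has_vector_derivative_def] ev _ t,
          folded has_vector_derivative_def])
qed

lemma smooth_family_extension:
  assumes G: "smooth_family A S G" and p: "p \<in> S"
    and c: "c \<in> charts_at A (G p q)" and d: "d \<in> charts_at A q"
  obtains U h where "open U" "(p, snd d q) \<in> U" "\<And>k. Ck_on k U h"
    "\<And>p y. (p, y) \<in> U \<Longrightarrow> p \<in> S \<Longrightarrow> y \<in> snd d ` fst d \<Longrightarrow> G p (chart_inv d y) \<in> fst c \<Longrightarrow>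
       snd c (G p (chart_inv d y)) = h (p, y)"
proof -
  note dA = charts_atD[OF d] and cA = charts_atD[OF c]
  have "(p, snd d q) \<in> {(p, y). p \<in> S \<and> y \<in> snd d ` fst d \<and> G p (chart_inv d y) \<in> fst c}"
    using p dA cA chart_inv_chart[OF dA] by auto
  then obtain U h where U: "open U" "(p, snd d q) \<in> U" "\<forall>k. Ck_on k U h"
    and eq: "\<forall>z\<in>{(p, y). p \<in> S \<and> y \<in> snd d ` fst d \<and> G p (chart_inv d y) \<in> fst c} \<inter> U.
       (case z of (p, y) \<Rightarrow> snd c (G p (chart_inv d y))) = h z"
    by (rule smooth_onE[OF smooth_family_chart[OF G dA(1) cA(1)]])
  show ?thesis
  proof (rule that[OF U(1,2)])
    show "Ck_on k U h" for k using U(3) by blast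
    show "snd c (G p (chart_inv d y)) = h (p, y)"
      if "(p, y) \<in> U" "p \<in> S" "y \<in> snd d ` fst d" "G p (chart_inv d y) \<in> fst c" for p y
      using bspec[OF eq, of "(p, y)"] that by simp
  qed
qed

end

text \<open>A family of diffeomorphisms over a set of parameters that contains, with each point \<open>p\<close>, the unit segment
  through \<open>p\<close> in a fixed direction \<open>e\<close>; the position of \<open>p\<close> on that segment is \<open>\<rho> p\<close>. It is used for the unit interval and for both directions in the unit square.\<close>

locale line_family = atlas A
  for A :: "('m::{t2_space,second_countable_topology}, 'e::euclidean_space) chart set" +
  fixes S :: "'p::euclidean_space set" and G :: "'p \<Rightarrow> 'm \<Rightarrow> 'm" and \<rho> :: "'p \<Rightarrow> real" and e :: 'p
  assumes family: "diffeo_family A S G"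
    and time: "\<And>p. p \<in> S \<Longrightarrow> \<rho> p \<in> {0..1}"
    and line: "\<And>p r. p \<in> S \<Longrightarrow> r \<in> {0..1} \<Longrightarrow> p + (r - \<rho> p) *\<^sub>R e \<in> S"
begin

definition "V p = velocity A (\<lambda>r. G (p + (r - \<rho> p) *\<^sub>R e)) (\<rho> p)"

lemma V_eqI:
  assumes "p \<in> S" "c \<in> charts_at A (G p q)"
    and "((\<lambda>r. snd c (G (p + (r - \<rho> p) *\<^sub>R e) q)) has_vector_derivative D) (at (\<rho> p) within {0..1})"
  shows "V p c (G p q) = D"
  using velocity_eqI[of "\<lambda>r. G (p + (r - \<rho> p) *\<^sub>R e)" "\<rho> p" c q D] assms diffeo_family_bij[OF family assms(1)] time[OF assms(1)]
  by (simp add: V_def)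

lemma V_has_vector_derivative:
  assumes p: "p \<in> S" and c: "c \<in> charts_at A (G p q)"
  shows "((\<lambda>r. snd c (G (p + (r - \<rho> p) *\<^sub>R e) q)) has_vector_derivative V p c (G p q)) (at (\<rho> p) within {0..1})"
proof -
  obtain U h where U: "open U" "(p, snd (chart_at A q) q) \<in> U" "\<And>k. Ck_on k U h"
    "\<And>p y. (p, y) \<in> U \<Longrightarrow> p \<in> S \<Longrightarrow> y \<in> snd (chart_at A q) ` fst (chart_at A q) \<Longrightarrow>
       G p (chart_inv (chart_at A q) y) \<in> fst c \<Longrightarrow> snd c (G p (chart_inv (chart_at A q) y)) = h (p, y)"
    by (rule smooth_family_extension[OF diffeo_family_smooth[OF family] p c chart_at_in]) metis
  from line_has_vector_derivative[OF diffeo_family_smooth[OF family] p time[OF p] line[OF p] c chart_at_in U]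
  show ?thesis using V_eqI[OF p c] by simp
qed

text \<open>The velocity at \<open>x\<close> belongs to the trajectory of the point \<open>G\<^sub>p\<^sup>-\<^sup>1(x)\<close>, which depends smoothly on \<open>p\<close> and \<open>x\<close> because the
  inverses form a smooth family as well. Inserting it into the derivative of a local extension gives a smooth map.\<close>

lemma V_smooth:
  assumes c: "c \<in> A"
  shows "smooth_on (S \<times> snd c ` fst c) (\<lambda>(p, y). V p c (chart_inv c y))"
proof (rule smooth_onI_local)
  fix z assume z: "z \<in> S \<times> snd c ` fst c"
  define p0 y0 where "p0 = fst z" and "y0 = snd z"
  have p0: "p0 \<in> S" and y0: "y0 \<in> snd c ` fst c" and z_eq: "z = (p0, y0)" using z by (auto simp: p0_def y0_def)
  let ?I = "\<lambda>p. inv_into UNIV (G p)"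
  note smG = diffeo_family_smooth[OF family] and smI = diffeo_family_smooth_inv[OF family]
  have GI: "G p (?I p x) = x" if "p \<in> S" for p x
    using diffeo_family_bij[OF family that] by (simp add: bij_is_surj surj_f_inv_f)
  define q0 where "q0 = ?I p0 (chart_inv c y0)"
  define d where "d = chart_at A q0"
  have d: "d \<in> charts_at A q0" unfolding d_def by (rule chart_at_in)
  note dA = charts_atD[OF d]
  have c0: "c \<in> charts_at A (G p0 q0)" using c chart_inv_in[OF c y0] by (simp add: q0_def GI[OF p0] charts_at_def)
  obtain U h where U: "open U" "(p0, snd d q0) \<in> U" "\<And>k. Ck_on k U h"
    "\<And>p y. (p, y) \<in> U \<Longrightarrow> p \<in> S \<Longrightarrow> y \<in> snd d ` fst d \<Longrightarrow> G p (chart_inv d y) \<in> fst c \<Longrightarrow>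
       snd c (G p (chart_inv d y)) = h (p, y)"
    by (rule smooth_family_extension[OF smG p0 c0 d]) metis
  have "?I p0 (chart_inv c y0) \<in> fst d" using dA by (simp add: q0_def)
  from smooth_family_neighbourhood[OF smI c open_chart[OF dA(1)] p0 y0 this]
  obtain N where N: "open N" "(p0, y0) \<in> N"
    "\<And>p y. (p, y) \<in> N \<Longrightarrow> p \<in> S \<Longrightarrow> y \<in> snd c ` fst c \<Longrightarrow> ?I p (chart_inv c y) \<in> fst d" by metis
  let ?P = "(S \<times> snd c ` fst c) \<inter> N"
  let ?K = "\<lambda>z. (fst z, (\<lambda>(p, y). snd d (?I p (chart_inv c y))) z)"
  have K: "smooth_on ?P ?K"
    by (intro smooth_on_Pair smooth_on_fst smooth_on_ident smooth_on_subset[OF smooth_family_chart[OF smI c dA(1)]])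
       (use N(3) in auto)
  have "(p0, y0) \<in> ?P" "?K (p0, y0) \<in> U" using p0 y0 N(2) U(2) by (auto simp: q0_def)
  then obtain N' where N': "open N'" "(p0, y0) \<in> N'" "\<forall>z\<in>?P. z \<in> N' \<longrightarrow> ?K z \<in> U"
    using smooth_on_continuous[OF K, unfolded continuous_on_topological, rule_format, of "(p0, y0)" U] U(1) by auto
  have smh: "smooth_on U h" using U(1,3) by (rule smooth_onI_open)
  have "smooth_on (?P \<inter> N') (\<lambda>z. frechet_derivative h (at (?K z)) (e, 0))"
    by (rule smooth_on_derivative_compose[OF U(1) smh smooth_on_subset[OF K] _ smooth_on_const]) (use N'(3) in auto)
  then have "smooth_on (?P \<inter> N') (\<lambda>(p, y). V p c (chart_inv c y))"
  proof (rule smooth_on_cong)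
    fix w assume w: "w \<in> ?P \<inter> N'"
    obtain p y where py: "w = (p, y)" by (cases w)
    have p: "p \<in> S" and y: "y \<in> snd c ` fst c" and "(p, y) \<in> N" "?K (p, y) \<in> U" using w N'(3) by (auto simp: py)
    define q where "q = ?I p (chart_inv c y)"
    have Gq: "G p q = chart_inv c y" by (simp add: q_def GI[OF p])
    have dq: "d \<in> charts_at A q" using N(3)[OF \<open>(p, y) \<in> N\<close> p y] dA(1) by (simp add: q_def charts_at_def)
    have cq: "c \<in> charts_at A (G p q)" using c chart_inv_in[OF c y] by (simp add: Gq charts_at_def)
    have Uq: "(p, snd d q) \<in> U" using \<open>?K (p, y) \<in> U\<close> by (simp add: q_def)
    have "V p c (G p q) = frechet_derivative h (at (p, snd d q)) (e, 0)"
      by (rule V_eqI[OF p cq line_has_vector_derivative[OF smG p time[OF p] line[OF p] cq dq U(1) Uq U(3,4)]])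
    then show "frechet_derivative h (at (?K w)) (e, 0) = (case w of (p, y) \<Rightarrow> V p c (chart_inv c y))"
      by (simp add: py Gq) (simp add: q_def)
  qed
  then have "smooth_on ((S \<times> snd c ` fst c) \<inter> (N \<inter> N')) (\<lambda>(p, y). V p c (chart_inv c y))"
    by (simp add: Int_assoc)
  then show "\<exists>U. open U \<and> z \<in> U \<and> smooth_on ((S \<times> snd c ` fst c) \<inter> U) (\<lambda>(p, y). V p c (chart_inv c y))"
    using N(1,2) N'(1,2) z_eq by (intro exI[of _ "N \<inter> N'"]) auto
qed

text \<open>The law of change of coordinates is the chain rule along the trajectory through \<open>x\<close>.\<close>

lemma V_vector_field:
  assumes p: "p \<in> S"
  shows "V p \<in> vector_fields A"
proof (rule vector_fieldsI)
  fix c assume c: "c \<in> A"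
  have "smooth_on (snd c ` fst c) (\<lambda>y. (p, y))" by (intro smooth_on_Pair smooth_on_const smooth_on_ident)
  then have "smooth_on (snd c ` fst c) (\<lambda>y. (\<lambda>(p, y). V p c (chart_inv c y)) (p, y))"
    by (rule smooth_on_compose[OF V_smooth[OF c]]) (use p in auto)
  then show "smooth_on (snd c ` fst c) (V p c \<circ> chart_inv c)" by (simp add: comp_def)
next
  fix c d x assume cx: "c \<in> charts_at A x" and dx: "d \<in> charts_at A x"
  define q where "q = inv_into UNIV (G p) x"
  have Gq: "G p q = x" using diffeo_family_bij[OF family p] by (simp add: q_def bij_is_surj surj_f_inv_f)
  let ?g = "\<lambda>r. G (p + (r - \<rho> p) *\<^sub>R e)"
  have cq: "c \<in> charts_at A (G p q)" and dq: "d \<in> charts_at A (G p q)" using cx dx by (simp_all add: Gq)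
  note cA = charts_atD[OF cx]
  have "((snd d \<circ> chart_inv c) has_derivative chart_deriv c (snd d) x) (at (snd c x))"
    by (rule chart_has_derivative[OF chart_differentiable_chart[OF cx dx]])
  then have "((snd d \<circ> chart_inv c) has_derivative chart_deriv c (snd d) x)
     (at (snd c (?g (\<rho> p) q)) within (\<lambda>r. snd c (?g r q)) ` {0..1})"
    by (simp add: Gq has_derivative_at_withinI)
  from vector_derivative_diff_chain_within[OF V_has_vector_derivative[OF p cq] this]
  have der: "((\<lambda>r. snd d (chart_inv c (snd c (?g r q)))) has_vector_derivative chart_deriv c (snd d) x (V p c x)) (at (\<rho> p) within {0..1})"
    by (simp add: comp_def Gq)
  have "continuous_on {0..1} (\<lambda>r. ?g r q)"
    by (rule smooth_family_continuous_compose[OF diffeo_family_smooth[OF family] _ continuous_on_const line[OF p]])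
       (auto intro!: continuous_intros)
  then have "((\<lambda>r. ?g r q) \<longlongrightarrow> ?g (\<rho> p) q) (at (\<rho> p) within {0..1})"
    using time[OF p] unfolding continuous_on by blast
  then have "\<forall>\<^sub>F r in at (\<rho> p) within {0..1}. ?g r q \<in> fst c"
    by (rule topological_tendstoD) (use open_chart[OF cA(1)] cA(2) Gq in auto)
  then have ev: "\<forall>\<^sub>F r in at (\<rho> p) within {0..1}. snd d (chart_inv c (snd c (?g r q))) = snd d (?g r q)"
    by eventually_elim (simp add: chart_inv_chart[OF cA(1)])
  have "((\<lambda>r. snd d (?g r q)) has_vector_derivative chart_deriv c (snd d) x (V p c x)) (at (\<rho> p) within {0..1})"
    using der unfolding has_vector_derivative_def
    by (rule has_derivative_transform_eventually[OF _ ev]) (use time[OF p] chart_inv_chart[OF cA] in \<open>auto simp: Gq\<close>)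
  from V_eqI[OF p dq this] show "V p d x = chart_deriv c (snd d) x (V p c x)" by (simp add: Gq)
next
  show "V p c x = 0" if "c \<notin> charts_at A x" for c x using that by (simp add: V_def velocity_def)
qed

end

section \<open>Paths of LCS diffeomorphisms\<close>

context atlas begin

lemma line_family_unit_interval:
  assumes "diffeo_family A {0..1} g"
  shows "line_family A {0..1} g (\<lambda>t. t) (1::real)"
  by unfold_locales (use assms in auto)

lemma path_V: "line_family.V A g (\<lambda>t. t) (1::real) t = velocity A g t" if "diffeo_family A {0..1} g"
  unfolding line_family.V_def[OF line_family_unit_interval[OF that]] by simp

lemma
  assumes g: "diffeo_family A {0..1} g" and t: "t \<in> {0..1}"
  shows velocity_vector_field: "velocity A g t \<in> vector_fields A"
    and velocity_has_vector_derivative: "c \<in> charts_at A (g t q) \<Longrightarrow>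
      ((\<lambda>r. snd c (g r q)) has_vector_derivative velocity A g t c (g t q)) (at t within {0..1})"
  using line_family.V_vector_field[OF line_family_unit_interval[OF g] t]
    line_family.V_has_vector_derivative[OF line_family_unit_interval[OF g] t, of c q]
  by (simp_all add: path_V[OF g])

lemma vector_derivative_within_cong:
  fixes u w :: "real \<Rightarrow> 'z::real_normed_vector"
  assumes "t \<in> S" "\<And>r. r \<in> S \<Longrightarrow> u r = w r"
  shows "vector_derivative u (at t within S) = vector_derivative w (at t within S)"
proof -
  have "(u has_vector_derivative D) (at t within S) \<longleftrightarrow> (w has_vector_derivative D) (at t within S)" for D
    using has_vector_derivative_transform[OF assms(1), of u w D] has_vector_derivative_transform[OF assms(1), of w u D] assms(2)
    by fastforce
  then show ?thesis by (simp only: vector_derivative_def)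
qed

lemma velocity_cong:
  assumes eq: "\<And>r. r \<in> {0..1} \<Longrightarrow> f r = g r" and t: "t \<in> {0..1}"
  shows "velocity A f t = velocity A g t"
proof -
  have "vector_derivative (\<lambda>s. snd c (f s y)) (at t within {0..1}) = vector_derivative (\<lambda>s. snd c (g s y)) (at t within {0..1})"
    for c :: "('m, 'e) chart" and y
    by (rule vector_derivative_within_cong[OF t]) (simp only: eq)
  then show ?thesis unfolding velocity_def eq[OF t] by (intro ext) simp
qed

lemma diffeo_family_product:
  assumes "diffeo_family A {0..1} g" "diffeo_family A {0..1} h" "k \<in> {0..1::real}"
  shows "diffeo_family A {0..1} (\<lambda>r. g (k * r) \<circ> h r)"
  by (rule diffeo_family_compose[OF diffeo_family_reparametrize[OF assms(1)] assms(2)])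
     (use assms(3) in \<open>auto intro!: smooth_on_mult smooth_on_const smooth_on_ident simp: mult_le_one\<close>)

text \<open>A trajectory of the product moves with the outer path and with the push-forward of the velocity of the inner
  path. The factor \<open>k\<close> is \<open>1\<close> for products of paths and general for the curves in the square \<open>g\<^sub>s\<^sub>t \<circ> h\<^sub>t\<close>.\<close>

lemma product_has_vector_derivative:
  assumes g: "diffeo_family A {0..1} g" and h: "diffeo_family A {0..1} h"
    and k: "k \<in> {0..1::real}" and t: "t \<in> {0..1}"
    and d: "d \<in> charts_at A (h t q)" and c: "c \<in> charts_at A (g (k * t) (h t q))"
  shows "((\<lambda>r. snd c (g (k * r) (h r q))) has_vector_derivative
     k *\<^sub>R velocity A g (k * t) c (g (k * t) (h t q))
     + chart_deriv d (snd c \<circ> g (k * t)) (h t q) (velocity A h t d (h t q))) (at t within {0..1})"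
proof -
  \<comment> \<open>A local extension \<open>H\<close> of the coordinate expression of \<open>g\<close> is differentiated along the curve \<open>\<gamma>\<close>; its two partial
    derivatives are the velocity of \<open>g\<close> and the tangent map of \<open>g\<^sub>k\<^sub>t\<close>.\<close>
  let ?T = "k * t" and ?q = "h t q" and ?Y = "velocity A h t d (h t q)"
  note dA = charts_atD[OF d] and cA = charts_atD[OF c]
  note smg = diffeo_family_smooth[OF g] and smh = diffeo_family_smooth[OF h]
  have kr: "k * r \<in> {0..1}" if "r \<in> {0..1}" for r using k that by (auto simp: mult_le_one)
  have T: "?T \<in> {0..1}" by (rule kr[OF t])
  have q: "chart_inv d (snd d ?q) = ?q" by (rule chart_inv_chart[OF dA])
  obtain U H where U: "open U" "(?T, snd d ?q) \<in> U" "\<And>k. Ck_on k U H"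
    "\<And>p y. (p, y) \<in> U \<Longrightarrow> p \<in> {0..1} \<Longrightarrow> y \<in> snd d ` fst d \<Longrightarrow> g p (chart_inv d y) \<in> fst c \<Longrightarrow>
       snd c (g p (chart_inv d y)) = H (p, y)"
    by (rule smooth_family_extension[OF smg T c d]) metis
  let ?D = "frechet_derivative H (at (?T, snd d ?q))"
  have HD: "(H has_derivative ?D) (at (?T, snd d ?q))" by (rule Ck_on_has_derivative[OF U(3,2)])
  have D1: "?D (1, 0) = velocity A g ?T c (g ?T ?q)"
  proof -
    have "((\<lambda>r. snd c (g (?T + (r - ?T) *\<^sub>R 1) ?q)) has_vector_derivative ?D (1, 0)) (at ?T within {0..1})"
      by (rule line_has_vector_derivative[OF smg T T _ c d U]) auto
    then have "((\<lambda>r. snd c (g r ?q)) has_vector_derivative ?D (1, 0)) (at ?T within {0..1})" by simp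
    from velocity_eqI[OF diffeo_family_bij[OF g T] c T this] show ?thesis by simp
  qed
  have D2: "?D (0, w) = chart_deriv d (snd c \<circ> g ?T) ?q w" for w
  proof -
    have "((\<lambda>y. (?T, y)) has_derivative (\<lambda>v. (0, v))) (at (snd d ?q))"
      by (auto intro!: derivative_eq_intros)
    from has_derivative_compose[OF this HD]
    have 1: "((\<lambda>y. H (?T, y)) has_derivative (\<lambda>v. ?D (0, v))) (at (snd d ?q))" .
    have "open (g ?T -` fst c)"
      using smooth_mapD[OF smooth_family_slice[OF smg T]] open_chart[OF cA(1)] by (simp add: continuous_on_open_vimage)
    then have "open (snd d ` (fst d \<inter> g ?T -` fst c))" by (rule open_chart_image_Int[OF dA(1)])
    moreover have "open (Pair ?T -` U)" using U(1) by (intro open_vimage) (auto intro: continuous_intros)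
    ultimately have o: "open (snd d ` (fst d \<inter> g ?T -` fst c) \<inter> Pair ?T -` U)" by blast
    have "(snd c \<circ> g ?T \<circ> chart_inv d has_derivative (\<lambda>v. ?D (0, v))) (at (snd d ?q))"
    proof (rule has_derivative_transform_within_open[OF 1 o])
      show "snd d ?q \<in> snd d ` (fst d \<inter> g ?T -` fst c) \<inter> Pair ?T -` U" using dA cA U(2) by blast
      fix y assume "y \<in> snd d ` (fst d \<inter> g ?T -` fst c) \<inter> Pair ?T -` U"
      then show "H (?T, y) = (snd c \<circ> g ?T \<circ> chart_inv d) y"
        using U(4)[of ?T y] T chart_inv_chart[OF dA(1)] by auto
    qed
    from chart_derivI(2)[OF this] show ?thesis by simp
  qed
  let ?\<gamma> = "\<lambda>r. (k * r, snd d (h r q))"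
  have \<gamma>: "(?\<gamma> has_vector_derivative (k, ?Y)) (at t within {0..1})"
    by (intro has_vector_derivative_Pair velocity_has_vector_derivative[OF h t d])
       (auto intro!: derivative_eq_intros simp: has_vector_derivative_def)
  have "(H has_derivative ?D) (at (?\<gamma> t) within ?\<gamma> ` {0..1})" using HD by (rule has_derivative_at_withinI)
  from vector_derivative_diff_chain_within[OF \<gamma> this]
  have der: "((\<lambda>r. H (?\<gamma> r)) has_vector_derivative ?D (k, ?Y)) (at t within {0..1})" by (simp add: comp_def)
  have "?D (k, ?Y) = ?D (k *\<^sub>R (1, 0) + (0, ?Y))" by simp
  also have "\<dots> = k *\<^sub>R ?D (1, 0) + ?D (0, ?Y)"
    by (simp only: linear_add[OF has_derivative_linear[OF HD]] linear_scale[OF has_derivative_linear[OF HD]])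
  finally have Deq: "?D (k, ?Y) = k *\<^sub>R velocity A g ?T c (g ?T ?q) + chart_deriv d (snd c \<circ> g ?T) ?q ?Y"
    by (simp only: D1 D2)
  have "continuous (at t within {0..1}) ?\<gamma>"
    using \<gamma> unfolding has_vector_derivative_def by (rule has_derivative_continuous)
  then have 1: "\<forall>\<^sub>F r in at t within {0..1}. ?\<gamma> r \<in> U"
    unfolding continuous_within by (rule topological_tendstoD) (use U in auto)
  have hc: "continuous_on {0..1} (\<lambda>r. h r q)"
    by (rule smooth_family_continuous_compose[OF smh continuous_on_id continuous_on_const])
  then have "((\<lambda>r. h r q) \<longlongrightarrow> h t q) (at t within {0..1})" using t unfolding continuous_on by blast
  then have 2: "\<forall>\<^sub>F r in at t within {0..1}. h r q \<in> fst d"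
    by (rule topological_tendstoD) (use open_chart[OF dA(1)] dA(2) in auto)
  have "continuous_on {0..1} (\<lambda>r. g (k * r) (h r q))"
    by (rule smooth_family_continuous_compose[OF smg _ hc kr]) (auto intro: continuous_intros)
  then have "((\<lambda>r. g (k * r) (h r q)) \<longlongrightarrow> g (k * t) (h t q)) (at t within {0..1})" using t unfolding continuous_on by blast
  then have 3: "\<forall>\<^sub>F r in at t within {0..1}. g (k * r) (h r q) \<in> fst c"
    by (rule topological_tendstoD) (use open_chart[OF cA(1)] cA(2) in auto)
  have 4: "\<forall>\<^sub>F r in at t within {0..1}. r \<in> {0..1}" by (simp add: eventually_at_filter)
  have H_eq: "H (?\<gamma> r) = snd c (g (k * r) (h r q))"
    if "?\<gamma> r \<in> U" "h r q \<in> fst d" "g (k * r) (h r q) \<in> fst c" "r \<in> {0..1}" for r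
    using U(4)[OF that(1) kr[OF that(4)]] that by (simp add: chart_inv_chart[OF dA(1)])
  have ev: "\<forall>\<^sub>F r in at t within {0..1}. H (?\<gamma> r) = snd c (g (k * r) (h r q))"
    using 1 2 3 4 by eventually_elim (rule H_eq)
  show ?thesis
    by (rule has_derivative_transform_eventually[OF der[unfolded has_vector_derivative_def Deq] ev H_eq t,
          folded has_vector_derivative_def]) (use U(2) dA cA t in auto)
qed

end

context lcs begin

lemma product_velocity_related:
  assumes g: "diffeo_family A {0..1} g" and h: "diffeo_family A {0..1} h"
    and k: "k \<in> {0..1::real}" and t: "t \<in> {0..1}"
  shows "related (g (k * t)) (velocity A h t)
    (\<lambda>c x. velocity A (\<lambda>r. g (k * r) \<circ> h r) t c x - k *\<^sub>R velocity A g (k * t) c x)"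
  unfolding related_def
proof (intro allI ballI)
  fix q d c assume d: "d \<in> charts_at A q" and c: "c \<in> charts_at A (g (k * t) q)"
  define q' where "q' = inv_into UNIV (h t) q"
  have q: "h t q' = q" using diffeo_family_bij[OF h t] by (simp add: q'_def bij_is_surj surj_f_inv_f)
  have "((\<lambda>r. snd c ((g (k * r) \<circ> h r) q')) has_vector_derivative
     k *\<^sub>R velocity A g (k * t) c (g (k * t) q) + chart_deriv d (snd c \<circ> g (k * t)) q (velocity A h t d q)) (at t within {0..1})"
    using product_has_vector_derivative[OF g h k t, of d q' c] d c by (simp add: q)
  from velocity_eqI[where g = "\<lambda>r. g (k * r) \<circ> h r", OF diffeo_family_bij[OF diffeo_family_product[OF g h k] t] _ t this] c
  show "velocity A (\<lambda>r. g (k * r) \<circ> h r) t c (g (k * t) q) - k *\<^sub>R velocity A g (k * t) c (g (k * t) q) =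
     chart_deriv d (snd c \<circ> g (k * t)) q (velocity A h t d q)"
    by (simp add: q)
qed

lemma product_velocity_kerPhi:
  assumes g: "diffeo_family A {0..1} g" and h: "diffeo_family A {0..1} h"
    and k: "k \<in> {0..1::real}" and t: "t \<in> {0..1}"
    and "g (k * t) \<in> Diff_Omega A \<Omega> \<omega>" "velocity A g (k * t) \<in> kerPhi A \<Omega> \<omega>" "velocity A h t \<in> kerPhi A \<Omega> \<omega>"
  shows "velocity A (\<lambda>r. g (k * r) \<circ> h r) t \<in> kerPhi A \<Omega> \<omega>"
proof -
  let ?f = "velocity A (\<lambda>r. g (k * r) \<circ> h r) t" and ?Y = "\<lambda>c x. velocity A (\<lambda>r. g (k * r) \<circ> h r) t c x - k *\<^sub>R velocity A g (k * t) c x"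
  have "?f \<in> vector_fields A" by (rule velocity_vector_field[OF diffeo_family_product[OF g h k] t])
  then have "?Y \<in> vector_fields A"
    using vector_field_combine[OF _ kerPhi_vector_field[OF assms(6)], of ?f 1 "- k"] by simp
  then have "?Y \<in> kerPhi A \<Omega> \<omega>"
    using related_kerPhi[OF assms(5) kerPhi_vector_field[OF assms(7)] _ product_velocity_related[OF g h k t]] assms(7) by blast
  from kerPhi_combine[OF this assms(6), of 1 k] show ?thesis by simp
qed

lemma kerPhi_pathsD:
  assumes "g \<in> kerPhi_paths A \<Omega> \<omega>"
  shows "g 0 = id" "diffeo_family A {0..1} g"
    "t \<in> {0..1} \<Longrightarrow> g t \<in> Diff_Omega A \<Omega> \<omega>" "t \<in> {0..1} \<Longrightarrow> velocity A g t \<in> kerPhi A \<Omega> \<omega>"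
  using assms unfolding kerPhi_paths_def by blast+

lemma kerPhi_paths_product:
  assumes g: "g \<in> kerPhi_paths A \<Omega> \<omega>" and h: "h \<in> kerPhi_paths A \<Omega> \<omega>" and k: "k \<in> {0..1::real}"
  shows "(\<lambda>t. g (k * t) \<circ> h t) \<in> kerPhi_paths A \<Omega> \<omega>"
proof -
  note G = kerPhi_pathsD[OF g] and H = kerPhi_pathsD[OF h]
  note fam = diffeo_family_product[OF G(2) H(2) k]
  have "g (k * t) \<circ> h t \<in> Diff_Omega A \<Omega> \<omega> \<and> velocity A (\<lambda>t. g (k * t) \<circ> h t) t \<in> kerPhi A \<Omega> \<omega>"
    if t: "t \<in> {0..1}" for t
  proof -
    have kt: "k * t \<in> {0..1}" using k t by (auto simp: mult_le_one)
    show ?thesis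
      using Diff_Omega_compose[OF G(3)[OF kt] H(3)[OF t] diffeo_family_diffeo[OF fam t]]
        product_velocity_kerPhi[OF G(2) H(2) k t G(3)[OF kt] G(4)[OF kt] H(4)[OF t]] by blast
  qed
  then show ?thesis using fam G(1) H(1) unfolding kerPhi_paths_def by simp
qed

lemma kerPhi_paths_compose:
  "g \<in> kerPhi_paths A \<Omega> \<omega> \<Longrightarrow> h \<in> kerPhi_paths A \<Omega> \<omega> \<Longrightarrow> (\<lambda>t. g t \<circ> h t) \<in> kerPhi_paths A \<Omega> \<omega>"
  using kerPhi_paths_product[of g h 1] by simp

lemma kerPhi_paths_id: "(\<lambda>t. id) \<in> kerPhi_paths A \<Omega> \<omega>"
  unfolding kerPhi_paths_def
  using diffeo_family_constant[OF Diff_Omega_diffeo[OF Diff_Omega_id]] Diff_Omega_id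
  by (simp add: velocity_constant kerPhi_zero)

text \<open>Since \<open>g\<^sub>t \<circ> g\<^sub>t\<^sup>-\<^sup>1\<close> is constant, the formula for products shows that the push-forward by \<open>g\<^sub>t\<close> of the velocity of the
  inverse path is the negative of the velocity of \<open>g\<close>.\<close>

lemma kerPhi_paths_inverse:
  assumes g: "g \<in> kerPhi_paths A \<Omega> \<omega>"
  shows "(\<lambda>t. inv_into UNIV (g t)) \<in> kerPhi_paths A \<Omega> \<omega>"
proof -
  note G = kerPhi_pathsD[OF g]
  let ?h = "\<lambda>t. inv_into UNIV (g t)"
  note fam = diffeo_family_inverse[OF G(2)]
  have "velocity A ?h t \<in> kerPhi A \<Omega> \<omega>" if t: "t \<in> {0..1}" for t
  proof -
    have "velocity A (\<lambda>r. g (1 * r) \<circ> ?h r) t = velocity A (\<lambda>r. id) t"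
    proof (rule velocity_cong[OF _ t])
      show "g (1 * r) \<circ> ?h r = id" if "r \<in> {0..1}" for r
        using surj_iff[THEN iffD1, OF bij_is_surj[OF diffeo_family_bij[OF G(2) that]]] by simp
    qed
    then have v: "velocity A (\<lambda>r. g (1 * r) \<circ> ?h r) t = (\<lambda>c x. 0)" by (simp add: velocity_constant[OF t])
    have "related (g t) (velocity A ?h t) (\<lambda>c x. - velocity A g t c x)"
      using product_velocity_related[OF G(2) fam _ t, of 1] unfolding v by simp
    moreover have "(\<lambda>c x. - velocity A g t c x) \<in> kerPhi A \<Omega> \<omega>"
      using kerPhi_combine[OF G(4)[OF t] kerPhi_zero, of "-1" 0] by simp
    ultimately show ?thesis
      using related_kerPhi[OF G(3)[OF t] velocity_vector_field[OF fam t]] kerPhi_vector_field by blast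
  qed
  then show ?thesis
    using fam Diff_Omega_inv G(1,3) unfolding kerPhi_paths_def by (simp add: inv_id)
qed

lemma group_kerPhi0: "group (kerPhi0 A \<Omega> \<omega>)"
proof (rule groupI)
  fix x y assume "x \<in> carrier (kerPhi0 A \<Omega> \<omega>)" "y \<in> carrier (kerPhi0 A \<Omega> \<omega>)"
  then obtain g h where "g \<in> kerPhi_paths A \<Omega> \<omega>" "x = g 1" "h \<in> kerPhi_paths A \<Omega> \<omega>" "y = h 1"
    by (auto simp: kerPhi0_def)
  then show "x \<otimes>\<^bsub>kerPhi0 A \<Omega> \<omega>\<^esub> y \<in> carrier (kerPhi0 A \<Omega> \<omega>)"
    using kerPhi_paths_compose[of g h] by (auto simp: kerPhi0_def)
next
  show "\<one>\<^bsub>kerPhi0 A \<Omega> \<omega>\<^esub> \<in> carrier (kerPhi0 A \<Omega> \<omega>)"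
    using kerPhi_paths_id by (auto simp: kerPhi0_def)
next
  fix x assume "x \<in> carrier (kerPhi0 A \<Omega> \<omega>)"
  then obtain g where g: "g \<in> kerPhi_paths A \<Omega> \<omega>" "x = g 1" by (auto simp: kerPhi0_def)
  have "bij (g 1)" using diffeo_family_bij[OF kerPhi_pathsD(2)[OF g(1)], of 1] by simp
  then have "inv_into UNIV (g 1) \<circ> x = id" by (simp add: g(2) bij_is_inj)
  then show "\<exists>y\<in>carrier (kerPhi0 A \<Omega> \<omega>). y \<otimes>\<^bsub>kerPhi0 A \<Omega> \<omega>\<^esub> x = \<one>\<^bsub>kerPhi0 A \<Omega> \<omega>\<^esub>"
    using kerPhi_paths_inverse[OF g(1)] by (auto simp: kerPhi0_def)
qed (auto simp: kerPhi0_def)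

end

section \<open>The flux of a square\<close>

lemma has_vector_derivative_along_line:
  fixes f :: "'p::real_normed_vector \<Rightarrow> 'b::real_normed_vector"
  assumes "(f has_derivative f') (at p)"
  shows "((\<lambda>r. f (p + (r - \<tau>) *\<^sub>R e)) has_vector_derivative f' e) (at \<tau> within S)"
proof -
  have 1: "((\<lambda>r. p + (r - \<tau>) *\<^sub>R e) has_vector_derivative e) (at \<tau> within S)"
    unfolding has_vector_derivative_def by (auto intro!: derivative_eq_intros)
  have "(f has_derivative f') (at (p + (\<tau> - \<tau>) *\<^sub>R e) within (\<lambda>r. p + (r - \<tau>) *\<^sub>R e) ` S)"
    using assms by (simp add: has_derivative_at_withinI)
  from vector_derivative_diff_chain_within[OF 1 this] show ?thesis by (simp add: comp_def)
qed

text \<open>Derivatives along segments of the parameter set are again computed by local extensions; they are therefore smooth up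
  to the boundary, where they are one-sided.\<close>

lemma
  fixes f :: "'p::euclidean_space \<Rightarrow> 'b::euclidean_space" and e :: 'p
  assumes f: "smooth_on S f" and time: "\<And>p. p \<in> S \<Longrightarrow> \<rho> p \<in> {0..1}"
    and line: "\<And>p r. p \<in> S \<Longrightarrow> r \<in> {0..1} \<Longrightarrow> p + (r - \<rho> p) *\<^sub>R e \<in> S"
  defines "D \<equiv> \<lambda>p. vector_derivative (\<lambda>r. f (p + (r - \<rho> p) *\<^sub>R e)) (at (\<rho> p) within {0..1})"
  shows line_derivative: "p \<in> S \<Longrightarrow> ((\<lambda>r. f (p + (r - \<rho> p) *\<^sub>R e)) has_vector_derivative D p) (at (\<rho> p) within {0..1})"
    and smooth_on_line_derivative: "smooth_on S D"
proof -
  have core: "((\<lambda>r. f (p + (r - \<rho> p) *\<^sub>R e)) has_vector_derivative frechet_derivative g (at p) e) (at (\<rho> p) within {0..1})"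
    if U: "open U" "p \<in> U" "\<forall>k. Ck_on k U g" "\<forall>y\<in>S \<inter> U. f y = g y" and p: "p \<in> S" for p U g
  proof -
    let ?L = "\<lambda>r. p + (r - \<rho> p) *\<^sub>R e"
    have "Ck_on (Suc 0) U g" using U(3) by blast
    note der = has_vector_derivative_along_line[OF Ck_on_has_derivative[OF this U(2)], of "\<rho> p" e "{0..1}"]
    have "(?L \<longlongrightarrow> ?L (\<rho> p)) (at (\<rho> p) within {0..1})" by (intro tendsto_intros)
    then have 1: "\<forall>\<^sub>F r in at (\<rho> p) within {0..1}. ?L r \<in> U"
      by (rule topological_tendstoD) (use U in auto)
    have 2: "\<forall>\<^sub>F r in at (\<rho> p) within {0..1}. r \<in> {0..1}" by (simp add: eventually_at_filter)
    have ev: "\<forall>\<^sub>F r in at (\<rho> p) within {0..1}. g (?L r) = f (?L r)"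
      using 1 2 by eventually_elim (use U(4) line[OF p] in auto)
    show ?thesis
      by (rule has_derivative_transform_eventually[OF der[unfolded has_vector_derivative_def] ev _ time[OF p],
            folded has_vector_derivative_def]) (use U p in auto)
  qed
  have D: "D p = frechet_derivative g (at p) e"
    if "open U" "p \<in> U" "\<forall>k. Ck_on k U g" "\<forall>y\<in>S \<inter> U. f y = g y" "p \<in> S" for p U g
    unfolding D_def by (rule vector_derivative_within_closed_interval[OF zero_less_one time[OF that(5)] core[OF that]])
  show "((\<lambda>r. f (p + (r - \<rho> p) *\<^sub>R e)) has_vector_derivative D p) (at (\<rho> p) within {0..1})" if p: "p \<in> S"
  proof -
    obtain U g where U: "open U" "p \<in> U" "\<forall>k. Ck_on k U g" "\<forall>y\<in>S \<inter> U. f y = g y"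
      by (rule smooth_onE[OF f p])
    show ?thesis unfolding D[OF U p] by (rule core[OF U p])
  qed
  show "smooth_on S D"
  proof (rule smooth_onI_local)
    fix p assume p: "p \<in> S"
    obtain U g where U: "open U" "p \<in> U" "\<forall>k. Ck_on k U g" "\<forall>y\<in>S \<inter> U. f y = g y"
      by (rule smooth_onE[OF f p])
    have "smooth_on U g" using U(1,3) by (intro smooth_onI_open) auto
    then have "smooth_on (S \<inter> U) (\<lambda>p. frechet_derivative g (at p) e)"
      by (rule smooth_on_subset[OF smooth_on_derivative[OF U(1)]]) simp
    then have "smooth_on (S \<inter> U) D"
      by (rule smooth_on_cong) (rule D[OF U(1) _ U(3,4), symmetric], auto)
    then show "\<exists>U. open U \<and> p \<in> U \<and> smooth_on (S \<inter> U) D" using U by blast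
  qed
qed

text \<open>Green's formula on the unit square. The partial derivatives are compared in the interior, where they
  are ordinary derivatives; both sides are continuous up to the boundary, which extends the identity to the square.\<close>

lemma unit_square_green:
  fixes \<alpha> \<beta> \<phi> :: "real \<times> real \<Rightarrow> real"
  defines "Q \<equiv> {0..1} \<times> {0..1}"
  assumes \<alpha>: "smooth_on Q \<alpha>" and \<beta>: "smooth_on Q \<beta>" and \<phi>: "continuous_on Q \<phi>"
    and eq: "\<And>p. p \<in> box (0, 0) (1, 1) \<Longrightarrow>
      frechet_derivative \<alpha> (at p) (1, 0) - frechet_derivative \<beta> (at p) (0, 1) = \<phi> p"
  shows "(integral {0..1} (\<lambda>t. \<alpha> (1, t)) - integral {0..1} (\<lambda>t. \<alpha> (0, t)))
     - (integral {0..1} (\<lambda>s. \<beta> (s, 1)) - integral {0..1} (\<lambda>s. \<beta> (s, 0))) = integral Q \<phi>"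
proof -
  have Q: "Q = cbox (0, 0) (1, 1)" by (simp add: Q_def cbox_Pair_eq)
  have box: "box (0, 0) (1, 1) \<subseteq> Q" unfolding Q by (rule box_subset_cbox)
  have line: "p + (r - fst p) *\<^sub>R (1, 0) \<in> Q" "p + (r - snd p) *\<^sub>R (0, 1) \<in> Q" "fst p \<in> {0..1}" "snd p \<in> {0..1}"
    if "p \<in> Q" "r \<in> {0..1}" for p r using that by (auto simp: Q_def)
  define A1 where "A1 p = vector_derivative (\<lambda>r. \<alpha> (p + (r - fst p) *\<^sub>R (1, 0))) (at (fst p) within {0..1})" for p
  define B1 where "B1 p = vector_derivative (\<lambda>r. \<beta> (p + (r - snd p) *\<^sub>R (0, 1))) (at (snd p) within {0..1})" for p
  have in01: "fst p \<in> {0..1}" "snd p \<in> {0..1}" if "p \<in> Q" for p using that by (auto simp: Q_def)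
  have A1: "((\<lambda>r. \<alpha> (p + (r - fst p) *\<^sub>R (1, 0))) has_vector_derivative A1 p) (at (fst p) within {0..1})" if "p \<in> Q" for p
    using line_derivative[OF \<alpha> in01(1) line(1) that] by (simp add: A1_def)
  have B1: "((\<lambda>r. \<beta> (p + (r - snd p) *\<^sub>R (0, 1))) has_vector_derivative B1 p) (at (snd p) within {0..1})" if "p \<in> Q" for p
    using line_derivative[OF \<beta> in01(2) line(2) that] by (simp add: B1_def)
  have A1c: "continuous_on Q A1"
    using smooth_on_continuous[OF smooth_on_line_derivative[OF \<alpha> in01(1) line(1)]] by (simp add: A1_def[abs_def])
  have B1c: "continuous_on Q B1"
    using smooth_on_continuous[OF smooth_on_line_derivative[OF \<beta> in01(2) line(2)]] by (simp add: B1_def[abs_def])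
  have inner: "A1 p - B1 p - \<phi> p = 0" if p: "p \<in> box (0, 0) (1, 1)" for p
  proof -
    have pQ: "p \<in> Q" using p box by blast
    have "A1 p = frechet_derivative \<alpha> (at p) (1, 0)"
      unfolding A1_def
      by (rule vector_derivative_within_closed_interval[OF zero_less_one in01(1)[OF pQ] has_vector_derivative_along_line[OF
            smooth_on_has_derivative[OF open_box smooth_on_subset[OF \<alpha> box] p]]])
    moreover have "B1 p = frechet_derivative \<beta> (at p) (0, 1)"
      unfolding B1_def
      by (rule vector_derivative_within_closed_interval[OF zero_less_one in01(2)[OF pQ] has_vector_derivative_along_line[OF
            smooth_on_has_derivative[OF open_box smooth_on_subset[OF \<beta> box] p]]])
    ultimately show ?thesis using eq[OF p] by simp
  qed
  have "(1/2, 1/2) \<in> box (0, 0) (1::real, 1::real)" by (simp add: mem_box Basis_prod_def)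
  then have closure: "closure (box (0, 0) (1, 1)) = Q" unfolding Q by (intro closure_box) blast
  have zero: "A1 p - B1 p - \<phi> p = 0" if "p \<in> Q" for p
    by (rule continuous_constant_on_closure[of "box (0, 0) (1, 1)" "\<lambda>p. A1 p - B1 p - \<phi> p" 0])
       (use inner that in \<open>auto simp: closure intro!: continuous_intros A1c B1c \<phi>\<close>)
  have \<phi>_eq: "\<phi> p = A1 p - B1 p" if "p \<in> Q" for p using zero[OF that] by simp
  have "integral Q \<phi> = integral Q (\<lambda>p. A1 p - B1 p)" by (rule integral_cong) (rule \<phi>_eq)
  also have "\<dots> = integral Q A1 - integral Q B1"
    using A1c B1c unfolding Q by (intro integral_diff integrable_continuous)
  also have "integral Q A1 = integral {0..1} (\<lambda>t. \<alpha> (1, t)) - integral {0..1} (\<lambda>t. \<alpha> (0, t))"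
  proof -
    have "integral Q A1 = integral {0..1} (\<lambda>s. integral {0..1} (\<lambda>t. A1 (s, t)))"
      using integral_prod_continuous[of 0 0 1 1 A1] A1c by (simp add: Q)
    also have "\<dots> = integral {0..1} (\<lambda>t. integral {0..1} (\<lambda>s. A1 (s, t)))"
      using integral_swap_continuous[of 0 0 1 1 "\<lambda>s t. A1 (s, t)"] A1c by (simp add: Q)
    also have "\<dots> = integral {0..1} (\<lambda>t. \<alpha> (1, t) - \<alpha> (0, t))"
    proof (rule integral_cong)
      fix t :: real assume t: "t \<in> {0..1}"
      have "((\<lambda>s. A1 (s, t)) has_integral \<alpha> (1, t) - \<alpha> (0, t)) {0..1}"
        by (rule fundamental_theorem_of_calculus) (use A1[of "(_, t)"] t in \<open>auto simp: Q_def\<close>)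
      then show "integral {0..1} (\<lambda>s. A1 (s, t)) = \<alpha> (1, t) - \<alpha> (0, t)" by (rule integral_unique)
    qed
    also have "\<dots> = integral {0..1} (\<lambda>t. \<alpha> (1, t)) - integral {0..1} (\<lambda>t. \<alpha> (0, t))"
      by (intro integral_diff integrable_continuous_interval continuous_on_compose2[OF smooth_on_continuous[OF \<alpha>]])
         (auto simp: Q_def intro!: continuous_intros)
    finally show ?thesis .
  qed
  also have "integral Q B1 = integral {0..1} (\<lambda>s. \<beta> (s, 1)) - integral {0..1} (\<lambda>s. \<beta> (s, 0))"
  proof -
    have "integral Q B1 = integral {0..1} (\<lambda>s. integral {0..1} (\<lambda>t. B1 (s, t)))"
      using integral_prod_continuous[of 0 0 1 1 B1] B1c by (simp add: Q)
    also have "\<dots> = integral {0..1} (\<lambda>s. \<beta> (s, 1) - \<beta> (s, 0))"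
    proof (rule integral_cong)
      fix s :: real assume s: "s \<in> {0..1}"
      have "((\<lambda>t. B1 (s, t)) has_integral \<beta> (s, 1) - \<beta> (s, 0)) {0..1}"
        by (rule fundamental_theorem_of_calculus) (use B1[of "(s, _)"] s in \<open>auto simp: Q_def\<close>)
      then show "integral {0..1} (\<lambda>t. B1 (s, t)) = \<beta> (s, 1) - \<beta> (s, 0)" by (rule integral_unique)
    qed
    also have "\<dots> = integral {0..1} (\<lambda>s. \<beta> (s, 1)) - integral {0..1} (\<lambda>s. \<beta> (s, 0))"
      by (intro integral_diff integrable_continuous_interval continuous_on_compose2[OF smooth_on_continuous[OF \<beta>]])
         (auto simp: Q_def intro!: continuous_intros)
    finally show ?thesis .
  qed
  finally show ?thesis by simp
qed

context atlas begin

text \<open>Both velocities arise from the mixed second derivative of the family: in coordinates, the derivative of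
  \<open>\<partial>\<^sub>t G = X(G)\<close> in \<open>s\<close> and of \<open>\<partial>\<^sub>s G = Y(G)\<close> in \<open>t\<close> agree.\<close>

lemma velocity_commutator:
  fixes G :: "real \<times> real \<Rightarrow> 'm \<Rightarrow> 'm"
  defines "X \<equiv> \<lambda>p. velocity A (\<lambda>r. G (fst p, r)) (snd p)" and "Y \<equiv> \<lambda>p. velocity A (\<lambda>r. G (r, snd p)) (fst p)"
  assumes fam: "diffeo_family A ({0..1} \<times> {0..1}) G"
    and p0: "p0 \<in> box (0, 0) (1, 1)" and c: "c \<in> charts_at A x"
  shows "frechet_derivative (\<lambda>p. X p c x) (at p0) (1, 0) - frechet_derivative (\<lambda>p. Y p c x) (at p0) (0, 1)
    = chart_deriv c (Y p0 c) x (X p0 c x) - chart_deriv c (X p0 c) x (Y p0 c x)"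
proof -
  define Q :: "(real \<times> real) set" where "Q = {0..1} \<times> {0..1}"
  define I :: "(real \<times> real) set" where "I = box (0, 0) (1, 1)"
  have IQ: "I \<subseteq> Q" using box_subset_cbox[of "(0, 0)" "(1::real, 1::real)"] by (simp add: I_def Q_def cbox_Pair_eq)
  have oI: "open I" unfolding I_def by (rule open_box)
  have p0I: "p0 \<in> I" using p0 by (simp add: I_def)
  interpret LX: line_family A Q G snd "(0, 1)" by unfold_locales (use fam in \<open>auto simp: Q_def\<close>)
  interpret LY: line_family A Q G fst "(1, 0)" by unfold_locales (use fam in \<open>auto simp: Q_def\<close>)
  have X: "LX.V p = X p" and Y: "LY.V p = Y p" for p
    unfolding LX.V_def LY.V_def X_def Y_def by (cases p; simp)+
  note cA = charts_atD[OF c]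
  define V where "V = snd c ` fst c"
  have oV: "open V" unfolding V_def by (rule open_chart_image[OF cA(1)])
  have smX: "smooth_on (I \<times> V) (\<lambda>(p, y). X p c (chart_inv c y))" and smY: "smooth_on (I \<times> V) (\<lambda>(p, y). Y p c (chart_inv c y))"
    using smooth_on_subset[OF LX.V_smooth[OF cA(1)], of "I \<times> V"] smooth_on_subset[OF LY.V_smooth[OF cA(1)], of "I \<times> V"] IQ
    by (auto simp: X Y V_def)
  note smG = diffeo_family_smooth[OF LX.family]
  define q where "q = inv_into UNIV (G p0) x"
  have q: "G p0 q = x" using diffeo_family_bij[OF LX.family subsetD[OF IQ p0I]] by (simp add: q_def bij_is_surj surj_f_inv_f)
  define d where "d = chart_at A q"
  have d: "d \<in> charts_at A q" unfolding d_def by (rule chart_at_in)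
  note dA = charts_atD[OF d]
  define u where "u p = snd c (G p q)" for p
  define W where "W = I \<inter> (\<lambda>p. G p q) -` fst c"
  have "continuous_on I (\<lambda>p. G p q)"
    by (rule smooth_family_continuous_compose[OF smG continuous_on_id continuous_on_const]) (use IQ in auto)
  then have oW: "open W" unfolding W_def by (rule continuous_open_preimage[OF _ oI open_chart[OF cA(1)]])
  have p0W: "p0 \<in> W" using p0I cA(2) by (simp add: W_def q)
  have "smooth_on W (\<lambda>p. snd c (G p (chart_inv d (snd d q))))"
    by (rule smooth_family_chart_compose[OF smG dA(1) cA(1) smooth_on_ident smooth_on_const])
       (use IQ dA chart_inv_chart[OF dA] in \<open>auto simp: W_def\<close>)
  then have smu: "smooth_on W u" by (simp add: chart_inv_chart[OF dA] u_def[abs_def])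
  have pW: "p \<in> Q" "c \<in> charts_at A (G p q)" "u p \<in> V" "chart_inv c (u p) = G p q" if "p \<in> W" for p
    using that IQ cA chart_inv_chart[OF cA(1)] by (auto simp: W_def u_def V_def charts_at_def)
  have u0: "u p0 = snd c x" by (simp add: u_def q)
  have ut: "frechet_derivative u (at p) (0, 1) = X p c (chart_inv c (u p))"
    and us: "frechet_derivative u (at p) (1, 0) = Y p c (chart_inv c (u p))" if p: "p \<in> W" for p
  proof -
    note der = smooth_on_has_derivative[OF oW smu p]
    have "((\<lambda>r. u (p + (r - snd p) *\<^sub>R (0, 1))) has_vector_derivative X p c (G p q)) (at (snd p) within {0..1})"
      using LX.V_has_vector_derivative[OF pW(1,2)[OF p]] by (simp add: X u_def)
    from vector_derivative_within_closed_interval[OF zero_less_one LX.time[OF pW(1)[OF p]] this]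
      vector_derivative_within_closed_interval[OF zero_less_one LX.time[OF pW(1)[OF p]]
        has_vector_derivative_along_line[OF der, of "snd p" "(0, 1)"]]
    show "frechet_derivative u (at p) (0, 1) = X p c (chart_inv c (u p))" using pW(4)[OF p] by simp
    have "((\<lambda>r. u (p + (r - fst p) *\<^sub>R (1, 0))) has_vector_derivative Y p c (G p q)) (at (fst p) within {0..1})"
      using LY.V_has_vector_derivative[OF pW(1,2)[OF p]] by (simp add: Y u_def)
    from vector_derivative_within_closed_interval[OF zero_less_one LY.time[OF pW(1)[OF p]] this]
      vector_derivative_within_closed_interval[OF zero_less_one LY.time[OF pW(1)[OF p]]
        has_vector_derivative_along_line[OF der, of "fst p" "(1, 0)"]]
    show "frechet_derivative u (at p) (1, 0) = Y p c (chart_inv c (u p))" using pW(4)[OF p] by simp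
  qed
  have chain: "((\<lambda>p. Z p c (chart_inv c (u p))) has_derivative
      (\<lambda>h. frechet_derivative (\<lambda>p. Z p c x) (at p0) h + chart_deriv c (Z p0 c) x (frechet_derivative u (at p0) h))) (at p0)"
    if sm: "smooth_on (I \<times> V) (\<lambda>(p, y). Z p c (chart_inv c y))" for Z :: "real \<times> real \<Rightarrow> ('m, 'e) vfield"
  proof -
    let ?Z = "\<lambda>(p, y). Z p c (chart_inv c y)"
    let ?D = "frechet_derivative ?Z (at (p0, snd c x))"
    have in_dom: "(p0, snd c x) \<in> I \<times> V" using p0I cA by (auto simp: V_def)
    have x: "chart_inv c (snd c x) = x" by (rule chart_inv_chart[OF cA])
    have D: "(?Z has_derivative ?D) (at (p0, snd c x))"
      by (rule smooth_on_has_derivative[OF open_Times[OF oI oV] sm in_dom])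
    have "((\<lambda>p. (p, u p)) has_derivative (\<lambda>h. (h, frechet_derivative u (at p0) h))) (at p0)"
      by (rule has_derivative_Pair[OF has_derivative_ident smooth_on_has_derivative[OF oW smu p0W]])
    moreover have "(?Z has_derivative ?D) (at (p0, u p0))" using D by (simp only: u0)
    ultimately have 1: "((\<lambda>p. ?Z (p, u p)) has_derivative (\<lambda>h. ?D (h, frechet_derivative u (at p0) h))) (at p0)"
      by (rule has_derivative_compose)
    have "((\<lambda>p. (p, snd c x)) has_derivative (\<lambda>h. (h, 0))) (at p0)" by (auto intro!: derivative_eq_intros)
    from has_derivative_compose[OF this D]
    have "((\<lambda>p. Z p c x) has_derivative (\<lambda>h. ?D (h, 0))) (at p0)" by (simp add: x)
    then have 2: "frechet_derivative (\<lambda>p. Z p c x) (at p0) = (\<lambda>h. ?D (h, 0))" by (rule frechet_derivative_eqI)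
    have "((\<lambda>y. (p0, y)) has_derivative (\<lambda>w. (0, w))) (at (snd c x))" by (auto intro!: derivative_eq_intros)
    from has_derivative_compose[OF this D]
    have "(Z p0 c \<circ> chart_inv c has_derivative (\<lambda>w. ?D (0, w))) (at (snd c x))" by (simp add: comp_def)
    then have 3: "chart_deriv c (Z p0 c) x = (\<lambda>w. ?D (0, w))" by (rule chart_derivI(2))
    have "?D (h, w) = ?D (h, 0) + ?D (0, w)" for h w
      using linear_add[OF has_derivative_linear[OF D], of "(h, 0)" "(0, w)"] by simp
    then have "(\<lambda>h. ?D (h, frechet_derivative u (at p0) h)) = (\<lambda>h. ?D (h, 0) + ?D (0, frechet_derivative u (at p0) h))"
      by (intro ext)
    then show ?thesis using 1 unfolding 2 3 by (simp only: prod.case)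
  qed
  have mixed: "frechet_derivative (\<lambda>p. frechet_derivative u (at p) e) (at p0) h =
      frechet_derivative (\<lambda>p. Z p c x) (at p0) h + chart_deriv c (Z p0 c) x (frechet_derivative u (at p0) h)"
    if "smooth_on (I \<times> V) (\<lambda>(p, y). Z p c (chart_inv c y))"
      and "\<And>p. p \<in> W \<Longrightarrow> frechet_derivative u (at p) e = Z p c (chart_inv c (u p))" for Z :: "real \<times> real \<Rightarrow> ('m, 'e) vfield" and e h
  proof -
    have "frechet_derivative (\<lambda>p. frechet_derivative u (at p) e) (at p0) = frechet_derivative (\<lambda>p. Z p c (chart_inv c (u p))) (at p0)"
      by (rule frechet_derivative_transform_within_open[OF smooth_on_differentiable[OF oW smooth_on_derivative[OF oW smu] p0W] oW p0W that(2)])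
    then show ?thesis unfolding frechet_derivative_eqI[OF chain[of Z, OF that(1)]] by simp
  qed
  have x: "chart_inv c (snd c x) = x" by (rule chart_inv_chart[OF cA])
  have "frechet_derivative (\<lambda>p. frechet_derivative u (at p) (0, 1)) (at p0) (1, 0) =
    frechet_derivative (\<lambda>p. frechet_derivative u (at p) (1, 0)) (at p0) (0, 1)"
    by (rule second_derivative_symmetric[OF oW smu p0W])
  then show ?thesis
    using mixed[of X "(0, 1)" "(1, 0)", OF smX ut] mixed[of Y "(1, 0)" "(0, 1)", OF smY us]
    by (simp add: ut[OF p0W] us[OF p0W] u0 x algebra_simps)
qed

end

context lcs begin

text \<open>Primitives of exact forms that depend smoothly on a parameter may be integrated over the parameter.\<close>

lemma
  fixes f :: "'p::euclidean_space \<Rightarrow> 'm \<Rightarrow> real"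
  assumes f: "\<And>c. c \<in> A \<Longrightarrow> smooth_on (cbox a b \<times> snd c ` fst c) (\<lambda>(p, y). f p (chart_inv c y))"
  shows smooth_function_integral: "(\<lambda>x. integral (cbox a b) (\<lambda>p. f p x)) \<in> smooth_functions A"
    and dw0_integral: "dw0 A \<omega> (\<lambda>x. integral (cbox a b) (\<lambda>p. f p x)) c x v = integral (cbox a b) (\<lambda>p. dw0 A \<omega> (f p) c x v)"
    and continuous_on_dw0: "continuous_on (cbox a b) (\<lambda>p. dw0 A \<omega> (f p) c x v)"
proof -
  let ?F = "\<lambda>x. integral (cbox a b) (\<lambda>p. f p x)"
  show "?F \<in> smooth_functions A"
    unfolding smooth_functions_def comp_def
    using smooth_on_integral_parameter[OF open_chart_image f] by blast
  have "dw0 A \<omega> ?F c x v = integral (cbox a b) (\<lambda>p. dw0 A \<omega> (f p) c x v) \<and> continuous_on (cbox a b) (\<lambda>p. dw0 A \<omega> (f p) c x v)"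
  proof (cases "c \<in> charts_at A x")
    case True
    note cA = charts_atD[OF True]
    have y: "snd c x \<in> snd c ` fst c" using cA by blast
    have x: "chart_inv c (snd c x) = x" by (rule chart_inv_chart[OF cA])
    have D: "chart_deriv c ?F x v = integral (cbox a b) (\<lambda>p. chart_deriv c (f p) x v)"
      using has_derivative_integral_parameter[OF open_chart_image[OF cA(1)] f[OF cA(1)] y]
      by (simp add: chart_deriv_def comp_def frechet_derivative_eqI)
    have slice: "continuous_on (cbox a b) (\<lambda>p. h p (snd c x))"
      if "smooth_on (cbox a b \<times> snd c ` fst c) (\<lambda>(p, y). h p y)" for h :: "'p \<Rightarrow> 'e \<Rightarrow> real"
    proof -
      have "continuous_on (cbox a b) (\<lambda>p. (\<lambda>(p, y). h p y) (p, snd c x))"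
        by (rule continuous_on_compose2[OF smooth_on_continuous[OF that]]) (use y in \<open>auto intro!: continuous_intros\<close>)
      then show ?thesis by simp
    qed
    have c1: "continuous_on (cbox a b) (\<lambda>p. f p x)" using slice[OF f[OF cA(1)]] by (simp add: x)
    have c2: "continuous_on (cbox a b) (\<lambda>p. chart_deriv c (f p) x v)"
      using slice[OF smooth_on_partial[OF open_chart_image[OF cA(1)] f[OF cA(1)]], of v]
      by (simp add: chart_deriv_def comp_def)
    have "integral (cbox a b) (\<lambda>p. chart_deriv c (f p) x v + f p x * \<omega> c x v) =
      integral (cbox a b) (\<lambda>p. chart_deriv c (f p) x v) + integral (cbox a b) (\<lambda>p. f p x * \<omega> c x v)"
      by (intro integral_add integrable_continuous c2 continuous_on_mult c1 continuous_on_const)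
    then show ?thesis
      using True D c1 c2 by (auto simp: dw0_def d0_def intro!: continuous_intros)
  qed (simp add: dw0_def d0_def one_form_outside[OF lee_form])
  then show "dw0 A \<omega> ?F c x v = integral (cbox a b) (\<lambda>p. dw0 A \<omega> (f p) c x v)"
    "continuous_on (cbox a b) (\<lambda>p. dw0 A \<omega> (f p) c x v)" by auto
qed

text \<open>Stokes' theorem for the flux of a square of diffeomorphisms. With \<open>X\<close> and \<open>Y\<close> the velocities in \<open>t\<close> and \<open>s\<close>, the lemmas
  \<open>velocity_commutator\<close> and \<open>contract_bracket_exact\<close> give \<open>\<partial>\<^sub>s i\<^sub>X \<Omega> - \<partial>\<^sub>t i\<^sub>Y \<Omega> = - d\<^sup>\<omega> (\<Omega>(X, Y))\<close> in the interior. Integrating over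
  the square, the left-hand side becomes the flux around the boundary and the right-hand side stays exact.\<close>

lemma square_flux:
  fixes G :: "real \<times> real \<Rightarrow> 'm \<Rightarrow> 'm"
  assumes fam: "diffeo_family A ({0..1} \<times> {0..1}) G"
    and kX: "\<And>s t. s \<in> {0..1} \<Longrightarrow> t \<in> {0..1} \<Longrightarrow> velocity A (\<lambda>r. G (s, r)) t \<in> kerPhi A \<Omega> \<omega>"
    and kY: "\<And>s t. s \<in> {0..1} \<Longrightarrow> t \<in> {0..1} \<Longrightarrow> velocity A (\<lambda>r. G (r, t)) s \<in> kerPhi A \<Omega> \<omega>"
  shows "(\<lambda>c x v. (flux_form A \<Omega> (\<lambda>t. G (1, t)) c x v - flux_form A \<Omega> (\<lambda>t. G (0, t)) c x v)
      - (flux_form A \<Omega> (\<lambda>s. G (s, 1)) c x v - flux_form A \<Omega> (\<lambda>s. G (s, 0)) c x v)) \<in> exact1 A \<omega>"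
proof -
  define Q :: "(real \<times> real) set" where "Q = {0..1} \<times> {0..1}"
  have Qc: "Q = cbox (0, 0) (1, 1)" by (simp add: Q_def cbox_Pair_eq)
  have IQ: "box (0, 0) (1, 1) \<subseteq> Q" unfolding Qc by (rule box_subset_cbox)
  interpret LX: line_family A Q G snd "(0, 1)" by unfold_locales (use fam in \<open>auto simp: Q_def\<close>)
  interpret LY: line_family A Q G fst "(1, 0)" by unfold_locales (use fam in \<open>auto simp: Q_def\<close>)
  define X where "X p = velocity A (\<lambda>r. G (fst p, r)) (snd p)" for p
  define Y where "Y p = velocity A (\<lambda>r. G (r, snd p)) (fst p)" for p
  have V: "LX.V p = X p" "LY.V p = Y p" for p
    unfolding LX.V_def LY.V_def X_def Y_def by (cases p; simp)+
  have k: "X p \<in> kerPhi A \<Omega> \<omega>" "Y p \<in> kerPhi A \<Omega> \<omega>" if "p \<in> Q" for p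
    using that kX kY by (auto simp: Q_def X_def Y_def)
  have smX: "smooth_on (Q \<times> snd c ` fst c) (\<lambda>z. X (fst z) c (chart_inv c (snd z)))"
    and smY: "smooth_on (Q \<times> snd c ` fst c) (\<lambda>z. Y (fst z) c (chart_inv c (snd z)))" if "c \<in> A" for c
    using LX.V_smooth[OF that] LY.V_smooth[OF that] by (simp_all add: V case_prod_unfold)
  define f where "f p = contract1 A (contract2 \<Omega> (X p)) (Y p)" for p
  have smf: "smooth_on (Q \<times> snd c ` fst c) (\<lambda>(p, y). f p (chart_inv c y))" if c: "c \<in> A" for c
  proof -
    have ch: "c \<in> charts_at A (chart_inv c y)" if "y \<in> snd c ` fst c" for y
      using c chart_inv_in[OF c that] by (simp add: charts_at_def)
    have \<Omega>: "smooth_on (Q \<times> snd c ` fst c) (\<lambda>z. \<Omega> c (chart_inv c (snd z)) v w)" for v w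
      by (rule smooth_on_compose[OF form_smooth[OF c] smooth_on_snd[OF smooth_on_ident]]) auto
    have 1: "smooth_on (Q \<times> snd c ` fst c) (\<lambda>z. \<Omega> c (chart_inv c (snd z)) (X (fst z) c (chart_inv c (snd z))) w)" for w
      by (rule smooth_on_contraction[where L = "\<lambda>z u. \<Omega> c (chart_inv c (snd z)) u w" and X = "\<lambda>z. X (fst z) c (chart_inv c (snd z))",
            OF _ \<Omega> smX[OF c]]) (auto intro: form_linear(2)[OF ch])
    have "smooth_on (Q \<times> snd c ` fst c) (\<lambda>z. \<Omega> c (chart_inv c (snd z)) (X (fst z) c (chart_inv c (snd z))) (Y (fst z) c (chart_inv c (snd z))))"
      by (rule smooth_on_contraction[where L = "\<lambda>z u. \<Omega> c (chart_inv c (snd z)) (X (fst z) c (chart_inv c (snd z))) u"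
            and X = "\<lambda>z. Y (fst z) c (chart_inv c (snd z))", OF _ 1 smY[OF c]]) (auto intro: form_linear(1)[OF ch])
    then show ?thesis
    proof (rule smooth_on_cong)
      fix z assume "z \<in> Q \<times> snd c ` fst c"
      then obtain p y where z: "z = (p, y)" "p \<in> Q" "y \<in> snd c ` fst c" by auto
      note vf = k[OF z(2), THEN kerPhi_vector_field]
      show "\<Omega> c (chart_inv c (snd z)) (X (fst z) c (chart_inv c (snd z))) (Y (fst z) c (chart_inv c (snd z))) =
        (case z of (p, y) \<Rightarrow> f p (chart_inv c y))"
        using contract1_in_chart[OF contract2_one_form[OF vf(1)] vf(2) ch[OF z(3)]]
        by (simp add: z(1) f_def contract2_def)
    qed
  qed
  define F where "F x = - integral Q (\<lambda>p. f p x)" for x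
  note smf' = smf[unfolded Qc]
  have smF: "F \<in> smooth_functions A"
    using smooth_function_mult[OF smooth_function_const[of "-1"] smooth_function_integral[OF smf']]
    by (simp add: F_def[abs_def] Qc)
  have dF: "dw0 A \<omega> F c x v = - integral Q (\<lambda>p. dw0 A \<omega> (f p) c x v)" for c x v
    using dw0_scale[OF smooth_function_integral[OF smf'], of "-1" c x v] dw0_integral[OF smf', of c x v]
    by (simp add: F_def[abs_def] Qc)
  have "(flux_form A \<Omega> (\<lambda>t. G (1, t)) c x v - flux_form A \<Omega> (\<lambda>t. G (0, t)) c x v)
      - (flux_form A \<Omega> (\<lambda>s. G (s, 1)) c x v - flux_form A \<Omega> (\<lambda>s. G (s, 0)) c x v) = dw0 A \<omega> F c x v" for c x v
  proof (cases "c \<in> charts_at A x")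
    case True
    note cA = charts_atD[OF True]
    have x: "chart_inv c (snd c x) = x" by (rule chart_inv_chart[OF cA])
    have bl: "bounded_linear (\<lambda>u. \<Omega> c x u v)" using form_linear(2)[OF True] by (simp add: linear_linear)
    define \<alpha> where "\<alpha> p = contract2 \<Omega> (X p) c x v" for p
    define \<beta> where "\<beta> p = contract2 \<Omega> (Y p) c x v" for p
    have slice: "smooth_on Q (\<lambda>p. Z p c x)"
      if "smooth_on (Q \<times> snd c ` fst c) (\<lambda>z. Z (fst z) c (chart_inv c (snd z)))" for Z :: "real \<times> real \<Rightarrow> ('m, 'e) vfield"
    proof -
      have "smooth_on Q (\<lambda>p. (\<lambda>z. Z (fst z) c (chart_inv c (snd z))) (p, snd c x))"
        by (rule smooth_on_compose[OF that smooth_on_Pair[OF smooth_on_ident smooth_on_const]]) (use cA in auto)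
      then show ?thesis by (simp add: x)
    qed
    note sX = slice[of X, OF smX[OF cA(1)]] and sY = slice[of Y, OF smY[OF cA(1)]]
    have s\<alpha>: "smooth_on Q \<alpha>" and s\<beta>: "smooth_on Q \<beta>"
      unfolding \<alpha>_def[abs_def] \<beta>_def[abs_def] contract2_def
      by (rule smooth_on_linear[OF bl sX], rule smooth_on_linear[OF bl sY])
    have eq: "frechet_derivative \<alpha> (at p) (1, 0) - frechet_derivative \<beta> (at p) (0, 1) = - dw0 A \<omega> (f p) c x v"
      if p: "p \<in> box (0, 0) (1, 1)" for p
    proof -
      have D: "frechet_derivative (\<lambda>p. \<Omega> c x (Z p c x) v) (at p) h = \<Omega> c x (frechet_derivative (\<lambda>p. Z p c x) (at p) h) v"
        if "smooth_on Q (\<lambda>p. Z p c x)" for Z :: "real \<times> real \<Rightarrow> ('m, 'e) vfield" and h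
        using frechet_derivative_eqI[OF bounded_linear.has_derivative[OF bl smooth_on_has_derivative[OF open_box
              smooth_on_subset[OF that IQ] p]]] by metis
      have "frechet_derivative \<alpha> (at p) (1, 0) - frechet_derivative \<beta> (at p) (0, 1) =
        \<Omega> c x (frechet_derivative (\<lambda>p. X p c x) (at p) (1, 0) - frechet_derivative (\<lambda>p. Y p c x) (at p) (0, 1)) v"
        unfolding \<alpha>_def[abs_def] \<beta>_def[abs_def] contract2_def D[of X, OF sX] D[of Y, OF sY]
        by (rule linear_diff[OF form_linear(2)[OF True], symmetric])
      also have "frechet_derivative (\<lambda>p. X p c x) (at p) (1, 0) - frechet_derivative (\<lambda>p. Y p c x) (at p) (0, 1)
          = - (chart_deriv c (X p c) x (Y p c x) - chart_deriv c (Y p c) x (X p c x))"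
        using velocity_commutator[OF fam p True] by (simp add: X_def Y_def)
      also have "\<Omega> c x \<dots> v = - dw0 A \<omega> (f p) c x v"
        by (simp only: f_def linear_neg[OF form_linear(2)[OF True]] contract_bracket_exact[OF k[OF subsetD[OF IQ p]] True])
      finally show ?thesis .
    qed
    have "continuous_on Q (\<lambda>p. - dw0 A \<omega> (f p) c x v)"
      using continuous_on_dw0[OF smf', of c x v] unfolding Qc by (rule continuous_on_minus)
    from unit_square_green[OF s\<alpha>[unfolded Q_def] s\<beta>[unfolded Q_def] this[unfolded Q_def] eq]
    have "(integral {0..1} (\<lambda>t. \<alpha> (1, t)) - integral {0..1} (\<lambda>t. \<alpha> (0, t)))
     - (integral {0..1} (\<lambda>s. \<beta> (s, 1)) - integral {0..1} (\<lambda>s. \<beta> (s, 0))) = integral Q (\<lambda>p. - dw0 A \<omega> (f p) c x v)"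
      by (simp add: Q_def)
    then show ?thesis
      unfolding dF by (simp add: flux_form_def \<alpha>_def \<beta>_def X_def Y_def)
  qed (simp add: flux_form_def contract2_def form_outside dw0_def d0_def one_form_outside[OF lee_form])
  then have "(\<lambda>c x v. (flux_form A \<Omega> (\<lambda>t. G (1, t)) c x v - flux_form A \<Omega> (\<lambda>t. G (0, t)) c x v)
      - (flux_form A \<Omega> (\<lambda>s. G (s, 1)) c x v - flux_form A \<Omega> (\<lambda>s. G (s, 0)) c x v)) = dw0 A \<omega> F"
    by (intro ext)
  then show ?thesis unfolding exact1_def using smF by blast
qed

end

section \<open>The flux of paths\<close>

context lcs begin

lemma flux_form_eqI:
  assumes "\<And>t. t \<in> {0..1} \<Longrightarrow> velocity A f t = velocity A g t"
  shows "flux_form A \<Omega> f = flux_form A \<Omega> g"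
  unfolding flux_form_def by (intro ext integral_cong) (simp add: assms)

lemma flux_form_cong:
  "(\<And>r. r \<in> {0..1} \<Longrightarrow> f r = g r) \<Longrightarrow> flux_form A \<Omega> f = flux_form A \<Omega> g"
  by (rule flux_form_eqI) (rule velocity_cong)

lemma flux_form_constant:
  assumes "\<And>r. r \<in> {0..1} \<Longrightarrow> f r = k"
  shows "flux_form A \<Omega> f = (\<lambda>c x v. 0)"
proof -
  have zero: "contract2 \<Omega> (velocity A f t) c x v = 0" if t: "t \<in> {0..1}" for t c x v
  proof -
    have "velocity A f t = velocity A (\<lambda>r. k) t" by (rule velocity_cong[OF assms t])
    also have "\<dots> = (\<lambda>c x. 0)" by (rule velocity_constant[OF t])
    finally show ?thesis
      by (cases "c \<in> charts_at A x") (simp_all add: contract2_def form_outside linear_0[OF form_linear(2)])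
  qed
  have "integral {0..1} (\<lambda>t. contract2 \<Omega> (velocity A f t) c x v) = integral {0..1::real} (\<lambda>t. 0 :: real)" for c x v
    by (rule integral_cong) (rule zero)
  then show ?thesis by (simp add: flux_form_def)
qed

abbreviation flux_class :: "(real \<Rightarrow> 'm \<Rightarrow> 'm) \<Rightarrow> ('m, 'e) form1 set" where
  "flux_class g \<equiv> class1 A \<omega> (flux_form A \<Omega> g)"

text \<open>A homotopy relative to endpoints is a square with two constant sides, which carry no flux.\<close>

lemma flux_class_homotopy:
  assumes "path_homotopic A \<Omega> \<omega> g h"
  shows "flux_class g = flux_class h"
proof -
  obtain G where fam: "diffeo_family A ({0..1} \<times> {0..1}) G"
    and paths: "\<And>s. s \<in> {0..1} \<Longrightarrow> (\<lambda>t. G (s, t)) \<in> kerPhi_paths A \<Omega> \<omega>"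
    and end1: "\<And>s. s \<in> {0..1} \<Longrightarrow> G (s, 1) = g 1"
    and kY: "\<And>s t. s \<in> {0..1} \<Longrightarrow> t \<in> {0..1} \<Longrightarrow> velocity A (\<lambda>r. G (r, t)) s \<in> kerPhi A \<Omega> \<omega>"
    and ends: "\<And>t. t \<in> {0..1} \<Longrightarrow> G (0, t) = g t" "\<And>t. t \<in> {0..1} \<Longrightarrow> G (1, t) = h t"
    using assms unfolding path_homotopic_def by blast
  have e0: "G (s, 0) = id" if "s \<in> {0..1}" for s using kerPhi_pathsD(1)[OF paths[OF that]] .
  have "flux_form A \<Omega> (\<lambda>s. G (s, 1)) = (\<lambda>c x v. 0)" "flux_form A \<Omega> (\<lambda>s. G (s, 0)) = (\<lambda>c x v. 0)"
    "flux_form A \<Omega> (\<lambda>t. G (0, t)) = flux_form A \<Omega> g" "flux_form A \<Omega> (\<lambda>t. G (1, t)) = flux_form A \<Omega> h"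
    by (rule flux_form_constant[OF end1], assumption, rule flux_form_constant[OF e0], assumption,
        rule flux_form_cong[OF ends(1)], assumption, rule flux_form_cong[OF ends(2)], assumption)
  then have "(\<lambda>c x v. flux_form A \<Omega> h c x v - flux_form A \<Omega> g c x v) \<in> exact1 A \<omega>"
    using square_flux[OF fam kerPhi_pathsD(4)[OF paths] kY] by simp
  from class1_eqI[OF this] show ?thesis by (rule sym)
qed

text \<open>In the square \<open>g\<^sub>s\<^sub>t \<circ> h\<^sub>t\<close> the side \<open>t = 0\<close> is constant, \<open>s = 0\<close> is \<open>h\<close>, \<open>s = 1\<close> is the product, and \<open>t = 1\<close> is \<open>g\<^sub>s \<circ> h\<^sub>1\<close>, which has
  the velocity of \<open>g\<close> since the factor on the right does not move.\<close>

lemma flux_class_compose: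
  assumes g: "g \<in> kerPhi_paths A \<Omega> \<omega>" and h: "h \<in> kerPhi_paths A \<Omega> \<omega>"
  shows "flux_class (\<lambda>t. g t \<circ> h t) = flux_class g \<otimes>\<^bsub>H1 A \<omega>\<^esub> flux_class h"
proof -
  note G = kerPhi_pathsD[OF g] and H = kerPhi_pathsD[OF h]
  define K :: "real \<times> real \<Rightarrow> 'm \<Rightarrow> 'm" where "K p = g (fst p * snd p) \<circ> h (snd p)" for p
  have fam: "diffeo_family A ({0..1} \<times> {0..1}) K"
    unfolding K_def[abs_def]
    by (intro diffeo_family_compose diffeo_family_reparametrize[OF G(2)] diffeo_family_reparametrize[OF H(2)]
        smooth_on_mult smooth_on_fst smooth_on_snd smooth_on_ident) (auto simp: mult_le_one)
  have st: "s * t \<in> {0..1}" if "s \<in> {0..1}" "t \<in> {0..1}" for s t :: real using that by (auto simp: mult_le_one)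
  have kX: "velocity A (\<lambda>r. K (s, r)) t \<in> kerPhi A \<Omega> \<omega>" if "s \<in> {0..1}" "t \<in> {0..1}" for s t
    using product_velocity_kerPhi[OF G(2) H(2) that G(3)[OF st[OF that]] G(4)[OF st[OF that]] H(4)[OF that(2)]]
    by (simp add: K_def)
  have kY: "velocity A (\<lambda>r. K (r, t)) s \<in> kerPhi A \<Omega> \<omega>" if "s \<in> {0..1}" "t \<in> {0..1}" for s t
    using product_velocity_kerPhi[OF G(2) diffeo_family_constant[OF diffeo_family_diffeo[OF H(2) that(2)]] that(2,1)
       G(3)[OF st[OF that(2,1)]] G(4)[OF st[OF that(2,1)]]]
    by (simp add: K_def velocity_constant[OF that(1)] kerPhi_zero mult.commute[of _ t])
  have right: "flux_form A \<Omega> (\<lambda>s. K (s, 1)) = flux_form A \<Omega> g"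
  proof (rule flux_form_eqI)
    fix t :: real assume t: "t \<in> {0..1}"
    show "velocity A (\<lambda>s. K (s, 1)) t = velocity A g t"
      using velocity_right_translate[of g t "h 1", OF diffeo_family_bij[OF G(2) t] diffeo_family_bij[OF H(2), of 1]] by (simp add: K_def)
  qed
  have left: "flux_form A \<Omega> (\<lambda>s. K (s, 0)) = (\<lambda>c x v. 0)"
    by (rule flux_form_constant[of _ id]) (simp add: K_def G(1) H(1))
  have top: "flux_form A \<Omega> (\<lambda>t. K (1, t)) = flux_form A \<Omega> (\<lambda>t. g t \<circ> h t)"
    by (rule flux_form_cong) (simp add: K_def)
  have bottom: "flux_form A \<Omega> (\<lambda>t. K (0, t)) = flux_form A \<Omega> h"
    by (rule flux_form_cong) (simp add: K_def G(1))
  have "(\<lambda>c x v. (flux_form A \<Omega> (\<lambda>t. g t \<circ> h t) c x v - flux_form A \<Omega> h c x v) - (flux_form A \<Omega> g c x v - 0)) \<in> exact1 A \<omega>"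
    using square_flux[OF fam kX kY] unfolding right left top bottom .
  then have "(\<lambda>c x v. flux_form A \<Omega> (\<lambda>t. g t \<circ> h t) c x v - (flux_form A \<Omega> g c x v + flux_form A \<Omega> h c x v)) \<in> exact1 A \<omega>"
    by (simp add: diff_diff_eq add.commute)
  from class1_eqI[OF this] show ?thesis unfolding class1_mult .
qed

lemma flux_class_constant: "(\<And>t. t \<in> {0..1} \<Longrightarrow> g t = id) \<Longrightarrow> flux_class g = \<one>\<^bsub>H1 A \<omega>\<^esub>"
  using flux_form_constant[of g id] class1_zero by simp

section \<open>The universal cover and the induced flux\<close>

lemma homotopy_rel_refl:
  assumes g: "g \<in> kerPhi_paths A \<Omega> \<omega>"
  shows "(g, g) \<in> homotopy_rel A \<Omega> \<omega>"
proof -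
  have "diffeo_family A ({0..1} \<times> {0..1}) (\<lambda>p::real \<times> real. g (snd p))"
    by (rule diffeo_family_reparametrize[OF kerPhi_pathsD(2)[OF g]]) (auto intro: smooth_on_snd smooth_on_ident)
  then have "path_homotopic A \<Omega> \<omega> g g"
    unfolding path_homotopic_def using g
    by (intro exI[of _ "\<lambda>p. g (snd p)"]) (simp add: velocity_constant kerPhi_zero)
  then show ?thesis using g by (simp add: homotopy_rel_def)
qed

text \<open>Homotopic paths have the same flux class and the same endpoint, so that the flux and the projection of a homotopy
  class, which are defined as the single element of a set of values, are those of any representative.\<close>

lemma
  assumes g: "g \<in> kerPhi_paths A \<Omega> \<omega>"
  shows flux_cover_class: "flux A \<Omega> \<omega> (homotopy_rel A \<Omega> \<omega> `` {g}) = flux_class g"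
    and cover_proj_class: "cover_proj (homotopy_rel A \<Omega> \<omega> `` {g}) = g 1"
proof -
  have mem: "g \<in> homotopy_rel A \<Omega> \<omega> `` {g}" using homotopy_rel_refl[OF g] by blast
  have hom: "path_homotopic A \<Omega> \<omega> g h" if "h \<in> homotopy_rel A \<Omega> \<omega> `` {g}" for h
    using that by (simp add: homotopy_rel_def)
  have "(\<lambda>h. flux_class h) ` (homotopy_rel A \<Omega> \<omega> `` {g}) = (\<lambda>h. flux_class g) ` (homotopy_rel A \<Omega> \<omega> `` {g})"
    by (rule image_cong[OF refl]) (rule flux_class_homotopy[OF hom, symmetric])
  also have "\<dots> = {flux_class g}" by (rule image_constant[OF mem])
  finally show "flux A \<Omega> \<omega> (homotopy_rel A \<Omega> \<omega> `` {g}) = flux_class g" unfolding flux_def by simp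
  have end_eq: "h 1 = g 1" if gh: "path_homotopic A \<Omega> \<omega> g h" for h
  proof -
    obtain G where G: "\<forall>s\<in>{0..1}. (\<lambda>t. G (s, t)) \<in> kerPhi_paths A \<Omega> \<omega> \<and> G (s, 1::real) = g 1"
      "\<forall>t\<in>{0..1}. G (0::real, t) = g t \<and> G (1, t) = h t"
      using gh unfolding path_homotopic_def by blast
    have "G (1, 1) = g 1" using bspec[OF G(1), of 1] by simp
    moreover have "G (1, 1) = h 1" using bspec[OF G(2), of 1] by simp
    ultimately show ?thesis by simp
  qed
  have "(\<lambda>h. h 1) ` (homotopy_rel A \<Omega> \<omega> `` {g}) = (\<lambda>h. g 1) ` (homotopy_rel A \<Omega> \<omega> `` {g})"
    by (rule image_cong[OF refl]) (rule end_eq[OF hom])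
  also have "\<dots> = {g 1}" by (rule image_constant[OF mem])
  finally show "cover_proj (homotopy_rel A \<Omega> \<omega> `` {g}) = g 1" unfolding cover_proj_def by simp
qed

lemma carrier_cover: "carrier (kerPhi_cover A \<Omega> \<omega>) = (\<lambda>g. homotopy_rel A \<Omega> \<omega> `` {g}) ` kerPhi_paths A \<Omega> \<omega>"
  by (auto simp: kerPhi_cover_def quotient_def)

lemma carrier_kerPhi0: "carrier (kerPhi0 A \<Omega> \<omega>) = (\<lambda>g. g 1) ` kerPhi_paths A \<Omega> \<omega>"
  by (auto simp: kerPhi0_def)

lemma period_group_eq: "period_group A \<Omega> \<omega> = flux_class ` {g \<in> kerPhi_paths A \<Omega> \<omega>. g 1 = id}"
proof -
  have "kerPhi_pi1 A \<Omega> \<omega> = (\<lambda>g. homotopy_rel A \<Omega> \<omega> `` {g}) ` {g \<in> kerPhi_paths A \<Omega> \<omega>. g 1 = id}"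
    unfolding kerPhi_pi1_def carrier_cover using cover_proj_class by auto
  then show ?thesis
    unfolding period_group_def by (simp add: image_image flux_cover_class)
qed

lemma Ham_eq: "Ham A \<Omega> \<omega> = (\<lambda>g. g 1) ` {g \<in> kerPhi_paths A \<Omega> \<omega>. flux_class g = \<one>\<^bsub>H1 A \<omega>\<^esub>}"
proof -
  have "kernel (kerPhi_cover A \<Omega> \<omega>) (H1 A \<omega>) (flux A \<Omega> \<omega>) =
     (\<lambda>g. homotopy_rel A \<Omega> \<omega> `` {g}) ` {g \<in> kerPhi_paths A \<Omega> \<omega>. flux_class g = \<one>\<^bsub>H1 A \<omega>\<^esub>}"
    unfolding kernel_def carrier_cover using flux_cover_class by auto
  then show ?thesis
    unfolding Ham_def by (simp add: image_image cover_proj_class)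
qed

end

text \<open>The two properties of the flux on which the exact sequence rests: its values are cohomology classes, and the
  periods form a subgroup.\<close>

locale lcs_flux = lcs +
  assumes flux_carrier: "g \<in> kerPhi_paths A \<Omega> \<omega> \<Longrightarrow> flux_class g \<in> carrier (H1 A \<omega>)"
    and subgroup_periods: "subgroup (period_group A \<Omega> \<omega>) (H1 A \<omega>)"
begin

interpretation H: comm_group "H1 A \<omega>" by (rule comm_group_H1)

lemma normal_periods: "period_group A \<Omega> \<omega> \<lhd> H1 A \<omega>"
  by (rule H.subgroup_imp_normal[OF subgroup_periods])

lemma flux_class_inverse:
  assumes g: "g \<in> kerPhi_paths A \<Omega> \<omega>"
  shows "flux_class (\<lambda>t. inv_into UNIV (g t)) = inv\<^bsub>H1 A \<omega>\<^esub> flux_class g"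
proof -
  let ?h = "\<lambda>t. inv_into UNIV (g t)"
  have h: "?h \<in> kerPhi_paths A \<Omega> \<omega>" by (rule kerPhi_paths_inverse[OF g])
  have "inv_into UNIV (g t) \<circ> g t = id" if "t \<in> {0..1}" for t
    using diffeo_family_bij[OF kerPhi_pathsD(2)[OF g] that] by (simp add: bij_is_inj)
  then have "flux_class ?h \<otimes>\<^bsub>H1 A \<omega>\<^esub> flux_class g = \<one>\<^bsub>H1 A \<omega>\<^esub>"
    using flux_class_compose[OF h g] flux_class_constant[of "\<lambda>t. ?h t \<circ> g t"] by simp
  then show ?thesis
    using H.inv_equality flux_carrier[OF g] flux_carrier[OF h] by metis
qed

text \<open>If \<open>g\<close> and \<open>h\<close> have the same endpoint, then \<open>h\<^sub>t \<circ> g\<^sub>t\<^sup>-\<^sup>1\<close> is a loop, so the fluxes of \<open>g\<close> and \<open>h\<close> differ by a period.\<close>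

lemma induced_flux_eq:
  assumes g: "g \<in> kerPhi_paths A \<Omega> \<omega>"
  shows "induced_flux A \<Omega> \<omega> (g 1) = period_group A \<Omega> \<omega> #>\<^bsub>H1 A \<omega>\<^esub> flux_class g"
proof -
  have indep: "period_group A \<Omega> \<omega> #>\<^bsub>H1 A \<omega>\<^esub> flux_class g = period_group A \<Omega> \<omega> #>\<^bsub>H1 A \<omega>\<^esub> flux_class h"
    if h: "h \<in> kerPhi_paths A \<Omega> \<omega>" and eq: "h 1 = g 1" for h
  proof (rule H.repr_independence[OF _ flux_carrier[OF g] subgroup_periods])
    let ?k = "\<lambda>t. h t \<circ> inv_into UNIV (g t)"
    note inv = kerPhi_paths_inverse[OF g]
    have "?k 1 = id"
      using surj_iff[THEN iffD1, OF bij_is_surj[OF diffeo_family_bij[OF kerPhi_pathsD(2)[OF g], of 1]]] by (simp add: eq)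
    then have "flux_class ?k \<in> period_group A \<Omega> \<omega>"
      unfolding period_group_eq using kerPhi_paths_compose[OF h inv] by blast
    moreover have "flux_class h = flux_class ?k \<otimes>\<^bsub>H1 A \<omega>\<^esub> flux_class g"
      unfolding flux_class_compose[OF h inv] flux_class_inverse[OF g]
      using flux_carrier[OF g] flux_carrier[OF h] by (simp add: H.m_assoc)
    ultimately show "flux_class h \<in> period_group A \<Omega> \<omega> #>\<^bsub>H1 A \<omega>\<^esub> flux_class g"
      unfolding r_coset_def by blast
  qed
  show ?thesis
    unfolding induced_flux_def
  proof (rule the_equality)
    show "\<forall>P\<in>carrier (kerPhi_cover A \<Omega> \<omega>). cover_proj P = g 1 \<longrightarrow>
       period_group A \<Omega> \<omega> #>\<^bsub>H1 A \<omega>\<^esub> flux_class g = period_group A \<Omega> \<omega> #>\<^bsub>H1 A \<omega>\<^esub> flux A \<Omega> \<omega> P"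
      unfolding carrier_cover using indep by (auto simp: cover_proj_class flux_cover_class)
    show "K = period_group A \<Omega> \<omega> #>\<^bsub>H1 A \<omega>\<^esub> flux_class g"
      if "\<forall>P\<in>carrier (kerPhi_cover A \<Omega> \<omega>). cover_proj P = g 1 \<longrightarrow> K = period_group A \<Omega> \<omega> #>\<^bsub>H1 A \<omega>\<^esub> flux A \<Omega> \<omega> P" for K
      using that g unfolding carrier_cover by (auto simp: cover_proj_class flux_cover_class)
  qed
qed

lemma induced_flux_hom: "induced_flux A \<Omega> \<omega> \<in> hom (kerPhi0 A \<Omega> \<omega>) (H1 A \<omega> Mod period_group A \<Omega> \<omega>)"
proof (rule homI)
  fix x assume "x \<in> carrier (kerPhi0 A \<Omega> \<omega>)"
  then obtain g where g: "g \<in> kerPhi_paths A \<Omega> \<omega>" "x = g 1" by (auto simp: carrier_kerPhi0)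
  show "induced_flux A \<Omega> \<omega> x \<in> carrier (H1 A \<omega> Mod period_group A \<Omega> \<omega>)"
    unfolding g(2) induced_flux_eq[OF g(1)] FactGroup_def
    using H.rcosetsI[OF subgroup.subset[OF subgroup_periods] flux_carrier[OF g(1)]] by simp
  fix y assume "y \<in> carrier (kerPhi0 A \<Omega> \<omega>)"
  then obtain h where h: "h \<in> kerPhi_paths A \<Omega> \<omega>" "y = h 1" by (auto simp: carrier_kerPhi0)
  have "x \<otimes>\<^bsub>kerPhi0 A \<Omega> \<omega>\<^esub> y = (\<lambda>t. g t \<circ> h t) 1" by (simp add: kerPhi0_def g(2) h(2))
  then show "induced_flux A \<Omega> \<omega> (x \<otimes>\<^bsub>kerPhi0 A \<Omega> \<omega>\<^esub> y) =
      induced_flux A \<Omega> \<omega> x \<otimes>\<^bsub>H1 A \<omega> Mod period_group A \<Omega> \<omega>\<^esub> induced_flux A \<Omega> \<omega> y"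
    using induced_flux_eq[OF kerPhi_paths_compose[OF g(1) h(1)]]
      normal.rcos_sum[OF normal_periods flux_carrier[OF g(1)] flux_carrier[OF h(1)]]
    by (simp add: g(2) h(2) induced_flux_eq[OF g(1)] induced_flux_eq[OF h(1)] flux_class_compose[OF g(1) h(1)] FactGroup_def)
qed

text \<open>A path whose flux is a period can be corrected by the inverse of a loop of the same flux: the endpoint stays
  and the flux becomes zero.\<close>

lemma Ham_kernel: "Ham A \<Omega> \<omega> = kernel (kerPhi0 A \<Omega> \<omega>) (H1 A \<omega> Mod period_group A \<Omega> \<omega>) (induced_flux A \<Omega> \<omega>)"
proof (intro equalityI subsetI)
  fix x assume "x \<in> Ham A \<Omega> \<omega>"
  then obtain g where g: "g \<in> kerPhi_paths A \<Omega> \<omega>" "flux_class g = \<one>\<^bsub>H1 A \<omega>\<^esub>" "x = g 1"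
    unfolding Ham_eq by blast
  then show "x \<in> kernel (kerPhi0 A \<Omega> \<omega>) (H1 A \<omega> Mod period_group A \<Omega> \<omega>) (induced_flux A \<Omega> \<omega>)"
    using induced_flux_eq[OF g(1)] H.coset_mult_one[OF subgroup.subset[OF subgroup_periods]]
    by (auto simp: kernel_def carrier_kerPhi0 FactGroup_def)
next
  fix x assume "x \<in> kernel (kerPhi0 A \<Omega> \<omega>) (H1 A \<omega> Mod period_group A \<Omega> \<omega>) (induced_flux A \<Omega> \<omega>)"
  then obtain g where g: "g \<in> kerPhi_paths A \<Omega> \<omega>" "x = g 1" "induced_flux A \<Omega> \<omega> (g 1) = period_group A \<Omega> \<omega>"
    by (auto simp: kernel_def carrier_kerPhi0 FactGroup_def)
  then have "flux_class g \<in> period_group A \<Omega> \<omega>"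
    using induced_flux_eq[OF g(1)]
      H.rcos_self[OF flux_carrier[OF g(1)] subgroup_periods] by simp
  then obtain l where l: "l \<in> kerPhi_paths A \<Omega> \<omega>" "l 1 = id" "flux_class l = flux_class g"
    unfolding period_group_eq by auto
  note inv = kerPhi_paths_inverse[OF l(1)]
  have "flux_class (\<lambda>t. g t \<circ> inv_into UNIV (l t)) = \<one>\<^bsub>H1 A \<omega>\<^esub>"
    unfolding flux_class_compose[OF g(1) inv] flux_class_inverse[OF l(1)] l(3)
    by (rule H.r_inv[OF flux_carrier[OF g(1)]])
  moreover have "g 1 \<circ> inv_into UNIV (l 1) = x" by (simp add: l(2) g(2) inv_id)
  ultimately show "x \<in> Ham A \<Omega> \<omega>"
    unfolding Ham_eq using kerPhi_paths_compose[OF g(1) inv] by (intro image_eqI[of _ _ "\<lambda>t. g t \<circ> inv_into UNIV (l t)"]) auto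
qed

end

theorem proposition3p4:
  fixes A :: "('m::{t2_space,second_countable_topology}, 'e::euclidean_space) chart set"
    and \<Omega> :: "('m, 'e) form2" and \<omega> :: "('m, 'e) form1"
  assumes "lcs_manifold A \<Omega> \<omega>"
    and "compact (UNIV :: 'm set)"
    and "\<exists>K. subgroup K (H1 A \<omega>) \<and> period_group A \<Omega> \<omega> \<subseteq> K \<and>
           flux A \<Omega> \<omega> ` carrier (kerPhi_cover A \<Omega> \<omega>) = K"
    and "discrete_subgroup_H1 A \<omega> (period_group A \<Omega> \<omega>)"
    and "induced_flux A \<Omega> \<omega> ` carrier (kerPhi0 A \<Omega> \<omega>) =
           carrier (H1 A \<omega> Mod period_group A \<Omega> \<omega>)"
  shows "short_exact (kerPhi0 A \<Omega> \<omega>\<lparr>carrier := Ham A \<Omega> \<omega>\<rparr>) (\<lambda>g. g)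
           (kerPhi0 A \<Omega> \<omega>) (induced_flux A \<Omega> \<omega>) (H1 A \<omega> Mod period_group A \<Omega> \<omega>)"
proof -
  interpret lcs A \<Omega> \<omega>
    using assms(1,2) by unfold_locales (auto simp: lcs_manifold_def)
  have flux: "flux_class g \<in> carrier (H1 A \<omega>)" if g: "g \<in> kerPhi_paths A \<Omega> \<omega>" for g
  proof -
    obtain K where K: "subgroup K (H1 A \<omega>)" "flux A \<Omega> \<omega> ` carrier (kerPhi_cover A \<Omega> \<omega>) = K"
      using assms(3) by blast
    have "flux A \<Omega> \<omega> (homotopy_rel A \<Omega> \<omega> `` {g}) \<in> K" unfolding K(2)[symmetric] carrier_cover using g by blast
    then show ?thesis using subgroup.subset[OF K(1)] by (auto simp: flux_cover_class[OF g])
  qed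
  have periods: "subgroup (period_group A \<Omega> \<omega>) (H1 A \<omega>)"
    using assms(4) unfolding discrete_subgroup_H1_def by blast
  interpret lcs_flux A \<Omega> \<omega>
    by (intro lcs_flux.intro lcs_axioms lcs_flux_axioms.intro flux periods)
  let ?G = "kerPhi0 A \<Omega> \<omega>" and ?Q = "H1 A \<omega> Mod period_group A \<Omega> \<omega>"
  have Q: "group ?Q" by (rule normal.factorgroup_is_group[OF normal_periods])
  interpret group_hom ?G ?Q "induced_flux A \<Omega> \<omega>"
    by (intro group_hom.intro group_hom_axioms.intro group_kerPhi0 Q induced_flux_hom)
  have Ham: "subgroup (Ham A \<Omega> \<omega>) ?G" unfolding Ham_kernel by (rule subgroup_kernel)
  show ?thesis
    unfolding short_exact_def
  proof (intro conjI)
    show "group (?G\<lparr>carrier := Ham A \<Omega> \<omega>\<rparr>)" by (rule group.subgroup_imp_group[OF group_kerPhi0 Ham])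
    show "(\<lambda>g. g) \<in> mon (?G\<lparr>carrier := Ham A \<Omega> \<omega>\<rparr>) ?G"
      using subgroup.subset[OF Ham] by (auto simp: mon_def hom_def)
    show "(\<lambda>g. g) ` carrier (?G\<lparr>carrier := Ham A \<Omega> \<omega>\<rparr>) = kernel ?G ?Q (induced_flux A \<Omega> \<omega>)"
      using Ham_kernel by simp
    show "induced_flux A \<Omega> \<omega> \<in> epi ?G ?Q" using induced_flux_hom assms(5) by (simp add: epi_def)
  qed (rule group_kerPhi0, rule Q)
qed

end
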